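(* Let $\Delta(x,\hat x)=(x-\hat x)^2$, let the perception measure be $\phi(p_X,p_{\hat X})=W_2^2(p_X,p_{\hat X})$, let $\mu_X\in\mathbb R$, $\sigma_X>0$, $R,R_c\ge0$ and $P\ge0$. Then $$\underline D'(R,R_c,P|\mathcal N(\mu_X,\sigma_X^2))\le D(R,R_c,P|\mathcal N(\mu_X,\sigma_X^2))\le\overline D'(R,R_c,P|\mathcal N(\mu_X,\sigma_X^2)),$$ where $$\overline D'(R,R_c,P|\mathcal N(\mu_X,\sigma_X^2)):=\begin{cases}\sigma_X^2-\sigma_X^2\xi^2(R,R_c)&\text{if }\sigma_X-\sqrt P\le\sigma_X\xi(R,R_c),\\ \sigma_X^2+(\sigma_X-\sqrt P)^2-2\sigma_X(\sigma_X-\sqrt P)\xi(R,R_c)&\text{if }\sigma_X-\sqrt P>\sigma_X\xi(R,R_c),\end{cases}$$ $$\underline D'(R,R_c,P|\mathcal N(\mu_X,\sigma_X^2)):=\min_{\sigma_{\hat X}\in[(\sigma_X-\sqrt P)_+,\sigma_X]}\Big(\sigma_X^2+\sigma_{\hat X}^2-2\sigma_X\sqrt{(1-e^{-2R})\big(\sigma_{\hat X}^2-(\sigma_Xe^{-(R+R_c)}-\sqrt P)_+^2\big)}\Big).$$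
   Context: All logarithms are natural; $(a)_+:=\max\{a,0\}$ and $(a)_+^2:=((a)_+)^2$. $\xi(R,R_c):=\sqrt{(1-e^{-2R})(1-e^{-2(R+R_c)})}$. $W_2^2(p,q):=\inf_{\pi\in\Pi(p,q)}\mathbb E_\pi[(A-B)^2]$, where $\Pi(p,q)$ is the set of couplings of $p$ and $q$. Rate-distortion-perception function $D(R,R_c,P|p_X)$: for a block length $n\ge1$, a code consists of finite sets $\mathcal J,\mathcal K$, a random seed $K$ uniform on $\mathcal K$ and independent of the source sequence $X^n=(X_1,\dots,X_n)$ (i.i.d. with marginal $p_X$), a stochastic encoder $p_{J|X^nK}$ producing $J\in\mathcal J$, and a stochastic decoder $p_{\hat X^n|JK}$ producing $\hat X^n\in\mathbb R^n$. A level $D$ is achievable subject to rate constraints $(R,R_c)$ and perception constraint $P$ if for some $n$ there is such a code with $\frac1n\log|\mathcal J|\le R$, $\frac1n\log|\mathcal K|\le R_c$, $\frac1n\sum_{t=1}^n\mathbb E[\Delta(X_t,\hat X_t)]\le D$, $\frac1n\sum_{t=1}^n\phi(p_{X_t},p_{\hat X_t})\le P$, and $\hat X_1,\dots,\hat X_n$ i.i.d. (with some marginal). $D(R,R_c,P|p_X)$ is the infimum of achievable $D$. *)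

theory Defs
  imports "HOL-Probability.Probability"
begin

definition W2sq :: "real measure \<Rightarrow> real measure \<Rightarrow> ennreal" where
  "W2sq p q = (INF \<pi> \<in> {\<pi>. prob_space \<pi> \<and> sets \<pi> = sets (borel \<Otimes>\<^sub>M borel)
                   \<and> distr \<pi> borel fst = p \<and> distr \<pi> borel snd = q}.
                 \<integral>\<^sup>+ z. ennreal ((fst z - snd z)\<^sup>2) \<partial>\<pi>)"

definition xi :: "real \<Rightarrow> real \<Rightarrow> real" where
  "xi R Rc = sqrt ((1 - exp (-2*R)) * (1 - exp (-2*(R+Rc))))"

definition pos :: "real \<Rightarrow> real" where "pos a = max a 0"

abbreviation Rn :: "nat \<Rightarrow> (nat \<Rightarrow> real) measure" where
  "Rn n \<equiv> PiM {..<n} (\<lambda>_. (borel :: real measure))"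

text \<open>Message set J = {..<NJ}, seed set K = {..<NK}.
  enc: stochastic encoder (kernel from X^n and K to J); dec: stochastic decoder
  (kernel from J and K to R^n).\<close>
definition valid_code :: "nat \<Rightarrow> nat \<Rightarrow> nat \<Rightarrow> ((nat \<Rightarrow> real) \<Rightarrow> nat \<Rightarrow> nat measure)
    \<Rightarrow> (nat \<Rightarrow> nat \<Rightarrow> (nat \<Rightarrow> real) measure) \<Rightarrow> bool" where
  "valid_code n NJ NK enc dec \<longleftrightarrow> 1 \<le> n \<and> 1 \<le> NJ \<and> 1 \<le> NK \<and>
     (\<lambda>(x, k). enc x k) \<in> measurable (Rn n \<Otimes>\<^sub>M count_space {..<NK}) (prob_algebra (count_space {..<NJ})) \<and>
     (\<forall>j<NJ. \<forall>k<NK. dec j k \<in> space (prob_algebra (Rn n)))"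

definition code_joint :: "nat \<Rightarrow> real measure \<Rightarrow> nat \<Rightarrow> ((nat \<Rightarrow> real) \<Rightarrow> nat \<Rightarrow> nat measure)
    \<Rightarrow> (nat \<Rightarrow> nat \<Rightarrow> (nat \<Rightarrow> real) measure) \<Rightarrow> ((nat \<Rightarrow> real) \<times> (nat \<Rightarrow> real)) measure" where
  "code_joint n pX NK enc dec =
     PiM {..<n} (\<lambda>_. pX) \<bind> (\<lambda>x. uniform_count_measure {..<NK} \<bind> (\<lambda>k.
       enc x k \<bind> (\<lambda>j. dec j k \<bind> (\<lambda>xh. return (Rn n \<Otimes>\<^sub>M Rn n) (x, xh)))))"

definition achievable :: "real measure \<Rightarrow> real \<Rightarrow> real \<Rightarrow> real \<Rightarrow> real \<Rightarrow> bool" where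
  "achievable pX R Rc P D \<longleftrightarrow> 0 \<le> D \<and>
     (\<exists>n NJ NK enc dec. valid_code n NJ NK enc dec \<and>
        ln (real NJ) / real n \<le> R \<and> ln (real NK) / real n \<le> Rc \<and>
        (let M = code_joint n pX NK enc dec in
          ennreal (1 / real n) * (\<Sum>t<n. \<integral>\<^sup>+ z. ennreal ((fst z t - snd z t)\<^sup>2) \<partial>M) \<le> ennreal D \<and>
          ennreal (1 / real n) * (\<Sum>t<n. W2sq (distr M borel (\<lambda>z. fst z t)) (distr M borel (\<lambda>z. snd z t)))
             \<le> ennreal P \<and>
          (\<exists>q. prob_space q \<and> sets q = sets (borel :: real measure) \<and>
               distr M (Rn n) snd = PiM {..<n} (\<lambda>_. q))))"

definition RDP :: "real measure \<Rightarrow> real \<Rightarrow> real \<Rightarrow> real \<Rightarrow> real" where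
  "RDP pX R Rc P = Inf {D. achievable pX R Rc P D}"

definition gauss :: "real \<Rightarrow> real \<Rightarrow> real measure" where
  "gauss \<mu> \<sigma> = density lborel (normal_density \<mu> \<sigma>)"

definition D_upper :: "real \<Rightarrow> real \<Rightarrow> real \<Rightarrow> real \<Rightarrow> real" where
  "D_upper \<sigma> R Rc P =
     (if \<sigma> - sqrt P \<le> \<sigma> * xi R Rc then \<sigma>\<^sup>2 - \<sigma>\<^sup>2 * (xi R Rc)\<^sup>2
      else \<sigma>\<^sup>2 + (\<sigma> - sqrt P)\<^sup>2 - 2 * \<sigma> * (\<sigma> - sqrt P) * xi R Rc)"

definition D_lower :: "real \<Rightarrow> real \<Rightarrow> real \<Rightarrow> real \<Rightarrow> real" where
  "D_lower \<sigma> R Rc P =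
     Inf ((\<lambda>s. \<sigma>\<^sup>2 + s\<^sup>2 - 2 * \<sigma> * sqrt ((1 - exp (-2*R)) *
              (s\<^sup>2 - (pos (\<sigma> * exp (-(R+Rc)) - sqrt P))\<^sup>2))) ` {pos (\<sigma> - sqrt P)..\<sigma>})"

end

theory Submission
  imports Defs
begin

text \<open>
  Lower bound. Given the message and the seed, source and reconstruction are independent, so their
  correlation is that of their conditional means, and by Cauchy-Schwarz it is bounded by the energies
  of these means. A quantizer of \<open>N(0, I)\<close> with \<open>M\<close> cells has distortion at least \<open>n M powr (-2/n)\<close>, which bounds
  the energy on the source side. On the reconstruction side the same bound is applied to a Gaussian vector coupled
  letterwise to the reconstruction, at a cost of \<open>sqrt P\<close> in the triangle inequality.

  Upper bound. Random Gaussian codewords and a truncated likelihood ratio give, for every seed, a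
  quantizer of the source, and, over all seeds, a quantizer of the output vector. Both are made balanced,
  that is, the index is exactly uniform; hence they can be glued along the index, and the output is
  exactly i.i.d. Gaussian. Both quantizers are almost optimal, so the converse forces their centroids to be
  almost proportional to the codewords, which yields the correlation \<open>xi R Rc\<close>.
\<close>

section \<open>Product measures and Gaussian vectors\<close>

text \<open>The obstacle is that the output has to be exactly i.i.d. at a finite block length,
  whereas a random codebook only produces laws close to a product. Exactness is bought by forcing
  all cells to have the same mass, at a cost governed by the part of space that the codebook fails
  to cover. The two factors of \<open>xi\<close> count cells. Given the seed, the source meets a
  quantizer with \<open>NJ\<close> cells, since the seed is independent of it; the output is cut
  into all \<open>NK * NJ\<close> cells, since the decoder knows message and seed. The same count
  bounds the two energies in the lower bound. The gap between the bounds comes from the output law: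
  in the lower bound it is known only through its distance from a Gaussian, and this distance is
  paid for as \<open>sqrt P\<close>. There the i.i.d. condition is what lets one coupling of single
  letters be used as a product. As the block length may be chosen anew for each error, no limit of
  codes is taken, and Chebyshev estimates together with \<open>exp (- x) \<le> 1 / x\<close> are
  precise enough.\<close>

lemma distr_PiM_family:
  fixes P :: "'i \<Rightarrow> 'a measure" and N :: "'i \<Rightarrow> 'b measure"
  assumes I: "finite I" and P: "\<And>i. prob_space (P i)"
    and f: "\<And>i. f i \<in> P i \<rightarrow>\<^sub>M N i"
  shows "distr (PiM I P) (PiM I N) (\<lambda>x. \<lambda>i\<in>I. f i (x i)) = PiM I (\<lambda>i. distr (P i) (N i) (f i))"
proof -
  interpret P: product_prob_space P using P by (rule product_prob_spaceI)
  interpret Q: product_prob_space "\<lambda>i. distr (P i) (N i) (f i)"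
    by (intro product_prob_spaceI prob_space.prob_space_distr P f)
  have m: "(\<lambda>x. \<lambda>i\<in>I. f i (x i)) \<in> PiM I P \<rightarrow>\<^sub>M PiM I N"
    by (intro measurable_restrict measurable_compose[OF _ f] measurable_component_singleton)
  show ?thesis
  proof (rule Q.PiM_eqI)
    show "sets (distr (PiM I P) (PiM I N) (\<lambda>x. \<lambda>i\<in>I. f i (x i))) =
        sets (PiM I (\<lambda>i. distr (P i) (N i) (f i)))"
      unfolding sets_distr by (intro sets_PiM_cong) auto
    fix A assume A: "\<And>i. i \<in> I \<Longrightarrow> A i \<in> sets (distr (P i) (N i) (f i))"
    have "emeasure (distr (PiM I P) (PiM I N) (\<lambda>x. \<lambda>i\<in>I. f i (x i))) (Pi\<^sub>E I A)
      = emeasure (PiM I P) ((\<lambda>x. \<lambda>i\<in>I. f i (x i)) -` Pi\<^sub>E I A \<inter> space (PiM I P))"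
      using A I by (intro emeasure_distr m sets_PiM_I_finite) auto
    also have "(\<lambda>x. \<lambda>i\<in>I. f i (x i)) -` Pi\<^sub>E I A \<inter> space (PiM I P)
       = Pi\<^sub>E I (\<lambda>i. f i -` A i \<inter> space (P i))"
      by (auto simp: space_PiM PiE_iff)
    also have "emeasure (PiM I P) \<dots> = (\<Prod>i\<in>I. emeasure (P i) (f i -` A i \<inter> space (P i)))"
      using A I by (intro P.emeasure_PiM) (auto intro: measurable_sets[OF f])
    also have "\<dots> = (\<Prod>i\<in>I. emeasure (distr (P i) (N i) (f i)) (A i))"
      using A by (intro prod.cong refl emeasure_distr[symmetric] f) auto
    finally show "emeasure (distr (PiM I P) (PiM I N) (\<lambda>x. \<lambda>i\<in>I. f i (x i))) (Pi\<^sub>E I A) =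
      (\<Prod>i\<in>I. emeasure (distr (P i) (N i) (f i)) (A i))" .
  qed (fact I)
qed

text \<open>Boxes determine a product measure, and on a box the integrand factors. This turns
  one-dimensional likelihood ratios into the likelihood ratio of Gaussian vectors.\<close>

lemma density_PiM:
  assumes I: "finite I" and P: "\<And>i. prob_space (P i)"
    and f: "\<And>i. f i \<in> borel_measurable (P i)" and D: "\<And>i. prob_space (density (P i) (f i))"
  shows "density (PiM I P) (\<lambda>x. \<Prod>i\<in>I. f i (x i)) = PiM I (\<lambda>i. density (P i) (f i))"
proof -
  interpret P: product_prob_space P using P by (rule product_prob_spaceI)
  interpret Q: product_prob_space "\<lambda>i. density (P i) (f i)" using D by (rule product_prob_spaceI)
  have m: "(\<lambda>x. \<Prod>i\<in>I. f i (x i)) \<in> borel_measurable (PiM I P)"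
    by (intro borel_measurable_prod_ennreal measurable_compose[OF _ f] measurable_component_singleton)
  show ?thesis
  proof (rule Q.PiM_eqI)
    show "sets (density (PiM I P) (\<lambda>x. \<Prod>i\<in>I. f i (x i))) = sets (PiM I (\<lambda>i. density (P i) (f i)))"
      unfolding sets_density by (intro sets_PiM_cong) auto
    fix A assume A: "\<And>i. i \<in> I \<Longrightarrow> A i \<in> sets (density (P i) (f i))"
    have "emeasure (density (PiM I P) (\<lambda>x. \<Prod>i\<in>I. f i (x i))) (Pi\<^sub>E I A)
      = (\<integral>\<^sup>+x. (\<Prod>i\<in>I. f i (x i)) * indicator (Pi\<^sub>E I A) x \<partial>PiM I P)"
      using A I by (intro emeasure_density m sets_PiM_I_finite) auto
    also have "\<dots> = (\<integral>\<^sup>+x. (\<Prod>i\<in>I. f i (x i) * indicator (A i) (x i)) \<partial>PiM I P)"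
    proof (intro nn_integral_cong)
      fix x assume "x \<in> space (PiM I P)"
      then have e: "x \<in> extensional I" by (auto simp: space_PiM PiE_def)
      \<comment> \<open>\<open>Pi\<^sub>E\<close> also asks for extensionality, which every point of
        the space has; only there does the indicator factor.\<close>
      have "(indicator (Pi\<^sub>E I A) x :: ennreal) = (\<Prod>i\<in>I. indicator (A i) (x i))"
      proof (cases "\<forall>i\<in>I. x i \<in> A i")
        case True
        then have "x \<in> Pi\<^sub>E I A" using e by (simp add: PiE_iff)
        then show ?thesis using True by simp
      next
        case False
        then obtain k where k: "k \<in> I" "x k \<notin> A k" by auto
        then have "x \<notin> Pi\<^sub>E I A" by (auto simp: PiE_iff)
        moreover have "(\<Prod>i\<in>I. indicator (A i) (x i)) = (0::ennreal)"
          using I k by (intro prod_zero) (auto intro!: bexI[of _ k])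
        ultimately show ?thesis by simp
      qed
      then show "(\<Prod>i\<in>I. f i (x i)) * indicator (Pi\<^sub>E I A) x = (\<Prod>i\<in>I. f i (x i) * indicator (A i) (x i))"
        by (simp only: prod.distrib)
    qed
    also have "\<dots> = (\<Prod>i\<in>I. \<integral>\<^sup>+x. f i x * indicator (A i) x \<partial>P i)"
      using A f I by (intro P.product_nn_integral_prod) auto
    also have "\<dots> = (\<Prod>i\<in>I. emeasure (density (P i) (f i)) (A i))"
      using A f by (intro prod.cong refl) (simp add: emeasure_density)
    finally show "emeasure (density (PiM I P) (\<lambda>x. \<Prod>i\<in>I. f i (x i))) (Pi\<^sub>E I A) =
      (\<Prod>i\<in>I. emeasure (density (P i) (f i)) (A i))" .
  qed (fact I)
qed

lemma integral_PiM_component: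
  fixes f :: "'a \<Rightarrow> real"
  assumes P: "prob_space P" and i: "i \<in> I" and f: "f \<in> borel_measurable P"
  shows "(\<integral>x. f (x i) \<partial>PiM I (\<lambda>_. P)) = (\<integral>x. f x \<partial>P)"
    and "integrable (PiM I (\<lambda>_. P)) (\<lambda>x. f (x i)) \<longleftrightarrow> integrable P f"
proof -
  have d: "distr (PiM I (\<lambda>_. P)) P (\<lambda>x. x i) = P"
    using distr_PiM_component[of I "\<lambda>_. P" i] P i by simp
  have m: "(\<lambda>x. x i) \<in> PiM I (\<lambda>_. P) \<rightarrow>\<^sub>M P" using i by (rule measurable_component_singleton)
  show "(\<integral>x. f (x i) \<partial>PiM I (\<lambda>_. P)) = (\<integral>x. f x \<partial>P)"
    using integral_distr[OF m f] d by simp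
  show "integrable (PiM I (\<lambda>_. P)) (\<lambda>x. f (x i)) \<longleftrightarrow> integrable P f"
    using integrable_distr_eq[OF m f] d by simp
qed

lemma nn_integral_PiM_component:
  assumes P: "prob_space P" and i: "i \<in> I" and f: "f \<in> borel_measurable P"
  shows "(\<integral>\<^sup>+x. f (x i) \<partial>PiM I (\<lambda>_. P)) = (\<integral>\<^sup>+x. f x \<partial>P)"
proof -
  have d: "distr (PiM I (\<lambda>_. P)) P (\<lambda>x. x i) = P"
    using distr_PiM_component[of I "\<lambda>_. P" i] P i by simp
  have m: "(\<lambda>x. x i) \<in> PiM I (\<lambda>_. P) \<rightarrow>\<^sub>M P" using i by (rule measurable_component_singleton)
  show ?thesis using nn_integral_distr[OF m, of f] f d by simp
qed

lemma integral_PiM_two_components: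
  fixes f g :: "'a \<Rightarrow> real"
  assumes I: "finite I" and pP: "prob_space P" and ij: "i \<in> I" "j \<in> I" "i \<noteq> j"
    and f: "integrable P f" and g: "integrable P g"
  shows "(\<integral>x. f (x i) * g (x j) \<partial>PiM I (\<lambda>_. P)) = (\<integral>x. f x \<partial>P) * (\<integral>x. g x \<partial>P)"
    and "integrable (PiM I (\<lambda>_. P)) (\<lambda>x. f (x i) * g (x j))"
proof -
  interpret product_prob_space "\<lambda>_. P" using pP by (intro product_prob_spaceI)
  \<comment> \<open>The product rule wants one factor per coordinate, so all coordinates other than
    \<open>i\<close> and \<open>j\<close> get the constant 1.\<close>
  define h where "h k = (if k = i then f else if k = j then g else (\<lambda>_. 1))" for k
  have split: "(\<Prod>k\<in>I. F k) = F i * F j * (\<Prod>k\<in>I - {i} - {j}. F k)" for F :: "_ \<Rightarrow> real"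
    using I ij by (subst prod.remove[of _ i], simp, simp, subst prod.remove[of _ j]) (auto simp: mult_ac)
  have rest: "(\<Prod>k\<in>I - {i} - {j}. h k (x k)) = 1" for x
    by (intro prod.neutral) (auto simp: h_def)
  have e: "(\<Prod>k\<in>I. h k (x k)) = f (x i) * g (x j)" for x
    unfolding split rest using ij by (simp add: h_def)
  have ih: "integrable P (h k)" for k using f g by (simp add: h_def)
  have r2: "(\<Prod>k\<in>I - {i} - {j}. \<integral>x. h k x \<partial>P) = 1"
    by (intro prod.neutral) (auto simp: h_def prob_space.prob_space[OF pP])
  show "(\<integral>x. f (x i) * g (x j) \<partial>PiM I (\<lambda>_. P)) = (\<integral>x. f x \<partial>P) * (\<integral>x. g x \<partial>P)"
    using product_integral_prod[OF I ih, of "\<lambda>k. k"] ij unfolding e split r2 by (simp add: h_def)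
  show "integrable (PiM I (\<lambda>_. P)) (\<lambda>x. f (x i) * g (x j))"
    using product_integrable_prod[OF I ih, of "\<lambda>k. k"] unfolding e .
qed

text \<open>Independent centred summands: the mixed products integrate to 0. The sum runs over a
  subset \<open>J\<close> of the coordinates so that the codewords of a single seed can be treated
  inside the whole codebook.\<close>

lemma PiM_sum_square:
  fixes h :: "'i \<Rightarrow> 'a \<Rightarrow> real"
  assumes I: "finite I" and JI: "J \<subseteq> I" and P: "prob_space P"
    and h: "\<And>i. i \<in> J \<Longrightarrow> integrable P (h i)" and z: "\<And>i. i \<in> J \<Longrightarrow> (\<integral>x. h i x \<partial>P) = 0"
    and h2: "\<And>i. i \<in> J \<Longrightarrow> integrable P (\<lambda>x. (h i x)\<^sup>2)"
  shows "(\<integral>x. (\<Sum>i\<in>J. h i (x i))\<^sup>2 \<partial>PiM I (\<lambda>_. P)) = (\<Sum>i\<in>J. \<integral>x. (h i x)\<^sup>2 \<partial>P)"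
    and "integrable (PiM I (\<lambda>_. P)) (\<lambda>x. (\<Sum>i\<in>J. h i (x i))\<^sup>2)"
proof -
  have fJ: "finite J" using I JI by (rule finite_subset[rotated])
  have e: "(\<Sum>i\<in>J. h i (x i))\<^sup>2 = (\<Sum>i\<in>J. \<Sum>j\<in>J. h i (x i) * h j (x j))" for x
    by (simp add: power2_eq_square sum_product)
  have int: "integrable (PiM I (\<lambda>_. P)) (\<lambda>x. h i (x i) * h j (x j))" if "i \<in> J" "j \<in> J" for i j
  proof (cases "i = j")
    case True
    then show ?thesis
      using integral_PiM_component(2)[OF P, of i I "\<lambda>x. (h i x)\<^sup>2"] that JI h2[of i]
      by (auto simp: power2_eq_square)
  next
    case False
    then show ?thesis using that JI by (intro integral_PiM_two_components(2)[OF I P] h) auto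
  qed
  have val: "(\<integral>x. h i (x i) * h j (x j) \<partial>PiM I (\<lambda>_. P)) = (if i = j then \<integral>x. (h i x)\<^sup>2 \<partial>P else 0)"
    if "i \<in> J" "j \<in> J" for i j
  proof (cases "i = j")
    case True
    then show ?thesis
      using integral_PiM_component(1)[OF P, of i I "\<lambda>x. (h i x)\<^sup>2"] that JI h2[of i]
      by (auto simp: power2_eq_square)
  next
    case False
    then show ?thesis using integral_PiM_two_components(1)[OF I P, of i j "h i" "h j"] that JI h z by auto
  qed
  show "integrable (PiM I (\<lambda>_. P)) (\<lambda>x. (\<Sum>i\<in>J. h i (x i))\<^sup>2)"
    unfolding e by (intro Bochner_Integration.integrable_sum int)
  show "(\<integral>x. (\<Sum>i\<in>J. h i (x i))\<^sup>2 \<partial>PiM I (\<lambda>_. P)) = (\<Sum>i\<in>J. \<integral>x. (h i x)\<^sup>2 \<partial>P)"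
    unfolding e using fJ by (simp add: int val Bochner_Integration.integral_sum sum.delta)
qed

section \<open>Normal laws, their moments and standard normal vectors\<close>

lemma sets_gauss[simp, measurable_cong]: "sets (gauss m c) = sets borel"
  by (simp add: gauss_def)

lemma space_gauss[simp]: "space (gauss m c) = UNIV"
  by (simp add: gauss_def)

lemma prob_space_gauss: "0 < c \<Longrightarrow> prob_space (gauss m c)"
  unfolding gauss_def by (rule prob_space_normal_density)

lemma prob_space_gauss1[simp]: "prob_space (gauss 0 1)"
  by (rule prob_space_gauss) simp

abbreviation std :: "nat \<Rightarrow> (nat \<Rightarrow> real) measure" where
  "std n \<equiv> PiM {..<n} (\<lambda>_. gauss 0 1)"

lemma sets_PiM_gauss[simp, measurable_cong]: "sets (PiM I (\<lambda>i. gauss (m i) (c i))) = sets (PiM I (\<lambda>_. borel))"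
  by (intro sets_PiM_cong) auto

lemma prob_space_std[simp]: "prob_space (std n)"
  by (intro prob_space_PiM) simp

lemma integral_gauss:
  fixes f :: "real \<Rightarrow> real"
  shows "f \<in> borel_measurable borel \<Longrightarrow> (\<integral>x. f x \<partial>gauss 0 1) = (\<integral>x. std_normal_density x * f x \<partial>lborel)"
    and "f \<in> borel_measurable borel \<Longrightarrow> integrable (gauss 0 1) f \<longleftrightarrow> integrable lborel (\<lambda>x. std_normal_density x * f x)"
  unfolding gauss_def
  by (subst integral_real_density; simp) (subst integrable_real_density; simp)

lemma gauss_moments:
  "integrable (gauss 0 1) (\<lambda>x. x)" "(\<integral>x. x \<partial>gauss 0 1) = 0"
  "integrable (gauss 0 1) (\<lambda>x. x\<^sup>2)" "(\<integral>x. x\<^sup>2 \<partial>gauss 0 1) = 1"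
  "integrable (gauss 0 1) (\<lambda>x. x ^ 4)" "(\<integral>x. x ^ 4 \<partial>gauss 0 1) = 3"
  using std_normal_moment_odd[of 0] std_normal_moment_even[of 1] std_normal_moment_even[of 2]
  by (auto simp: integral_gauss has_bochner_integral_iff fact_numeral)

lemma gauss_affine:
  assumes "0 < c"
  shows "distr (gauss 0 1) borel (\<lambda>y. m + c * y) = gauss m c"
proof -
  interpret prob_space "gauss 0 1" by simp
  have "distributed (gauss 0 1) lborel (\<lambda>x. x) (normal_density 0 1)"
    unfolding distributed_def by (auto simp: gauss_def distr_id2)
  from normal_density_affine[OF this, of c m] assms
  have "distr (gauss 0 1) lborel (\<lambda>x. m + c * x) = gauss m c"
    by (simp add: distributed_def gauss_def)
  moreover have "distr (gauss 0 1) borel (\<lambda>x. m + c * x) = distr (gauss 0 1) lborel (\<lambda>x. m + c * x)"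
    by (intro distr_cong) auto
  ultimately show ?thesis by simp
qed

lemma PiM_gauss_affine:
  assumes "0 < c"
  shows "distr (std n) (Rn n) (\<lambda>y. \<lambda>t\<in>{..<n}. m t + c * y t) = PiM {..<n} (\<lambda>t. gauss (m t) c)"
  using distr_PiM_family[of "{..<n}" "\<lambda>_. gauss 0 1" "\<lambda>t y. m t + c * y" "\<lambda>_. borel"]
  by (simp add: gauss_affine[OF assms])

definition sqn :: "nat \<Rightarrow> (nat \<Rightarrow> real) \<Rightarrow> real" where
  "sqn n x = (\<Sum>t<n. (x t)\<^sup>2)"

definition sqd :: "nat \<Rightarrow> (nat \<Rightarrow> real) \<Rightarrow> (nat \<Rightarrow> real) \<Rightarrow> real" where
  "sqd n x y = (\<Sum>t<n. (x t - y t)\<^sup>2)"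

lemma sqn_nonneg[simp]: "0 \<le> sqn n x" by (simp add: sqn_def sum_nonneg)
lemma sqd_nonneg[simp]: "0 \<le> sqd n x y" by (simp add: sqd_def sum_nonneg)

lemma std_component_moments:
  assumes "t < n"
  shows "integrable (std n) (\<lambda>x. x t)" "(\<integral>x. x t \<partial>std n) = 0"
    "integrable (std n) (\<lambda>x. (x t)\<^sup>2)" "(\<integral>x. (x t)\<^sup>2 \<partial>std n) = 1"
proof -
  have t: "t \<in> {..<n}" using assms by simp
  have m: "(\<lambda>x. x) \<in> borel_measurable (gauss 0 1)" "(\<lambda>x. x\<^sup>2) \<in> borel_measurable (gauss 0 1)"
    by measurable
  note 1 = integral_PiM_component[OF prob_space_gauss1 t m(1)]
  note 2 = integral_PiM_component[OF prob_space_gauss1 t m(2)]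
  show "integrable (std n) (\<lambda>x. x t)" "(\<integral>x. x t \<partial>std n) = 0"
    "integrable (std n) (\<lambda>x. (x t)\<^sup>2)" "(\<integral>x. (x t)\<^sup>2 \<partial>std n) = 1"
    unfolding 1 2 by (rule gauss_moments)+
qed

lemma std_sqn:
  "integrable (std n) (sqn n)" "(\<integral>x. sqn n x \<partial>std n) = real n"
proof -
  have i: "integrable (std n) (\<lambda>x. (x t)\<^sup>2)" if "t \<in> {..<n}" for t
    using that by (intro std_component_moments) simp
  show "integrable (std n) (sqn n)"
    unfolding sqn_def[abs_def] by (intro Bochner_Integration.integrable_sum i)
  have "(\<integral>x. sqn n x \<partial>std n) = (\<Sum>t<n. \<integral>x. (x t)\<^sup>2 \<partial>std n)"
    unfolding sqn_def by (intro Bochner_Integration.integral_sum i)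
  also have "\<dots> = (\<Sum>t<n. 1)" by (intro sum.cong refl std_component_moments) simp
  finally show "(\<integral>x. sqn n x \<partial>std n) = real n" by simp
qed

text \<open>The one concentration input for norms. A letter contributes 3 - 2 + 1 = 2, because the
  fourth moment of a standard normal variable is 3, and independence adds up the letters.\<close>

lemma std_sqn_variance:
  "integrable (std n) (\<lambda>x. (sqn n x - real n)\<^sup>2)" "(\<integral>x. (sqn n x - real n)\<^sup>2 \<partial>std n) = 2 * real n"
proof -
  have G: "Sigma_Algebra.measure (gauss 0 1) UNIV = 1"
    using prob_space.prob_space[OF prob_space_gauss1] by simp
  interpret prob_space "gauss 0 1" by simp
  have e: "sqn n x - real n = (\<Sum>t<n. (x t)\<^sup>2 - 1)" for x
    by (simp add: sqn_def sum_subtractf)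
  have q: "(y\<^sup>2 - 1)\<^sup>2 = y ^ 4 - 2 * y\<^sup>2 + 1" for y :: real
    by (simp add: power2_eq_square power4_eq_xxxx algebra_simps)
  have i2: "integrable (gauss 0 1) (\<lambda>y. (y\<^sup>2 - 1)\<^sup>2)" and v2: "(\<integral>y. (y\<^sup>2 - 1)\<^sup>2 \<partial>gauss 0 1) = 2"
    unfolding q by (simp_all add: gauss_moments G)
  have i1: "integrable (gauss 0 1) (\<lambda>y. y\<^sup>2 - 1)" "(\<integral>y. (y\<^sup>2 - 1) \<partial>gauss 0 1) = 0"
    by (simp_all add: gauss_moments G)
  note * = PiM_sum_square[OF finite_lessThan subset_refl prob_space_gauss1 i1 i2, of n]
  show "integrable (std n) (\<lambda>x. (sqn n x - real n)\<^sup>2)"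
    unfolding e by (rule *(2))
  show "(\<integral>x. (sqn n x - real n)\<^sup>2 \<partial>std n) = 2 * real n"
    unfolding e *(1) v2 by simp
qed

section \<open>The joint law of a code\<close>

lemma nn_integral_finite_count_space:
  assumes M: "sets M = sets (count_space A)" and A: "finite A"
  shows "(\<integral>\<^sup>+x. f x \<partial>M) = (\<Sum>a\<in>A. emeasure M {a} * f a)"
proof -
  have sp: "space M = A" using sets_eq_imp_space_eq[OF M] by simp
  have "(\<integral>\<^sup>+x. f x \<partial>M) = (\<integral>\<^sup>+x. (\<Sum>a\<in>A. f a * indicator {a} x) \<partial>M)"
    by (intro nn_integral_cong) (simp add: sp A indicator_def if_distrib cong: if_cong)
  also have "\<dots> = (\<Sum>a\<in>A. \<integral>\<^sup>+x. f a * indicator {a} x \<partial>M)"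
    using M by (intro nn_integral_sum borel_measurable_times_ennreal borel_measurable_const borel_measurable_indicator) auto
  also have "\<dots> = (\<Sum>a\<in>A. emeasure M {a} * f a)"
    using M by (intro sum.cong refl) (simp add: nn_integral_cmult_indicator mult.commute)
  finally show ?thesis .
qed

context
  fixes n NJ NK enc dec pX
  assumes V: "valid_code n NJ NK enc dec" and pX: "prob_space pX" "sets pX = sets (borel :: real measure)"
begin

private abbreviation "A \<equiv> PiM {..<n} (\<lambda>_. pX)"
private abbreviation "C \<equiv> uniform_count_measure {..<NK}"
private abbreviation "J \<equiv> count_space {..<NJ}"

private lemma sA[measurable_cong]: "sets A = sets (Rn n)"
  by (intro sets_PiM_cong) (auto simp: pX)

private lemma spA: "space A = space (Rn n)"
  by (rule sets_eq_imp_space_eq[OF sA])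

private lemma pC: "prob_space C"
  using V by (intro prob_space_uniform_count_measure) (auto simp: valid_code_def lessThan_empty_iff)

private lemma enc_meas: "(\<lambda>(x, k). enc x k) \<in> A \<Otimes>\<^sub>M C \<rightarrow>\<^sub>M prob_algebra J"
proof -
  have "sets (A \<Otimes>\<^sub>M C) = sets (Rn n \<Otimes>\<^sub>M count_space {..<NK})"
    by (intro sets_pair_measure_cong sA) (simp add: sets_uniform_count_measure_count_space)
  then show ?thesis
    using V measurable_cong_sets[of "A \<Otimes>\<^sub>M C" "Rn n \<Otimes>\<^sub>M count_space {..<NK}" "prob_algebra J" "prob_algebra J"]
    by (simp add: valid_code_def)
qed

private lemma dec_meas:
  assumes f: "f \<in> L \<rightarrow>\<^sub>M J" and g: "g \<in> L \<rightarrow>\<^sub>M count_space {..<NK}"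
  shows "(\<lambda>l. dec (f l) (g l)) \<in> L \<rightarrow>\<^sub>M prob_algebra (Rn n)"
  by (rule measurable_compose_countable'[OF _ f], rule measurable_compose_countable'[OF _ g])
     (use V in \<open>auto simp: valid_code_def\<close>)

text \<open>The three stages treat the nested kernels from the inside out, each jointly in all
  variables that are still free. Joint measurability is what the next outer bind asks for, and it
  also justifies exchanging bind and integral.\<close>

private lemma stage3:
  "(\<lambda>((x, k), j). dec j k \<bind> (\<lambda>y. return (Rn n \<Otimes>\<^sub>M Rn n) (x, y)))
     \<in> (A \<Otimes>\<^sub>M C) \<Otimes>\<^sub>M J \<rightarrow>\<^sub>M prob_algebra (Rn n \<Otimes>\<^sub>M Rn n)"
  unfolding split_beta'
proof (rule measurable_bind_prob_space2)
  have gc: "(\<lambda>p. snd (fst p)) \<in> (A \<Otimes>\<^sub>M C) \<Otimes>\<^sub>M J \<rightarrow>\<^sub>M count_space {..<NK}"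
  proof -
    have "(\<lambda>p. snd (fst p)) \<in> (A \<Otimes>\<^sub>M C) \<Otimes>\<^sub>M J \<rightarrow>\<^sub>M C" by measurable
    then show ?thesis
      using measurable_cong_sets[OF refl sets_uniform_count_measure_count_space[of "{..<NK}"]] by blast
  qed
  show "(\<lambda>p. dec (snd p) (snd (fst p))) \<in> (A \<Otimes>\<^sub>M C) \<Otimes>\<^sub>M J \<rightarrow>\<^sub>M prob_algebra (Rn n)"
    by (rule dec_meas[OF _ gc]) measurable
  have "(\<lambda>q. (fst (fst (fst q)), snd q)) \<in> ((A \<Otimes>\<^sub>M C) \<Otimes>\<^sub>M J) \<Otimes>\<^sub>M Rn n \<rightarrow>\<^sub>M Rn n \<Otimes>\<^sub>M Rn n"
    by measurable
  then have "(\<lambda>q. return (Rn n \<Otimes>\<^sub>M Rn n) (fst (fst (fst q)), snd q))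
    \<in> ((A \<Otimes>\<^sub>M C) \<Otimes>\<^sub>M J) \<Otimes>\<^sub>M Rn n \<rightarrow>\<^sub>M prob_algebra (Rn n \<Otimes>\<^sub>M Rn n)"
    by (rule measurable_compose[OF _ measurable_return_prob_space])
  then show "(\<lambda>(p, y). return (Rn n \<Otimes>\<^sub>M Rn n) (fst (fst p), y))
    \<in> ((A \<Otimes>\<^sub>M C) \<Otimes>\<^sub>M J) \<Otimes>\<^sub>M Rn n \<rightarrow>\<^sub>M prob_algebra (Rn n \<Otimes>\<^sub>M Rn n)"
    by (simp add: split_beta')
qed

private lemma stage2:
  "(\<lambda>(x, k). enc x k \<bind> (\<lambda>j. dec j k \<bind> (\<lambda>y. return (Rn n \<Otimes>\<^sub>M Rn n) (x, y))))
     \<in> A \<Otimes>\<^sub>M C \<rightarrow>\<^sub>M prob_algebra (Rn n \<Otimes>\<^sub>M Rn n)"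
  unfolding split_beta'
  by (rule measurable_bind_prob_space2[OF enc_meas[unfolded split_beta']])
     (use stage3 in \<open>simp add: split_beta'\<close>)

private lemma stage1:
  "(\<lambda>x. C \<bind> (\<lambda>k. enc x k \<bind> (\<lambda>j. dec j k \<bind> (\<lambda>y. return (Rn n \<Otimes>\<^sub>M Rn n) (x, y)))))
     \<in> A \<rightarrow>\<^sub>M prob_algebra (Rn n \<Otimes>\<^sub>M Rn n)"
  by (rule measurable_bind_prob_space2[OF _ stage2]) (simp add: space_prob_algebra pC)

lemma sets_code_joint: "sets (code_joint n pX NK enc dec) = sets (Rn n \<Otimes>\<^sub>M Rn n)"
  unfolding code_joint_def
  by (rule sets_bind'[OF _ stage1]) (auto simp: space_prob_algebra intro!: prob_space_PiM pX)

text \<open>From here on a code is a finite family of weights on the source, each paired with a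
  decoder law; the nested binds are not opened again.\<close>

lemma nn_integral_code_joint:
  assumes f: "f \<in> borel_measurable (Rn n \<Otimes>\<^sub>M Rn n)"
  shows "(\<integral>\<^sup>+z. f z \<partial>code_joint n pX NK enc dec) =
    (\<integral>\<^sup>+x. (\<Sum>k<NK. \<Sum>j<NJ. ennreal (1 / real NK) * (emeasure (enc x k) {j} * (\<integral>\<^sup>+y. f (x, y) \<partial>dec j k))) \<partial>A)"
proof -
  have "(\<integral>\<^sup>+z. f z \<partial>code_joint n pX NK enc dec) =
    (\<integral>\<^sup>+x. \<integral>\<^sup>+z. f z \<partial>(C \<bind> (\<lambda>k. enc x k \<bind> (\<lambda>j. dec j k \<bind> (\<lambda>y. return (Rn n \<Otimes>\<^sub>M Rn n) (x, y))))) \<partial>A)"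
    unfolding code_joint_def by (rule nn_integral_bind[OF f measurable_prob_algebraD[OF stage1]])
  also have "\<dots> = (\<integral>\<^sup>+x. (\<Sum>k<NK. \<Sum>j<NJ. ennreal (1 / real NK) * (emeasure (enc x k) {j} * (\<integral>\<^sup>+y. f (x, y) \<partial>dec j k))) \<partial>A)"
  proof (intro nn_integral_cong)
    fix x assume x: "x \<in> space A"
    have 2: "(\<lambda>k. enc x k \<bind> (\<lambda>j. dec j k \<bind> (\<lambda>y. return (Rn n \<Otimes>\<^sub>M Rn n) (x, y))))
      \<in> C \<rightarrow>\<^sub>M prob_algebra (Rn n \<Otimes>\<^sub>M Rn n)"
      using measurable_compose[OF measurable_Pair1'[OF x] stage2] by simp
    have "(\<integral>\<^sup>+z. f z \<partial>(C \<bind> (\<lambda>k. enc x k \<bind> (\<lambda>j. dec j k \<bind> (\<lambda>y. return (Rn n \<Otimes>\<^sub>M Rn n) (x, y))))))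
      = (\<integral>\<^sup>+k. \<integral>\<^sup>+z. f z \<partial>(enc x k \<bind> (\<lambda>j. dec j k \<bind> (\<lambda>y. return (Rn n \<Otimes>\<^sub>M Rn n) (x, y)))) \<partial>C)"
      by (rule nn_integral_bind[OF f measurable_prob_algebraD[OF 2]])
    also have "\<dots> = (\<Sum>k<NK. ennreal (1 / real NK) * (\<integral>\<^sup>+z. f z \<partial>(enc x k \<bind> (\<lambda>j. dec j k \<bind> (\<lambda>y. return (Rn n \<Otimes>\<^sub>M Rn n) (x, y))))))"
      by (subst nn_integral_finite_count_space[where A="{..<NK}"])
         (auto simp: sets_uniform_count_measure emeasure_uniform_count_measure)
    also have "\<dots> = (\<Sum>k<NK. \<Sum>j<NJ. ennreal (1 / real NK) * (emeasure (enc x k) {j} * (\<integral>\<^sup>+y. f (x, y) \<partial>dec j k)))"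
      unfolding sum_distrib_left[symmetric]
    proof (intro sum.cong refl arg_cong2[where f="(*)"])
      fix k assume k: "k \<in> {..<NK}"
      then have xk: "(x, k) \<in> space (A \<Otimes>\<^sub>M C)"
        using x by (simp add: space_pair_measure space_uniform_count_measure)
      have e: "enc x k \<in> space (prob_algebra J)"
        using measurable_space[OF enc_meas xk] by simp
      have 3: "(\<lambda>j. dec j k \<bind> (\<lambda>y. return (Rn n \<Otimes>\<^sub>M Rn n) (x, y))) \<in> J \<rightarrow>\<^sub>M prob_algebra (Rn n \<Otimes>\<^sub>M Rn n)"
        using measurable_compose[OF measurable_Pair1'[OF xk] stage3] by simp
      have se: "sets (enc x k) = sets J" using e by (simp add: space_prob_algebra)
      have k3: "(\<lambda>j. dec j k \<bind> (\<lambda>y. return (Rn n \<Otimes>\<^sub>M Rn n) (x, y))) \<in> enc x k \<rightarrow>\<^sub>M subprob_algebra (Rn n \<Otimes>\<^sub>M Rn n)"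
        using measurable_prob_algebraD[OF 3] measurable_cong_sets[OF se refl] by blast
      have "(\<integral>\<^sup>+z. f z \<partial>(enc x k \<bind> (\<lambda>j. dec j k \<bind> (\<lambda>y. return (Rn n \<Otimes>\<^sub>M Rn n) (x, y)))))
        = (\<integral>\<^sup>+j. \<integral>\<^sup>+z. f z \<partial>(dec j k \<bind> (\<lambda>y. return (Rn n \<Otimes>\<^sub>M Rn n) (x, y))) \<partial>enc x k)"
        by (rule nn_integral_bind[OF f k3])
      also have "\<dots> = (\<Sum>j<NJ. emeasure (enc x k) {j} * (\<integral>\<^sup>+z. f z \<partial>(dec j k \<bind> (\<lambda>y. return (Rn n \<Otimes>\<^sub>M Rn n) (x, y)))))"
        by (rule nn_integral_finite_count_space[OF se]) simp
      also have "\<dots> = (\<Sum>j<NJ. emeasure (enc x k) {j} * (\<integral>\<^sup>+y. f (x, y) \<partial>dec j k))"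
      proof (intro sum.cong refl arg_cong2[where f="(*)"])
        fix j assume j: "j \<in> {..<NJ}"
        have d: "sets (dec j k) = sets (Rn n)"
          using V j k by (simp add: valid_code_def space_prob_algebra)
        have px: "(\<lambda>y. (x, y)) \<in> Rn n \<rightarrow>\<^sub>M Rn n \<Otimes>\<^sub>M Rn n"
          using x unfolding spA by (rule measurable_Pair1')
        have "(\<lambda>y. return (Rn n \<Otimes>\<^sub>M Rn n) (x, y)) \<in> Rn n \<rightarrow>\<^sub>M subprob_algebra (Rn n \<Otimes>\<^sub>M Rn n)"
          by (rule measurable_compose[OF px return_measurable])
        then have 4: "(\<lambda>y. return (Rn n \<Otimes>\<^sub>M Rn n) (x, y)) \<in> dec j k \<rightarrow>\<^sub>M subprob_algebra (Rn n \<Otimes>\<^sub>M Rn n)"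
          using measurable_cong_sets[OF d refl] by blast
        have "(\<integral>\<^sup>+z. f z \<partial>(dec j k \<bind> (\<lambda>y. return (Rn n \<Otimes>\<^sub>M Rn n) (x, y))))
          = (\<integral>\<^sup>+y. \<integral>\<^sup>+z. f z \<partial>return (Rn n \<Otimes>\<^sub>M Rn n) (x, y) \<partial>dec j k)"
          by (rule nn_integral_bind[OF f 4])
        also have "\<dots> = (\<integral>\<^sup>+y. f (x, y) \<partial>dec j k)"
        proof (intro nn_integral_cong)
          fix y assume "y \<in> space (dec j k)"
          then have "y \<in> space (Rn n)" using sets_eq_imp_space_eq[OF d] by simp
          then show "(\<integral>\<^sup>+z. f z \<partial>return (Rn n \<Otimes>\<^sub>M Rn n) (x, y)) = f (x, y)"
            using x f unfolding spA by (intro nn_integral_return) (auto simp: space_pair_measure)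
        qed
        finally show "(\<integral>\<^sup>+z. f z \<partial>(dec j k \<bind> (\<lambda>y. return (Rn n \<Otimes>\<^sub>M Rn n) (x, y)))) = (\<integral>\<^sup>+y. f (x, y) \<partial>dec j k)" .
      qed
      finally show "(\<integral>\<^sup>+z. f z \<partial>(enc x k \<bind> (\<lambda>j. dec j k \<bind> (\<lambda>y. return (Rn n \<Otimes>\<^sub>M Rn n) (x, y)))))
        = (\<Sum>j<NJ. emeasure (enc x k) {j} * (\<integral>\<^sup>+y. f (x, y) \<partial>dec j k))" .
    qed
    finally show "(\<integral>\<^sup>+z. f z \<partial>(C \<bind> (\<lambda>k. enc x k \<bind> (\<lambda>j. dec j k \<bind> (\<lambda>y. return (Rn n \<Otimes>\<^sub>M Rn n) (x, y))))))
      = (\<Sum>k<NK. \<Sum>j<NJ. ennreal (1 / real NK) * (emeasure (enc x k) {j} * (\<integral>\<^sup>+y. f (x, y) \<partial>dec j k)))" .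
  qed
  finally show ?thesis .
qed

lemma code_encoder:
  assumes k: "k < NK"
  shows "\<And>j. (\<lambda>x. measure (enc x k) {j}) \<in> borel_measurable (Rn n)"
    and "\<And>x. x \<in> space (Rn n) \<Longrightarrow> (\<Sum>j<NJ. measure (enc x k) {j}) = 1"
    and "\<And>x j. x \<in> space (Rn n) \<Longrightarrow> emeasure (enc x k) {j} = ennreal (measure (enc x k) {j})"
proof -
  have kC: "k \<in> space C" using k by (simp add: space_uniform_count_measure)
  have 1: "(\<lambda>x. enc x k) \<in> A \<rightarrow>\<^sub>M prob_algebra J"
    using measurable_compose[OF measurable_Pair2'[OF kC] enc_meas] by simp
  have e: "prob_space (enc x k)" "sets (enc x k) = sets J" if "x \<in> space (Rn n)" for x
    using measurable_space[OF 1] that spA by (auto simp: space_prob_algebra)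
  show "(\<lambda>x. measure (enc x k) {j}) \<in> borel_measurable (Rn n)" for j
  proof (cases "j < NJ")
    case True
    then have "(\<lambda>x. measure (enc x k) {j}) \<in> borel_measurable A"
      by (intro measurable_compose[OF 1 measurable_measure_prob_algebra]) simp
    then show ?thesis using measurable_cong_sets[OF sA refl] by blast
  next
    case False
    \<comment> \<open>Outside the message set the singleton is not an event of the encoder law, and
      \<open>measure\<close> has the default value 0 there.\<close>
    have "(\<lambda>x. 0::real) \<in> borel_measurable (Rn n)" by simp
    then show ?thesis
      by (rule measurable_cong[THEN iffD1, rotated]) (use False e in \<open>auto simp: measure_notin_sets\<close>)
  qed
  fix x assume x: "x \<in> space (Rn n)"
  interpret E: prob_space "enc x k" using e[OF x] by simp
  show "emeasure (enc x k) {j} = ennreal (measure (enc x k) {j})" for j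
    by (rule E.emeasure_eq_measure)
  have sp: "space (enc x k) = {..<NJ}" using sets_eq_imp_space_eq[OF e(2)[OF x]] by simp
  have "measure (enc x k) (\<Union>j\<in>{..<NJ}. {j}) = (\<Sum>j<NJ. measure (enc x k) {j})"
    using e(2)[OF x] by (intro E.finite_measure_finite_Union) (auto simp: disjoint_family_on_def)
  then show "(\<Sum>j<NJ. measure (enc x k) {j}) = 1" using E.prob_space sp by simp
qed

lemma code_decoder:
  assumes "j < NJ" "k < NK"
  shows "prob_space (dec j k)" "sets (dec j k) = sets (Rn n)"
  using V assms by (auto simp: valid_code_def space_prob_algebra)

lemma code_NK: "0 < NK" using V by (simp add: valid_code_def)

lemma distr_code_joint_fst:
  assumes t: "t < n"
  shows "distr (code_joint n pX NK enc dec) borel (\<lambda>z. fst z t) = pX"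
proof (rule measure_eqI)
  let ?M = "code_joint n pX NK enc dec"
  show "sets (distr ?M borel (\<lambda>z. fst z t)) = sets pX" by (simp add: pX)
  fix B assume "B \<in> sets (distr ?M borel (\<lambda>z. fst z t))"
  then have B[measurable]: "B \<in> sets borel" by simp
  note [measurable_cong] = sets_code_joint
  have [measurable]: "(\<lambda>x. x t) \<in> borel_measurable (Rn n)"
    using t by (intro measurable_component_singleton) simp
  have "emeasure (distr ?M borel (\<lambda>z. fst z t)) B = (\<integral>\<^sup>+z. indicator B (fst z t) \<partial>?M)"
  proof -
    have m: "(\<lambda>z. fst z t) \<in> ?M \<rightarrow>\<^sub>M borel" by measurable
    have "emeasure (distr ?M borel (\<lambda>z. fst z t)) B = (\<integral>\<^sup>+x. indicator B x \<partial>distr ?M borel (\<lambda>z. fst z t))"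
      by simp
    also have "\<dots> = (\<integral>\<^sup>+z. indicator B (fst z t) \<partial>?M)"
      by (rule nn_integral_distr[OF m]) simp
    finally show ?thesis .
  qed
  also have "\<dots> = (\<integral>\<^sup>+x. (\<Sum>k<NK. \<Sum>j<NJ. ennreal (1 / real NK) * (emeasure (enc x k) {j} * (\<integral>\<^sup>+y. indicator B (x t) \<partial>dec j k))) \<partial>A)"
    by (subst nn_integral_code_joint) simp_all
  also have "\<dots> = (\<integral>\<^sup>+x. indicator B (x t) \<partial>A)"
  proof (intro nn_integral_cong)
    fix x assume "x \<in> space A"
    then have x: "x \<in> space (Rn n)" by (simp add: spA)
    have "(\<Sum>k<NK. \<Sum>j<NJ. ennreal (1 / real NK) * (emeasure (enc x k) {j} * (\<integral>\<^sup>+y. indicator B (x t) \<partial>dec j k)))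
      = (\<Sum>k<NK. \<Sum>j<NJ. ennreal (1 / real NK * measure (enc x k) {j}) * indicator B (x t))"
    proof (intro sum.cong refl)
      fix k j assume kj: "k \<in> {..<NK}" "j \<in> {..<NJ}"
      have "emeasure (dec j k) (space (dec j k)) = 1"
        using kj code_decoder[of j k] by (intro prob_space.emeasure_space_1) auto
      then show "ennreal (1 / real NK) * (emeasure (enc x k) {j} * (\<integral>\<^sup>+y. indicator B (x t) \<partial>dec j k)) =
         ennreal (1 / real NK * measure (enc x k) {j}) * indicator B (x t)"
        using kj code_encoder(3)[OF _ x, of k j] by (simp add: ennreal_mult[of "1 / real NK"] mult_ac del: ennreal_1 times_divide_eq_left times_divide_eq_right)
    qed
    also have "\<dots> = ennreal (\<Sum>k<NK. \<Sum>j<NJ. 1 / real NK * measure (enc x k) {j}) * indicator B (x t)"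
      by (simp add: sum_distrib_right[symmetric] sum_nonneg)
    also have "(\<Sum>k<NK. \<Sum>j<NJ. 1 / real NK * measure (enc x k) {j}) = (\<Sum>k<NK. 1 / real NK)"
    proof (intro sum.cong refl)
      fix k assume "k \<in> {..<NK}"
      then show "(\<Sum>j<NJ. 1 / real NK * measure (enc x k) {j}) = 1 / real NK"
        using code_encoder(2)[OF _ x, of k] by (simp only: sum_distrib_left[symmetric]) simp
    qed
    also have "\<dots> = 1" using code_NK by simp
    finally show "(\<Sum>k<NK. \<Sum>j<NJ. ennreal (1 / real NK) * (emeasure (enc x k) {j} * (\<integral>\<^sup>+y. indicator B (x t) \<partial>dec j k)))
      = indicator B (x t)" by simp
  qed
  also have "\<dots> = (\<integral>\<^sup>+x. indicator B x \<partial>pX)"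
    using t by (intro nn_integral_PiM_component pX) (auto simp: pX measurable_cong_sets[OF pX(2)])
  also have "\<dots> = emeasure pX B" by (simp add: pX)
  finally show "emeasure (distr ?M borel (\<lambda>z. fst z t)) B = emeasure pX B" .
qed

lemma distr_code_joint_snd:
  assumes q: "prob_space q" "sets q = sets (borel :: real measure)"
    and mq: "distr (code_joint n pX NK enc dec) (Rn n) snd = PiM {..<n} (\<lambda>_. q)" and t: "t < n"
  shows "distr (code_joint n pX NK enc dec) borel (\<lambda>z. snd z t) = q"
proof -
  let ?M = "code_joint n pX NK enc dec"
  have s: "snd \<in> ?M \<rightarrow>\<^sub>M Rn n"
    using measurable_cong_sets[OF sets_code_joint refl] measurable_snd by blast
  have c: "(\<lambda>x. x t) \<in> borel_measurable (Rn n)" using t by (intro measurable_component_singleton) simp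
  have "distr ?M borel (\<lambda>z. snd z t) = distr (distr ?M (Rn n) snd) borel (\<lambda>x. x t)"
    using distr_distr[OF c s] by (simp add: comp_def)
  also have "\<dots> = distr (PiM {..<n} (\<lambda>_. q)) q (\<lambda>x. x t)"
    unfolding mq by (intro distr_cong) (auto simp: q)
  also have "\<dots> = q" using t q by (intro distr_PiM_component) auto
  finally show ?thesis .
qed

text \<open>For an i.i.d. output every letter has the same pair of marginals, so the averaged
  constraint is a constraint on a single letter.\<close>

lemma average_perception:
  assumes q: "prob_space q" "sets q = sets (borel :: real measure)"
    and mq: "distr (code_joint n pX NK enc dec) (Rn n) snd = PiM {..<n} (\<lambda>_. q)"
  shows "ennreal (1 / real n) * (\<Sum>t<n. W2sq (distr (code_joint n pX NK enc dec) borel (\<lambda>z. fst z t))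
    (distr (code_joint n pX NK enc dec) borel (\<lambda>z. snd z t))) = W2sq pX q"
proof -
  have n: "0 < n" using V by (simp add: valid_code_def)
  have "(\<Sum>t<n. W2sq (distr (code_joint n pX NK enc dec) borel (\<lambda>z. fst z t))
    (distr (code_joint n pX NK enc dec) borel (\<lambda>z. snd z t))) = (\<Sum>t<n. W2sq pX q)"
    using distr_code_joint_fst distr_code_joint_snd[OF q mq] by (intro sum.cong refl) simp
  also have "\<dots> = ennreal (real n) * W2sq pX q" by (simp add: ennreal_of_nat_eq_real_of_nat)
  moreover have "ennreal (1 / real n) * ennreal (real n) = 1" using n by (simp add: ennreal_mult[symmetric])
  ultimately show ?thesis by (simp add: mult.assoc[symmetric])
qed

end

section \<open>The converse for Gaussian quantizers\<close>

text \<open>A weight of mass \<open>r = 0\<close> needs no separate treatment because of \<open>m / 0 = 0\<close>.\<close>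

lemma weighted_variance:
  fixes f w :: "'a \<Rightarrow> real"
  assumes "integrable Q w" "integrable Q (\<lambda>x. w x * f x)" "integrable Q (\<lambda>x. w x * (f x)\<^sup>2)"
  defines "r \<equiv> \<integral>x. w x \<partial>Q" and "m \<equiv> \<integral>x. w x * f x \<partial>Q"
  shows "(\<integral>x. w x * (f x - m / r)\<^sup>2 \<partial>Q) = (\<integral>x. w x * (f x)\<^sup>2 \<partial>Q) - m\<^sup>2 / r"
proof -
  have e: "w x * (f x - c)\<^sup>2 = w x * (f x)\<^sup>2 - 2 * c * (w x * f x) + c\<^sup>2 * w x" for x c
    by (simp add: power2_eq_square algebra_simps)
  have "(\<integral>x. w x * (f x - m / r)\<^sup>2 \<partial>Q) = (\<integral>x. w x * (f x)\<^sup>2 \<partial>Q) - 2 * (m / r) * m + (m / r)\<^sup>2 * r"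
    unfolding e using assms(1-3) by (simp add: r_def m_def)
  also have "\<dots> = (\<integral>x. w x * (f x)\<^sup>2 \<partial>Q) - m\<^sup>2 / r"
    by (cases "r = 0") (simp_all add: power2_eq_square field_simps)
  finally show ?thesis .
qed

text \<open>The partition of unity is assumed only almost everywhere, because on the output side the
  weights will be Radon-Nikodym derivatives.\<close>

lemma AE_weight_bounds:
  fixes w :: "'u \<Rightarrow> 'a \<Rightarrow> real"
  assumes U: "finite U" and w: "\<And>u. u \<in> U \<Longrightarrow> AE x in Q. 0 \<le> w u x"
    and s: "AE x in Q. (\<Sum>u\<in>U. w u x) = 1" and u: "u \<in> U"
  shows "AE x in Q. 0 \<le> w u x \<and> w u x \<le> 1"
proof -
  have "AE x in Q. \<forall>v\<in>U. 0 \<le> w v x" using U w by (intro AE_finite_allI)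
  with s show ?thesis
  proof eventually_elim
    fix x assume x: "(\<Sum>u\<in>U. w u x) = 1" "\<forall>v\<in>U. 0 \<le> w v x"
    then have "w u x \<le> (\<Sum>u\<in>U. w u x)" using U u by (intro member_le_sum) auto
    then show "0 \<le> w u x \<and> w u x \<le> 1" using x u by auto
  qed
qed

lemma integrable_weight_mult:
  fixes w g :: "'a \<Rightarrow> real"
  assumes w: "w \<in> borel_measurable Q" "AE x in Q. 0 \<le> w x \<and> w x \<le> 1" and g: "integrable Q g"
  shows "integrable Q (\<lambda>x. w x * g x)"
proof (rule Bochner_Integration.integrable_bound[OF g])
  show "(\<lambda>x. w x * g x) \<in> borel_measurable Q" using w(1) g by auto
  show "AE x in Q. norm (w x * g x) \<le> norm (g x)"
    using w(2) by eventually_elim (simp add: abs_mult mult_left_le_one_le)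
qed

lemma sum_integral_weights:
  fixes w :: "'u \<Rightarrow> 'a \<Rightarrow> real" and g :: "'a \<Rightarrow> real"
  assumes U: "finite U" and w: "\<And>u. u \<in> U \<Longrightarrow> w u \<in> borel_measurable Q"
     "\<And>u. u \<in> U \<Longrightarrow> AE x in Q. 0 \<le> w u x"
    and s: "AE x in Q. (\<Sum>u\<in>U. w u x) = 1" and g: "integrable Q g"
  shows "(\<Sum>u\<in>U. \<integral>x. w u x * g x \<partial>Q) = (\<integral>x. g x \<partial>Q)"
proof -
  have i: "integrable Q (\<lambda>x. w u x * g x)" if "u \<in> U" for u
    by (rule integrable_weight_mult[OF w(1)[OF that] AE_weight_bounds[OF U w(2) s that] g])
  have "(\<Sum>u\<in>U. \<integral>x. w u x * g x \<partial>Q) = (\<integral>x. (\<Sum>u\<in>U. w u x * g x) \<partial>Q)"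
    using i by (intro Bochner_Integration.integral_sum[symmetric]) auto
  also have "\<dots> = (\<integral>x. g x \<partial>Q)"
  proof (rule integral_cong_AE)
    show "AE x in Q. (\<Sum>u\<in>U. w u x * g x) = g x"
      using s by eventually_elim (simp add: sum_distrib_right[symmetric])
  qed (use g w in \<open>auto intro!: borel_measurable_sum\<close>)
  finally show ?thesis .
qed

lemma sum_weighted_second_moments:
  fixes f :: "'u \<Rightarrow> (nat \<Rightarrow> real) \<Rightarrow> real"
  assumes U: "finite U" and f: "\<And>u. u \<in> U \<Longrightarrow> f u \<in> borel_measurable (std n)"
      "\<And>u. u \<in> U \<Longrightarrow> AE y in std n. 0 \<le> f u y"
    and s: "AE y in std n. (\<Sum>u\<in>U. f u y) = 1"
  shows "(\<Sum>u\<in>U. \<Sum>t<n. \<integral>y. f u y * (y t)\<^sup>2 \<partial>std n) = real n"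
proof -
  have "(\<Sum>u\<in>U. \<Sum>t<n. \<integral>y. f u y * (y t)\<^sup>2 \<partial>std n) = (\<Sum>t<n. \<Sum>u\<in>U. \<integral>y. f u y * (y t)\<^sup>2 \<partial>std n)"
    by (rule sum.swap)
  also have "\<dots> = (\<Sum>t<n. 1)"
  proof (intro sum.cong refl)
    fix t assume "t \<in> {..<n}"
    then have t: "integrable (std n) (\<lambda>y. (y t)\<^sup>2)" "(\<integral>y. (y t)\<^sup>2 \<partial>std n) = 1"
      by (auto intro: std_component_moments)
    show "(\<Sum>u\<in>U. \<integral>y. f u y * (y t)\<^sup>2 \<partial>std n) = 1"
      using sum_integral_weights[OF U f s t(1)] t(2) by simp
  qed
  finally show ?thesis by simp
qed

text \<open>Multiplied by the standard normal density, the tilt becomes \<open>sqrt d\<close> times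
  the density of the normal law with mean \<open>c\<close> and variance \<open>d\<close>.\<close>

lemma gauss_exp_tilt:
  fixes c d :: real
  assumes d: "0 < d"
  shows "integrable (gauss 0 1) (\<lambda>x. exp (x\<^sup>2 / 2 - (x - c)\<^sup>2 / (2 * d)))"
    and "(\<integral>x. exp (x\<^sup>2 / 2 - (x - c)\<^sup>2 / (2 * d)) \<partial>gauss 0 1) = sqrt d"
proof -
  have e: "std_normal_density x * exp (x\<^sup>2 / 2 - (x - c)\<^sup>2 / (2 * d)) = sqrt d * normal_density c (sqrt d) x" for x
  proof -
    have "exp (- x\<^sup>2 / 2) * exp (x\<^sup>2 / 2 - (x - c)\<^sup>2 / (2 * d)) = exp (- (x - c)\<^sup>2 / (2 * d))"
      by (simp add: exp_add[symmetric])
    then show ?thesis using d by (simp add: normal_density_def real_sqrt_mult)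
  qed
  show "integrable (gauss 0 1) (\<lambda>x. exp (x\<^sup>2 / 2 - (x - c)\<^sup>2 / (2 * d)))"
    using d by (subst integral_gauss) (simp_all only: e, auto)
  show "(\<integral>x. exp (x\<^sup>2 / 2 - (x - c)\<^sup>2 / (2 * d)) \<partial>gauss 0 1) = sqrt d"
    using d by (subst integral_gauss) (simp_all only: e, auto)
qed

lemma sqd_le: "sqd n x c \<le> 2 * sqn n x + 2 * sqn n c"
proof -
  have "(a - b)\<^sup>2 \<le> 2 * a\<^sup>2 + 2 * b\<^sup>2" for a b :: real
    using zero_le_power2[of "a + b"] by (simp add: power2_eq_square algebra_simps)
  then have "sqd n x c \<le> (\<Sum>t<n. 2 * (x t)\<^sup>2 + 2 * (c t)\<^sup>2)"
    unfolding sqd_def by (intro sum_mono)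
  then show ?thesis by (simp add: sqn_def sum.distrib sum_distrib_left)
qed

lemma measurable_sqd[measurable]:
  assumes f: "f \<in> M \<rightarrow>\<^sub>M Rn n"
  shows "(\<lambda>x. sqd n (f x) c) \<in> borel_measurable M" and "(\<lambda>x. sqn n (f x)) \<in> borel_measurable M"
proof -
  have [measurable]: "(\<lambda>x. f x t) \<in> borel_measurable M" if "t \<in> {..<n}" for t
    using measurable_compose[OF f measurable_component_singleton[OF that]] .
  show "(\<lambda>x. sqd n (f x) c) \<in> borel_measurable M" unfolding sqd_def by measurable
  show "(\<lambda>x. sqn n (f x)) \<in> borel_measurable M" unfolding sqn_def by measurable
qed

text \<open>With \<open>D = M powr (-2/n)\<close> the density of \<open>N(c, D I)\<close> relative to \<open>N(0, I)\<close>, divided by \<open>M\<close>,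
  is \<open>exp (|x|^2/2 - |x-c|^2/(2D))\<close>; integrating \<open>1 + y \<le> exp y\<close> against the weights gives the
  bound without any entropy.\<close>

lemma gaussian_quantizer_converse:
  assumes Q: "prob_space Q" and X: "X \<in> Q \<rightarrow>\<^sub>M Rn n" and d: "distr Q (Rn n) X = std n"
    and U: "finite U" "U \<noteq> {}" and n: "1 \<le> n"
    and w: "\<And>u. u \<in> U \<Longrightarrow> w u \<in> borel_measurable Q" "\<And>u. u \<in> U \<Longrightarrow> AE x in Q. 0 \<le> w u x"
    and s: "AE x in Q. (\<Sum>u\<in>U. w u x) = 1"
  shows "real n * real (card U) powr (- 2 / real n) \<le> (\<Sum>u\<in>U. \<integral>x. w u x * sqd n (X x) (c u) \<partial>Q)"
proof -
  interpret Q: prob_space Q by fact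
  interpret P: product_prob_space "\<lambda>_. gauss 0 1" by (intro product_prob_spaceI) simp
  note [measurable] = X w(1)
  define M where "M = real (card U)"
  define D where "D = M powr (- 2 / real n)"
  have M: "0 < M" using U by (simp add: M_def card_gt_0_iff)
  have D: "0 < D" using M by (simp add: D_def)
  \<comment> \<open>The exponent in \<open>D\<close> is chosen for this: each of the
    \<open>M\<close> exponentials then integrates to \<open>1 / M\<close>.\<close>
  have sD: "sqrt D ^ n = 1 / M"
  proof -
    have q: "sqrt D = M powr (- 1 / real n)" using M by (simp add: D_def powr_half_sqrt[symmetric] powr_powr)
    have "sqrt D ^ n = (M powr (- 1 / real n)) powr real n" unfolding q using M by (simp add: powr_realpow)
    also have "\<dots> = 1 / M" using M n by (subst powr_powr) (simp add: powr_minus_divide)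

    finally show ?thesis .
  qed
  have w1: "AE x in Q. 0 \<le> w u x \<and> w u x \<le> 1" if "u \<in> U" for u
    by (rule AE_weight_bounds[OF U(1) w(2) s that])
  have iX: "integrable Q (\<lambda>x. sqn n (X x))" and vX: "(\<integral>x. sqn n (X x) \<partial>Q) = real n"
    using integrable_distr_eq[OF X, of "sqn n"] integral_distr[OF X, of "sqn n"] std_sqn[of n] d by auto
  have idom: "integrable Q (\<lambda>x. w u x * g x)" if "u \<in> U" "integrable Q g" for u and g :: "_ \<Rightarrow> real"
    using that by (intro integrable_weight_mult w(1) w1)
  have iXc: "integrable Q (\<lambda>x. sqd n (X x) (c u))" for u
  proof (rule Bochner_Integration.integrable_bound)
    show "integrable Q (\<lambda>x. 2 * sqn n (X x) + 2 * sqn n (c u))" using iX by simp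
    show "AE x in Q. norm (sqd n (X x) (c u)) \<le> norm (2 * sqn n (X x) + 2 * sqn n (c u))"
      using sqd_le by (intro AE_I2) (simp add: order_trans[OF _ abs_ge_self])
  qed measurable
  define y where "y u x = sqn n x / 2 - sqd n x (c u) / (2 * D)" for u x
  have ey: "exp (y u x) = (\<Prod>t\<in>{..<n}. exp ((x t)\<^sup>2 / 2 - (x t - c u t)\<^sup>2 / (2 * D)))" for u x
    by (simp add: y_def sqn_def sqd_def exp_sum[symmetric] sum_subtractf sum_divide_distrib)
  have ie: "integrable (std n) (\<lambda>x. exp (y u x))" and ve: "(\<integral>x. exp (y u x) \<partial>std n) = 1 / M" for u
  proof -
    have i: "integrable (gauss 0 1) (\<lambda>x. exp (x\<^sup>2 / 2 - (x - c u t)\<^sup>2 / (2 * D)))" for t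
      by (rule gauss_exp_tilt[OF D])
    show "integrable (std n) (\<lambda>x. exp (y u x))"
      unfolding ey using P.product_integrable_prod[OF finite_lessThan[of n], where f="\<lambda>t x. exp (x\<^sup>2 / 2 - (x - c u t)\<^sup>2 / (2 * D))"] i
      by simp
    show "(\<integral>x. exp (y u x) \<partial>std n) = 1 / M"
      unfolding ey using P.product_integral_prod[OF finite_lessThan[of n], where f="\<lambda>t x. exp (x\<^sup>2 / 2 - (x - c u t)\<^sup>2 / (2 * D))"] i
      by (simp add: gauss_exp_tilt[OF D] sD)
  qed
  have mey: "(\<lambda>x. exp (y u x)) \<in> borel_measurable (Rn n)" for u
    unfolding y_def using measurable_sqd[OF measurable_ident, of n] by measurable
  have ieX: "integrable Q (\<lambda>x. exp (y u (X x)))" and veX: "(\<integral>x. exp (y u (X x)) \<partial>Q) = 1 / M" for u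
    using integrable_distr_eq[OF X, of "\<lambda>x. exp (y u x)"] integral_distr[OF X, of "\<lambda>x. exp (y u x)"]
      ie[of u] ve[of u] d mey[of u] by auto
  have iw: "integrable Q (w u)" if "u \<in> U" for u using idom[OF that, of "\<lambda>_. 1"] by simp
  note sum_w = sum_integral_weights[OF U(1) w s]
  have le: "(\<integral>x. w u x + (w u x * (sqn n (X x) / 2) - w u x * sqd n (X x) (c u) / (2 * D)) \<partial>Q) \<le> 1 / M" if u: "u \<in> U" for u
  proof -
    have "(\<integral>x. w u x + (w u x * (sqn n (X x) / 2) - w u x * sqd n (X x) (c u) / (2 * D)) \<partial>Q) \<le> (\<integral>x. exp (y u (X x)) \<partial>Q)"
    proof (rule integral_mono_AE)
      show "integrable Q (\<lambda>x. w u x + (w u x * (sqn n (X x) / 2) - w u x * sqd n (X x) (c u) / (2 * D)))"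
        using iw[OF u] idom[OF u, of "\<lambda>x. sqn n (X x) / 2"] idom[OF u iXc] iX by simp
      show "AE x in Q. w u x + (w u x * (sqn n (X x) / 2) - w u x * sqd n (X x) (c u) / (2 * D)) \<le> exp (y u (X x))"
        using w1[OF u]
      proof eventually_elim
        fix x assume w: "0 \<le> w u x \<and> w u x \<le> 1"
        have "w u x + (w u x * (sqn n (X x) / 2) - w u x * sqd n (X x) (c u) / (2 * D)) = w u x * (1 + y u (X x))"
          by (simp add: y_def algebra_simps)
        also have "\<dots> \<le> w u x * exp (y u (X x))" using w by (intro mult_left_mono exp_ge_add_one_self) auto
        also have "\<dots> \<le> exp (y u (X x))" using w by (simp add: mult_left_le_one_le)
        finally show "w u x + (w u x * (sqn n (X x) / 2) - w u x * sqd n (X x) (c u) / (2 * D)) \<le> exp (y u (X x))" .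
      qed
    qed (rule ieX)
    then show ?thesis by (simp add: veX)
  qed
  have "(\<Sum>u\<in>U. (\<integral>x. w u x \<partial>Q) + ((\<integral>x. w u x * (sqn n (X x) / 2) \<partial>Q) - (\<integral>x. w u x * sqd n (X x) (c u) \<partial>Q) / (2 * D)))
     \<le> (\<Sum>u\<in>U. 1 / M)"
  proof (intro sum_mono)
    fix u assume u: "u \<in> U"
    show "(\<integral>x. w u x \<partial>Q) + ((\<integral>x. w u x * (sqn n (X x) / 2) \<partial>Q) - (\<integral>x. w u x * sqd n (X x) (c u) \<partial>Q) / (2 * D)) \<le> 1 / M"
      using le[OF u] iw[OF u] idom[OF u, of "\<lambda>x. sqn n (X x) / 2"] idom[OF u iXc] iX by simp
  qed
  moreover have "(\<Sum>u\<in>U. \<integral>x. w u x \<partial>Q) = 1" using sum_w[of "\<lambda>_. 1"] by (simp add: Q.prob_space)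
  moreover have "(\<Sum>u\<in>U. \<integral>x. w u x * (sqn n (X x) / 2) \<partial>Q) = real n / 2"
    using sum_w[of "\<lambda>x. sqn n (X x) / 2"] iX vX by simp
  moreover have "(\<Sum>u\<in>U. 1 / M) = 1" using M by (simp add: M_def)
  \<comment> \<open>The total weight 1 on the left cancels against \<open>M\<close> integrals of
    size \<open>1 / M\<close> on the right. What remains compares \<open>n / 2\<close> with the
    distortion over \<open>2 * D\<close>.\<close>
  ultimately have "1 + (real n / 2 - (\<Sum>u\<in>U. \<integral>x. w u x * sqd n (X x) (c u) \<partial>Q) / (2 * D)) \<le> 1"
    by (simp add: sum.distrib sum_subtractf sum_divide_distrib)
  then show ?thesis using D by (simp add: field_simps D_def M_def)
qed

section \<open>Triangle inequality in mean square, and energies of centroids\<close>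

lemma sqrt_triangle_of_weighted:
  fixes A B C :: real
  assumes A: "0 \<le> A" and B: "0 \<le> B"
    and le: "\<And>\<tau>. 0 < \<tau> \<Longrightarrow> C \<le> (1 + \<tau>) * A + (1 + 1 / \<tau>) * B"
  shows "sqrt C \<le> sqrt A + sqrt B"
proof -
  have "C \<le> (sqrt A + sqrt B + e)\<^sup>2" if e: "0 < e" for e
  proof -
    \<comment> \<open>The best weight is the ratio of the two norms; half of \<open>e\<close> added
      to each of them keeps the ratio meaningful when \<open>A\<close> or \<open>B\<close> is
      0.\<close>
    define a b where "a = sqrt A + e / 2" and "b = sqrt B + e / 2"
    have ab: "0 < a" "0 < b" using A B e by (auto simp: a_def b_def add_nonneg_pos)
    have "A \<le> a\<^sup>2" "B \<le> b\<^sup>2"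
      using e by (auto simp: a_def b_def intro!: sqrt_le_D)
    then have "(1 + b / a) * A + (1 + 1 / (b / a)) * B \<le> (1 + b / a) * a\<^sup>2 + (1 + 1 / (b / a)) * b\<^sup>2"
      using ab by (intro add_mono mult_left_mono) auto
    also have "\<dots> = (a + b)\<^sup>2" using ab by (simp add: field_simps power2_eq_square)
    finally have "C \<le> (a + b)\<^sup>2" using le[of "b / a"] ab by simp
    also have "a + b = sqrt A + sqrt B + e" by (simp add: a_def b_def)
    finally show ?thesis .
  qed
  then have "sqrt C \<le> sqrt A + sqrt B + e" if "0 < e" for e
    using that A B by (intro real_le_lsqrt) auto
  then show ?thesis by (rule field_le_epsilon)
qed

text \<open>With \<open>\<tau>\<close> left free the bound is linear in the squares, so it can be
  integrated and summed over letters and cells before any root is taken.\<close>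

lemma square_diff_weighted:
  fixes a b :: real
  assumes "0 < \<tau>"
  shows "(a + b)\<^sup>2 \<le> (1 + \<tau>) * a\<^sup>2 + (1 + 1 / \<tau>) * b\<^sup>2"
proof -
  have "0 \<le> (\<tau> * a - b)\<^sup>2 / \<tau>" using assms by simp
  also have "\<dots> = \<tau> * a\<^sup>2 - 2 * a * b + b\<^sup>2 / \<tau>"
    using assms by (simp add: power2_eq_square field_simps)
  finally show ?thesis by (simp add: power2_eq_square algebra_simps)
qed

text \<open>Inside one cell source and reconstruction are independent, so the mixed term is a
  product of first moments. The sign is claimed separately because \<open>ennreal\<close> truncates
  negative numbers and the equation alone would hide it.\<close>

lemma nn_integral_pair_square:
  fixes f w :: "'a \<Rightarrow> real" and g :: "'b \<Rightarrow> real"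
  assumes w: "integrable Q w" "integrable Q (\<lambda>x. w x * f x)" "integrable Q (\<lambda>x. w x * (f x)\<^sup>2)"
    and w0: "AE x in Q. 0 \<le> w x"
    and N: "prob_space N" and g: "integrable N g" "integrable N (\<lambda>z. (g z)\<^sup>2)"
  shows "(\<integral>\<^sup>+x. ennreal (w x) * (\<integral>\<^sup>+z. ennreal ((f x - g z)\<^sup>2) \<partial>N) \<partial>Q) =
    ennreal ((\<integral>x. w x * (f x)\<^sup>2 \<partial>Q) - 2 * (\<integral>x. w x * f x \<partial>Q) * (\<integral>z. g z \<partial>N)
       + (\<integral>x. w x \<partial>Q) * (\<integral>z. (g z)\<^sup>2 \<partial>N))"
    and "0 \<le> (\<integral>x. w x * (f x)\<^sup>2 \<partial>Q) - 2 * (\<integral>x. w x * f x \<partial>Q) * (\<integral>z. g z \<partial>N)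
       + (\<integral>x. w x \<partial>Q) * (\<integral>z. (g z)\<^sup>2 \<partial>N)"
proof -
  interpret N: prob_space N by fact
  have e: "(a - g z)\<^sup>2 = a\<^sup>2 - 2 * a * g z + (g z)\<^sup>2" for a z
    by (simp add: power2_eq_square algebra_simps)
  have i: "integrable N (\<lambda>z. (a - g z)\<^sup>2)" for a unfolding e using g by simp
  have v: "(\<integral>z. (a - g z)\<^sup>2 \<partial>N) = a\<^sup>2 - 2 * a * (\<integral>z. g z \<partial>N) + (\<integral>z. (g z)\<^sup>2 \<partial>N)" for a
    unfolding e using g by (simp add: N.prob_space)
  have inner: "(\<integral>\<^sup>+z. ennreal ((a - g z)\<^sup>2) \<partial>N) = ennreal (a\<^sup>2 - 2 * a * (\<integral>z. g z \<partial>N) + (\<integral>z. (g z)\<^sup>2 \<partial>N))" for a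
    unfolding v[symmetric] by (intro nn_integral_eq_integral i) simp
  have nn: "0 \<le> a\<^sup>2 - 2 * a * (\<integral>z. g z \<partial>N) + (\<integral>z. (g z)\<^sup>2 \<partial>N)" for a
    unfolding v[symmetric] by simp
  define h where "h x = w x * (f x)\<^sup>2 - 2 * (\<integral>z. g z \<partial>N) * (w x * f x) + (\<integral>z. (g z)\<^sup>2 \<partial>N) * w x" for x
  have ih: "integrable Q h" unfolding h_def using w by simp
  have h0: "AE x in Q. 0 \<le> h x" using w0
  proof eventually_elim
    fix x assume "0 \<le> w x"
    moreover have "h x = w x * ((f x)\<^sup>2 - 2 * f x * (\<integral>z. g z \<partial>N) + (\<integral>z. (g z)\<^sup>2 \<partial>N))"
      by (simp add: h_def algebra_simps)
    ultimately show "0 \<le> h x" using nn[of "f x"] by simp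
  qed
  have vh: "(\<integral>x. h x \<partial>Q) = (\<integral>x. w x * (f x)\<^sup>2 \<partial>Q) - 2 * (\<integral>x. w x * f x \<partial>Q) * (\<integral>z. g z \<partial>N)
       + (\<integral>x. w x \<partial>Q) * (\<integral>z. (g z)\<^sup>2 \<partial>N)"
    unfolding h_def using w by simp
  have "(\<integral>\<^sup>+x. ennreal (w x) * (\<integral>\<^sup>+z. ennreal ((f x - g z)\<^sup>2) \<partial>N) \<partial>Q) = (\<integral>\<^sup>+x. ennreal (h x) \<partial>Q)"
  proof (intro nn_integral_cong_AE)
    show "AE x in Q. ennreal (w x) * (\<integral>\<^sup>+z. ennreal ((f x - g z)\<^sup>2) \<partial>N) = ennreal (h x)"
      using w0
    proof eventually_elim
      fix x assume "0 \<le> w x"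
      then show "ennreal (w x) * (\<integral>\<^sup>+z. ennreal ((f x - g z)\<^sup>2) \<partial>N) = ennreal (h x)"
        unfolding inner using nn[of "f x"]
        by (subst ennreal_mult[symmetric]) (simp_all add: h_def algebra_simps)
    qed
  qed
  also have "\<dots> = ennreal (\<integral>x. h x \<partial>Q)"
    by (intro nn_integral_eq_integral ih h0)
  finally show "(\<integral>\<^sup>+x. ennreal (w x) * (\<integral>\<^sup>+z. ennreal ((f x - g z)\<^sup>2) \<partial>N) \<partial>Q) =
    ennreal ((\<integral>x. w x * (f x)\<^sup>2 \<partial>Q) - 2 * (\<integral>x. w x * f x \<partial>Q) * (\<integral>z. g z \<partial>N)
       + (\<integral>x. w x \<partial>Q) * (\<integral>z. (g z)\<^sup>2 \<partial>N))" unfolding vh .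
  show "0 \<le> (\<integral>x. w x * (f x)\<^sup>2 \<partial>Q) - 2 * (\<integral>x. w x * f x \<partial>Q) * (\<integral>z. g z \<partial>N)
       + (\<integral>x. w x \<partial>Q) * (\<integral>z. (g z)\<^sup>2 \<partial>N)"
    unfolding vh[symmetric] by (intro integral_nonneg_AE h0)
qed

text \<open>The converse is applied with the centroids of the cells as codewords: the second moments
  add up to \<open>n\<close>, and what the centroids do not carry is distortion.\<close>

lemma gaussian_centroid_energy:
  fixes w :: "'u \<Rightarrow> (nat \<Rightarrow> real) \<Rightarrow> real"
  assumes U: "finite U" "U \<noteq> {}" and n: "1 \<le> n"
    and w: "\<And>u. u \<in> U \<Longrightarrow> w u \<in> borel_measurable (std n)" "\<And>u. u \<in> U \<Longrightarrow> AE x in std n. 0 \<le> w u x"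
    and s: "AE x in std n. (\<Sum>u\<in>U. w u x) = 1"
  shows "(\<Sum>u\<in>U. \<Sum>t<n. (\<integral>x. w u x * x t \<partial>std n)\<^sup>2 / (\<integral>x. w u x \<partial>std n))
    \<le> real n - real n * real (card U) powr (- 2 / real n)"
proof -
  define r where "r u = (\<integral>x. w u x \<partial>std n)" for u
  define m where "m u t = (\<integral>x. w u x * x t \<partial>std n)" for u t
  have b: "AE x in std n. 0 \<le> w u x \<and> w u x \<le> 1" if "u \<in> U" for u
    by (rule AE_weight_bounds[OF U(1) w(2) s that])
  have i: "integrable (std n) (w u)" "integrable (std n) (\<lambda>x. w u x * x t)"
    "integrable (std n) (\<lambda>x. w u x * (x t)\<^sup>2)" if u: "u \<in> U" "t < n" for u t
  proof -
    interpret prob_space "std n" by simp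
    show "integrable (std n) (w u)" using integrable_weight_mult[OF w(1) b, of u "\<lambda>_. 1"] u by simp
    show "integrable (std n) (\<lambda>x. w u x * x t)" "integrable (std n) (\<lambda>x. w u x * (x t)\<^sup>2)"
      using u by (intro integrable_weight_mult[OF w(1) b] std_component_moments; simp)+
  qed
  have "(\<lambda>x. x) \<in> std n \<rightarrow>\<^sub>M Rn n" "distr (std n) (Rn n) (\<lambda>x. x) = std n"
    by (auto intro!: distr_id2 measurable_ident_sets)
  then have "real n * real (card U) powr (- 2 / real n) \<le> (\<Sum>u\<in>U. \<integral>x. w u x * sqd n x (\<lambda>t. m u t / r u) \<partial>std n)"
    by (rule gaussian_quantizer_converse[OF prob_space_std _ _ U n w s])
  also have "\<dots> = (\<Sum>u\<in>U. \<Sum>t<n. \<integral>x. w u x * (x t - m u t / r u)\<^sup>2 \<partial>std n)"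
  proof (intro sum.cong refl)
    fix u assume u: "u \<in> U"
    have e: "w u x * (x t - c)\<^sup>2 = w u x * (x t)\<^sup>2 - 2 * c * (w u x * x t) + c\<^sup>2 * w u x" for x t c
      by (simp add: power2_eq_square algebra_simps)
    show "(\<integral>x. w u x * sqd n x (\<lambda>t. m u t / r u) \<partial>std n) = (\<Sum>t<n. \<integral>x. w u x * (x t - m u t / r u)\<^sup>2 \<partial>std n)"
      unfolding sqd_def sum_distrib_left
      by (rule Bochner_Integration.integral_sum) (unfold e, use i[OF u] in auto)
  qed
  also have "\<dots> = (\<Sum>u\<in>U. \<Sum>t<n. (\<integral>x. w u x * (x t)\<^sup>2 \<partial>std n) - (m u t)\<^sup>2 / r u)"
    unfolding m_def r_def by (intro sum.cong refl weighted_variance i) auto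
  also have "\<dots> = real n - (\<Sum>u\<in>U. \<Sum>t<n. (m u t)\<^sup>2 / r u)"
    using sum_weighted_second_moments[OF U(1) w s] by (simp add: sum_subtractf)
  finally show ?thesis by (simp add: m_def r_def)
qed

lemma distr_gauss_standardize:
  assumes "0 < \<sigma>"
  shows "distr (gauss \<mu> \<sigma>) borel (\<lambda>x. (x - \<mu>) / \<sigma>) = gauss 0 1"
proof -
  have "distr (gauss \<mu> \<sigma>) borel (\<lambda>x. (x - \<mu>) / \<sigma>) = distr (gauss 0 1) borel (\<lambda>x. x)"
    using assms unfolding gauss_affine[OF assms, of \<mu>, symmetric]
    by (subst distr_distr) (auto simp: comp_def)
  also have "\<dots> = gauss 0 1" by (rule distr_id2) simp
  finally show ?thesis .
qed

text \<open>The output law \<open>q\<close> may fail to be Gaussian, so the converse does not apply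
  to it directly. But the product of the couplings has the i.i.d. output as its second marginal, and
  the weights, evaluated at that output, form a randomized quantizer of the Gaussian first marginal.
  The two marginals are apart by the coupling cost, and the triangle inequality transfers the
  bound.\<close>

lemma coupled_reconstruction_bound:
  fixes w :: "'u \<Rightarrow> (nat \<Rightarrow> real) \<Rightarrow> real" and c :: "'u \<Rightarrow> nat \<Rightarrow> real"
  assumes \<sigma>: "0 < \<sigma>" and P': "0 < P'"
    and pi: "prob_space \<pi>" "sets \<pi> = sets (borel \<Otimes>\<^sub>M borel)" "distr \<pi> borel fst = gauss \<mu> \<sigma>" "distr \<pi> borel snd = q"
    and cost: "(\<integral>\<^sup>+z. ennreal ((fst z - snd z)\<^sup>2) \<partial>\<pi>) \<le> ennreal P'"
    and s2: "integrable q (\<lambda>x. (x - \<mu>)\<^sup>2)"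
    and U: "finite U" "U \<noteq> {}" and n: "1 \<le> n"
    and w: "\<And>u. u \<in> U \<Longrightarrow> w u \<in> borel_measurable (Rn n)"
      "\<And>u. u \<in> U \<Longrightarrow> AE x in PiM {..<n} (\<lambda>_. q). 0 \<le> w u x"
    and s: "AE x in PiM {..<n} (\<lambda>_. q). (\<Sum>u\<in>U. w u x) = 1"
  shows "sqrt (real n) * (\<sigma> * real (card U) powr (- 1 / real n)) \<le>
    sqrt (\<Sum>u\<in>U. \<Sum>t<n. \<integral>x. w u x * (x t - c u t)\<^sup>2 \<partial>PiM {..<n} (\<lambda>_. q)) + sqrt (real n * P')"
proof -
  let ?Q = "PiM {..<n} (\<lambda>_. q)" and ?P = "PiM {..<n} (\<lambda>_. \<pi>)"
  interpret pi: prob_space \<pi> by fact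
  interpret P: prob_space ?P by (intro prob_space_PiM pi)
  note [measurable_cong] = pi(2)
  have sq: "sets q = sets borel" using pi(4) by auto
  have pq: "prob_space q" unfolding pi(4)[symmetric] by (intro pi.prob_space_distr) simp
  have mf[measurable]: "fst \<in> \<pi> \<rightarrow>\<^sub>M borel" "snd \<in> \<pi> \<rightarrow>\<^sub>M borel" by measurable
  define X where "X \<omega> = (\<lambda>t\<in>{..<n}. (fst (\<omega> t) - \<mu>) / \<sigma>)" for \<omega> :: "nat \<Rightarrow> real \<times> real"
  define Z where "Z \<omega> = (\<lambda>t\<in>{..<n}. snd (\<omega> t))" for \<omega> :: "nat \<Rightarrow> real \<times> real"
  have comp: "(\<lambda>\<omega>. \<omega> t) \<in> ?P \<rightarrow>\<^sub>M \<pi>" if "t < n" for t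
    using that by (intro measurable_component_singleton) simp
  have X: "X \<in> ?P \<rightarrow>\<^sub>M Rn n" and Z: "Z \<in> ?P \<rightarrow>\<^sub>M Rn n"
  proof -
    have 1: "(\<lambda>z. (fst z - \<mu>) / \<sigma>) \<in> \<pi> \<rightarrow>\<^sub>M borel" by measurable
    show "X \<in> ?P \<rightarrow>\<^sub>M Rn n" unfolding X_def
      by (intro measurable_restrict measurable_compose[OF _ 1] comp) simp
    show "Z \<in> ?P \<rightarrow>\<^sub>M Rn n" unfolding Z_def
      by (intro measurable_restrict measurable_compose[OF _ mf(2)] comp) simp
  qed
  have dX: "distr ?P (Rn n) X = std n"
  proof -
    have 1: "(\<lambda>z. (fst z - \<mu>) / \<sigma>) \<in> \<pi> \<rightarrow>\<^sub>M borel" by measurable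
    have "distr \<pi> borel (\<lambda>z. (fst z - \<mu>) / \<sigma>) = distr (distr \<pi> borel fst) borel (\<lambda>x. (x - \<mu>) / \<sigma>)"
      by (subst distr_distr) (auto simp: comp_def)
    then have "distr \<pi> borel (\<lambda>z. (fst z - \<mu>) / \<sigma>) = gauss 0 1"
      using distr_gauss_standardize[OF \<sigma>] pi(3) by simp
    then show ?thesis
      unfolding X_def using distr_PiM_family[OF finite_lessThan[of n] pi(1), of "\<lambda>_ z. (fst z - \<mu>) / \<sigma>" "\<lambda>_. borel"] 1 by simp
  qed
  have dZ: "distr ?P (Rn n) Z = ?Q"
    unfolding Z_def using distr_PiM_family[OF finite_lessThan[of n] pi(1), of "\<lambda>_. snd" "\<lambda>_. borel"] pi(4) by simp
  have wZ: "(\<lambda>\<omega>. w u (Z \<omega>)) \<in> borel_measurable ?P" if "u \<in> U" for u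
    using measurable_compose[OF Z w(1)[OF that]] .
  have wZ0: "AE \<omega> in ?P. 0 \<le> w u (Z \<omega>)" if "u \<in> U" for u
    using AE_distrD[OF Z, unfolded dZ, OF w(2)[OF that]] .
  have wZ1: "AE \<omega> in ?P. (\<Sum>u\<in>U. w u (Z \<omega>)) = 1"
    using AE_distrD[OF Z, unfolded dZ, OF s] .
  have b: "AE \<omega> in ?P. 0 \<le> w u (Z \<omega>) \<and> w u (Z \<omega>) \<le> 1" if "u \<in> U" for u
    by (rule AE_weight_bounds[OF U(1) wZ0 wZ1 that])
  have icost: "integrable \<pi> (\<lambda>z. (fst z - snd z)\<^sup>2)"
    using cost by (intro integrableI_bounded) (auto simp: le_less_trans)
  have vcost: "(\<integral>z. (fst z - snd z)\<^sup>2 \<partial>\<pi>) \<le> P'"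
    using cost P' nn_integral_eq_integral[OF icost] by simp
  have iC: "integrable ?P (\<lambda>\<omega>. (fst (\<omega> t) - snd (\<omega> t))\<^sup>2)"
    and vC: "(\<integral>\<omega>. (fst (\<omega> t) - snd (\<omega> t))\<^sup>2 \<partial>?P) \<le> P'" if "t < n" for t
    using integral_PiM_component[OF pi(1), of t "{..<n}" "\<lambda>z. (fst z - snd z)\<^sup>2"] that icost vcost by auto
  have iz2: "integrable ?P (\<lambda>\<omega>. (snd (\<omega> t) - \<mu>)\<^sup>2)" if "t < n" for t
  proof -
    have "integrable \<pi> (\<lambda>z. (snd z - \<mu>)\<^sup>2)"
      using integrable_distr_eq[of snd \<pi> borel "\<lambda>x. (x - \<mu>)\<^sup>2"] s2 pi(4) by simp
    then show ?thesis using integral_PiM_component(2)[OF pi(1), of t "{..<n}" "\<lambda>z. (snd z - \<mu>)\<^sup>2"] that by simp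
  qed
  have iz: "integrable ?P (\<lambda>\<omega>. (snd (\<omega> t) - d)\<^sup>2)" if t: "t < n" for t d
  proof (rule Bochner_Integration.integrable_bound)
    show "integrable ?P (\<lambda>\<omega>. 2 * (snd (\<omega> t) - \<mu>)\<^sup>2 + 2 * (\<mu> - d)\<^sup>2)" using iz2[OF t] by simp
    have "(snd (\<omega> t) - d)\<^sup>2 \<le> 2 * (snd (\<omega> t) - \<mu>)\<^sup>2 + 2 * (\<mu> - d)\<^sup>2" for \<omega>
      using square_diff_weighted[of 1 "snd (\<omega> t) - \<mu>" "\<mu> - d"] by simp
    then show "AE \<omega> in ?P. norm ((snd (\<omega> t) - d)\<^sup>2) \<le> norm (2 * (snd (\<omega> t) - \<mu>)\<^sup>2 + 2 * (\<mu> - d)\<^sup>2)"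
      by (intro AE_I2) auto
    show "(\<lambda>\<omega>. (snd (\<omega> t) - d)\<^sup>2) \<in> borel_measurable ?P"
      using measurable_compose[OF comp[OF t] mf(2)] by measurable
  qed
  have tr: "(\<integral>x. w u x * (x t - c u t)\<^sup>2 \<partial>?Q) = (\<integral>\<omega>. w u (Z \<omega>) * (snd (\<omega> t) - c u t)\<^sup>2 \<partial>?P)" if u: "u \<in> U" "t < n" for u t
  proof -
    have [measurable]: "w u \<in> borel_measurable (Rn n)" "(\<lambda>x. x t) \<in> borel_measurable (Rn n)"
      using u by (auto intro: w measurable_component_singleton)
    have "(\<integral>x. w u x * (x t - c u t)\<^sup>2 \<partial>distr ?P (Rn n) Z) = (\<integral>\<omega>. w u (Z \<omega>) * (Z \<omega> t - c u t)\<^sup>2 \<partial>?P)"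
      by (rule integral_distr[OF Z]) measurable
    then show ?thesis using u unfolding dZ by (simp add: Z_def)
  qed
  define A where "A = (\<Sum>u\<in>U. \<Sum>t<n. \<integral>x. w u x * (x t - c u t)\<^sup>2 \<partial>?Q)"
  have A: "A = (\<Sum>u\<in>U. \<Sum>t<n. \<integral>\<omega>. w u (Z \<omega>) * (snd (\<omega> t) - c u t)\<^sup>2 \<partial>?P)"
    unfolding A_def by (intro sum.cong refl tr) auto
  have A0: "0 \<le> A" unfolding A
  proof (intro sum_nonneg integral_nonneg_AE)
    fix u t assume "u \<in> U" "t \<in> {..<n}"
    show "AE \<omega> in ?P. 0 \<le> w u (Z \<omega>) * (snd (\<omega> t) - c u t)\<^sup>2"
      using wZ0[OF \<open>u \<in> U\<close>] by eventually_elim simp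
  qed
  have main: "\<sigma>\<^sup>2 * (real n * real (card U) powr (- 2 / real n)) \<le> (1 + \<tau>) * A + (1 + 1 / \<tau>) * (real n * P')" if \<tau>: "0 < \<tau>" for \<tau>
  proof -
    \<comment> \<open>The codewords are moved to the scale of the standardized vector, so that
      distances differ by the factor \<open>\<sigma>\<close> only.\<close>
    have "real n * real (card U) powr (- 2 / real n) \<le> (\<Sum>u\<in>U. \<integral>\<omega>. w u (Z \<omega>) * sqd n (X \<omega>) (\<lambda>t. (c u t - \<mu>) / \<sigma>) \<partial>?P)"
      by (rule gaussian_quantizer_converse[OF P.prob_space_axioms X dX U n wZ wZ0 wZ1])
    then have "\<sigma>\<^sup>2 * (real n * real (card U) powr (- 2 / real n)) \<le> \<sigma>\<^sup>2 * (\<Sum>u\<in>U. \<integral>\<omega>. w u (Z \<omega>) * sqd n (X \<omega>) (\<lambda>t. (c u t - \<mu>) / \<sigma>) \<partial>?P)"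
      by (intro mult_left_mono) auto
    also have "\<dots> = (\<Sum>u\<in>U. \<integral>\<omega>. \<sigma>\<^sup>2 * (w u (Z \<omega>) * sqd n (X \<omega>) (\<lambda>t. (c u t - \<mu>) / \<sigma>)) \<partial>?P)"
      by (simp add: sum_distrib_left)
    also have "\<dots> \<le> (\<Sum>u\<in>U. \<integral>\<omega>. (\<Sum>t<n. (1 + \<tau>) * (w u (Z \<omega>) * (snd (\<omega> t) - c u t)\<^sup>2)
         + (1 + 1 / \<tau>) * (w u (Z \<omega>) * (fst (\<omega> t) - snd (\<omega> t))\<^sup>2)) \<partial>?P)"
    proof (intro sum_mono integral_mono_AE')
      fix u assume u: "u \<in> U"
      show "integrable ?P (\<lambda>\<omega>. \<Sum>t<n. (1 + \<tau>) * (w u (Z \<omega>) * (snd (\<omega> t) - c u t)\<^sup>2)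
         + (1 + 1 / \<tau>) * (w u (Z \<omega>) * (fst (\<omega> t) - snd (\<omega> t))\<^sup>2))"
        using integrable_weight_mult[OF wZ[OF u] b[OF u]] iz iC by (intro Bochner_Integration.integrable_sum) simp
      show "AE \<omega> in ?P. \<sigma>\<^sup>2 * (w u (Z \<omega>) * sqd n (X \<omega>) (\<lambda>t. (c u t - \<mu>) / \<sigma>)) \<le>
        (\<Sum>t<n. (1 + \<tau>) * (w u (Z \<omega>) * (snd (\<omega> t) - c u t)\<^sup>2)
         + (1 + 1 / \<tau>) * (w u (Z \<omega>) * (fst (\<omega> t) - snd (\<omega> t))\<^sup>2))"
        using wZ0[OF u]
      proof eventually_elim
        fix \<omega> assume w0: "0 \<le> w u (Z \<omega>)"
        have "\<sigma>\<^sup>2 * (w u (Z \<omega>) * sqd n (X \<omega>) (\<lambda>t. (c u t - \<mu>) / \<sigma>)) = (\<Sum>t<n. w u (Z \<omega>) * ((snd (\<omega> t) - c u t) + (fst (\<omega> t) - snd (\<omega> t)))\<^sup>2)"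
          unfolding sqd_def sum_distrib_left
        proof (intro sum.cong refl)
          fix t assume t: "t \<in> {..<n}"
          have "\<sigma>\<^sup>2 * (X \<omega> t - (c u t - \<mu>) / \<sigma>)\<^sup>2 = (\<sigma> * (X \<omega> t - (c u t - \<mu>) / \<sigma>))\<^sup>2" by (simp add: power_mult_distrib)
          also have "\<sigma> * (X \<omega> t - (c u t - \<mu>) / \<sigma>) = (snd (\<omega> t) - c u t) + (fst (\<omega> t) - snd (\<omega> t))"
            using t \<sigma> by (simp add: X_def field_simps)
          finally show "\<sigma>\<^sup>2 * (w u (Z \<omega>) * (X \<omega> t - (c u t - \<mu>) / \<sigma>)\<^sup>2) = w u (Z \<omega>) * ((snd (\<omega> t) - c u t) + (fst (\<omega> t) - snd (\<omega> t)))\<^sup>2"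
            by (simp add: mult_ac)
        qed
        also have "\<dots> \<le> (\<Sum>t<n. w u (Z \<omega>) * ((1 + \<tau>) * (snd (\<omega> t) - c u t)\<^sup>2 + (1 + 1 / \<tau>) * (fst (\<omega> t) - snd (\<omega> t))\<^sup>2))"
          using w0 \<tau> by (intro sum_mono mult_left_mono square_diff_weighted)
        finally show "\<sigma>\<^sup>2 * (w u (Z \<omega>) * sqd n (X \<omega>) (\<lambda>t. (c u t - \<mu>) / \<sigma>)) \<le>
          (\<Sum>t<n. (1 + \<tau>) * (w u (Z \<omega>) * (snd (\<omega> t) - c u t)\<^sup>2) + (1 + 1 / \<tau>) * (w u (Z \<omega>) * (fst (\<omega> t) - snd (\<omega> t))\<^sup>2))"
          by (simp add: algebra_simps)
      qed
      show "AE \<omega> in ?P. 0 \<le> (\<Sum>t<n. (1 + \<tau>) * (w u (Z \<omega>) * (snd (\<omega> t) - c u t)\<^sup>2)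
         + (1 + 1 / \<tau>) * (w u (Z \<omega>) * (fst (\<omega> t) - snd (\<omega> t))\<^sup>2))"
        using wZ0[OF u] by eventually_elim (use \<tau> in \<open>auto intro!: sum_nonneg\<close>)
    qed
    also have "\<dots> = (\<Sum>u\<in>U. \<Sum>t<n. (1 + \<tau>) * (\<integral>\<omega>. w u (Z \<omega>) * (snd (\<omega> t) - c u t)\<^sup>2 \<partial>?P)
         + (1 + 1 / \<tau>) * (\<integral>\<omega>. w u (Z \<omega>) * (fst (\<omega> t) - snd (\<omega> t))\<^sup>2 \<partial>?P))"
    proof (intro sum.cong refl)
      fix u assume u: "u \<in> U"
      have i: "integrable ?P (\<lambda>\<omega>. w u (Z \<omega>) * (snd (\<omega> t) - c u t)\<^sup>2)"
          "integrable ?P (\<lambda>\<omega>. w u (Z \<omega>) * (fst (\<omega> t) - snd (\<omega> t))\<^sup>2)" if "t < n" for t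
        using integrable_weight_mult[OF wZ[OF u] b[OF u]] iz iC that by auto
      show "(\<integral>\<omega>. (\<Sum>t<n. (1 + \<tau>) * (w u (Z \<omega>) * (snd (\<omega> t) - c u t)\<^sup>2)
         + (1 + 1 / \<tau>) * (w u (Z \<omega>) * (fst (\<omega> t) - snd (\<omega> t))\<^sup>2)) \<partial>?P) = (\<Sum>t<n. (1 + \<tau>) * (\<integral>\<omega>. w u (Z \<omega>) * (snd (\<omega> t) - c u t)\<^sup>2 \<partial>?P)
         + (1 + 1 / \<tau>) * (\<integral>\<omega>. w u (Z \<omega>) * (fst (\<omega> t) - snd (\<omega> t))\<^sup>2 \<partial>?P))"
        using i by (subst Bochner_Integration.integral_sum) simp_all
    qed
    also have "\<dots> = (1 + \<tau>) * A + (1 + 1 / \<tau>) * (\<Sum>t<n. \<Sum>u\<in>U. \<integral>\<omega>. w u (Z \<omega>) * (fst (\<omega> t) - snd (\<omega> t))\<^sup>2 \<partial>?P)"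
      unfolding A by (simp only: sum.distrib sum_distrib_left sum.swap[of _ "{..<n}" U])
    \<comment> \<open>For each letter the weights of all cells add up to 1, so the coupling cost is
      counted once and not once per cell.\<close>
    also have "\<dots> \<le> (1 + \<tau>) * A + (1 + 1 / \<tau>) * (\<Sum>t<n. P')"
    proof (intro add_left_mono mult_left_mono sum_mono)
      fix t assume t: "t \<in> {..<n}"
      then show "(\<Sum>u\<in>U. \<integral>\<omega>. w u (Z \<omega>) * (fst (\<omega> t) - snd (\<omega> t))\<^sup>2 \<partial>?P) \<le> P'"
        using sum_integral_weights[OF U(1) wZ wZ0 wZ1 iC, of t] vC[of t] by simp
    qed (use \<tau> in simp)
    finally show ?thesis by simp
  qed
  have "sqrt (\<sigma>\<^sup>2 * (real n * real (card U) powr (- 2 / real n))) \<le> sqrt A + sqrt (real n * P')"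
    using A0 P' main by (intro sqrt_triangle_of_weighted) auto
  moreover have "sqrt (real (card U) powr (- 2 / real n)) = real (card U) powr (- 1 / real n)"
    using U by (simp add: powr_half_sqrt[symmetric] powr_powr)
  ultimately show ?thesis using \<sigma> by (simp add: real_sqrt_mult A_def mult_ac)
qed

section \<open>Codes seen as quantizers of the source and of the output\<close>

lemma measurable_affine_Rn: "(\<lambda>y. \<lambda>t\<in>{..<n}. m t + c * y t) \<in> Rn n \<rightarrow>\<^sub>M Rn n"
proof -
  have "(\<lambda>y. m t + c * y t) \<in> borel_measurable (Rn n)" if "t \<in> {..<n}" for t
    using measurable_component_singleton[OF that, of "\<lambda>_. borel"] by measurable
  then show ?thesis by (intro measurable_restrict) auto
qed

text \<open>Moves the source to the standard normal vector, where the converse lives; the encoder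
  weights are composed with the affine map. Each pair of seed and message now has one weight and one
  decoder law.\<close>

lemma nn_integral_code_joint_std:
  fixes \<mu> \<sigma> :: real
  assumes \<sigma>: "0 < \<sigma>" and V: "valid_code n NJ NK enc dec"
    and f: "f \<in> borel_measurable (Rn n \<Otimes>\<^sub>M Rn n)"
  defines "a \<equiv> \<lambda>y. \<lambda>t\<in>{..<n}. \<mu> + \<sigma> * y t"
  shows "(\<integral>\<^sup>+z. f z \<partial>code_joint n (gauss \<mu> \<sigma>) NK enc dec) =
    (\<Sum>k<NK. \<Sum>j<NJ. \<integral>\<^sup>+y. ennreal (measure (enc (a y) k) {j} / real NK) * (\<integral>\<^sup>+z. f (a y, z) \<partial>dec j k) \<partial>std n)"
proof -
  note g = prob_space_gauss[OF \<sigma>, of \<mu>] sets_gauss[of \<mu> \<sigma>]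
  have a: "a \<in> std n \<rightarrow>\<^sub>M Rn n"
    unfolding a_def[abs_def] measurable_cong_sets[OF sets_PiM_gauss refl] by (rule measurable_affine_Rn)
  have da: "PiM {..<n} (\<lambda>_. gauss \<mu> \<sigma>) = distr (std n) (Rn n) a"
    unfolding a_def PiM_gauss_affine[OF \<sigma>] ..
  have dm: "(\<lambda>x. \<integral>\<^sup>+z. f (x, z) \<partial>dec j k) \<in> borel_measurable (Rn n)" if "k \<in> {..<NK}" "j \<in> {..<NJ}" for j k
  proof -
    have d: "prob_space (dec j k)" "sets (dec j k) = sets (Rn n)"
      using code_decoder[OF V g, of j k] that by auto
    interpret D: prob_space "dec j k" by (rule d)
    have "f \<in> borel_measurable (Rn n \<Otimes>\<^sub>M dec j k)"
      using f measurable_cong_sets[OF sets_pair_measure_cong[OF refl d(2)] refl] by blast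
    then show ?thesis by (intro D.borel_measurable_nn_integral) (simp add: split_beta')
  qed
  note em = code_encoder(1)[OF V g]
  have "(\<integral>\<^sup>+z. f z \<partial>code_joint n (gauss \<mu> \<sigma>) NK enc dec) =
    (\<integral>\<^sup>+x. (\<Sum>k<NK. \<Sum>j<NJ. ennreal (1 / real NK) * (emeasure (enc x k) {j} * (\<integral>\<^sup>+y. f (x, y) \<partial>dec j k))) \<partial>PiM {..<n} (\<lambda>_. gauss \<mu> \<sigma>))"
    by (rule nn_integral_code_joint[OF V g f])
  also have "\<dots> = (\<integral>\<^sup>+x. (\<Sum>k<NK. \<Sum>j<NJ. ennreal (measure (enc x k) {j} / real NK) * (\<integral>\<^sup>+y. f (x, y) \<partial>dec j k)) \<partial>distr (std n) (Rn n) a)"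
    unfolding da
  proof (intro nn_integral_cong sum.cong refl)
    fix x k j assume "x \<in> space (distr (std n) (Rn n) a)" "k \<in> {..<NK}" "j \<in> {..<NJ}"
    then have "emeasure (enc x k) {j} = ennreal (measure (enc x k) {j})"
      by (intro code_encoder(3)[OF V g]) auto
    then show "ennreal (1 / real NK) * (emeasure (enc x k) {j} * (\<integral>\<^sup>+y. f (x, y) \<partial>dec j k)) =
       ennreal (measure (enc x k) {j} / real NK) * (\<integral>\<^sup>+y. f (x, y) \<partial>dec j k)"
      by (simp add: divide_inverse ennreal_mult mult_ac)
  qed
  also have "\<dots> = (\<integral>\<^sup>+y. (\<Sum>k<NK. \<Sum>j<NJ. ennreal (measure (enc (a y) k) {j} / real NK) * (\<integral>\<^sup>+z. f (a y, z) \<partial>dec j k)) \<partial>std n)"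
  proof (rule nn_integral_distr[OF a])
    show "(\<lambda>x. \<Sum>k<NK. \<Sum>j<NJ. ennreal (measure (enc x k) {j} / real NK) * (\<integral>\<^sup>+y. f (x, y) \<partial>dec j k))
       \<in> borel_measurable (distr (std n) (Rn n) a)"
    proof (intro borel_measurable_sum borel_measurable_times_ennreal measurable_compose[OF _ measurable_ennreal])
      fix k j assume kj: "k \<in> {..<NK}" "j \<in> {..<NJ}"
      show "(\<lambda>x. \<integral>\<^sup>+y. f (x, y) \<partial>dec j k) \<in> borel_measurable (distr (std n) (Rn n) a)"
        using dm[OF kj] by simp
      show "(\<lambda>x. measure (enc x k) {j} / real NK) \<in> borel_measurable (distr (std n) (Rn n) a)"
        using em[of k j] kj by simp
    qed
  qed
  also have "\<dots> = (\<Sum>k<NK. \<Sum>j<NJ. \<integral>\<^sup>+y. ennreal (measure (enc (a y) k) {j} / real NK) * (\<integral>\<^sup>+z. f (a y, z) \<partial>dec j k) \<partial>std n)"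
  proof -
    have m: "(\<lambda>y. ennreal (measure (enc (a y) k) {j} / real NK) * (\<integral>\<^sup>+z. f (a y, z) \<partial>dec j k)) \<in> borel_measurable (std n)"
      if "k \<in> {..<NK}" "j \<in> {..<NJ}" for k j
    proof (intro borel_measurable_times_ennreal measurable_compose[OF _ measurable_ennreal])
      show "(\<lambda>y. \<integral>\<^sup>+z. f (a y, z) \<partial>dec j k) \<in> borel_measurable (std n)"
        by (rule measurable_compose[OF a dm[OF that]])
      show "(\<lambda>y. measure (enc (a y) k) {j} / real NK) \<in> borel_measurable (std n)"
        using measurable_compose[OF a em[of k j]] that by simp
    qed
    show ?thesis using m
      by (subst nn_integral_sum) (auto intro!: sum.cong nn_integral_sum)
  qed
  finally show ?thesis .
qed

text \<open>Given the seed, the encoder is a quantizer with \<open>NJ\<close> cells of a source that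
  does not depend on the seed. Averaging over the seeds therefore cannot raise the energy: on this
  side common randomness does not help.\<close>

lemma encoder_energy:
  fixes v :: "nat \<Rightarrow> nat \<Rightarrow> (nat \<Rightarrow> real) \<Rightarrow> real"
  assumes n: "1 \<le> n" and J: "1 \<le> NJ" and K: "1 \<le> NK" and R: "ln (real NJ) / real n \<le> R"
    and v: "\<And>k j. k < NK \<Longrightarrow> j < NJ \<Longrightarrow> v k j \<in> borel_measurable (std n)"
      "\<And>k j y. k < NK \<Longrightarrow> j < NJ \<Longrightarrow> 0 \<le> v k j y"
      "\<And>k y. k < NK \<Longrightarrow> y \<in> space (Rn n) \<Longrightarrow> (\<Sum>j<NJ. v k j y) = 1"
  shows "(\<Sum>k<NK. \<Sum>j<NJ. \<Sum>t<n. (\<integral>y. v k j y / real NK * y t \<partial>std n)\<^sup>2 / (\<integral>y. v k j y / real NK \<partial>std n))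
    \<le> real n * (1 - exp (-2 * R))"
proof -
  have sp: "space (std n) = space (Rn n)" by (simp add: space_PiM)
  have k: "(\<Sum>j<NJ. \<Sum>t<n. (\<integral>y. v k j y / real NK * y t \<partial>std n)\<^sup>2 / (\<integral>y. v k j y / real NK \<partial>std n))
    \<le> real n * (1 - exp (-2 * R)) / real NK" if k: "k < NK" for k
  proof -
    have "(\<Sum>j<NJ. \<Sum>t<n. (\<integral>y. v k j y * y t \<partial>std n)\<^sup>2 / (\<integral>y. v k j y \<partial>std n))
      \<le> real n - real n * real (card {..<NJ}) powr (- 2 / real n)"
      using J k v sp by (intro gaussian_centroid_energy n) (auto simp: lessThan_empty_iff)
    also have "\<dots> \<le> real n * (1 - exp (-2 * R))"
    proof -
      have "ln (real NJ) * (2 / real n) \<le> 2 * R" using R n by (simp add: field_simps)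
      then have "exp (-2 * R) \<le> real NJ powr (- 2 / real n)"
        using J by (simp add: powr_def mult.commute)
      then show ?thesis using mult_left_mono[of _ _ "real n"] by (simp add: right_diff_distrib)
    qed
    finally have "(\<Sum>j<NJ. \<Sum>t<n. (\<integral>y. v k j y * y t \<partial>std n)\<^sup>2 / (\<integral>y. v k j y \<partial>std n)) / real NK
      \<le> real n * (1 - exp (-2 * R)) / real NK" by (intro divide_right_mono) auto
    moreover have "(\<integral>y. v k j y / real NK * y t \<partial>std n)\<^sup>2 / (\<integral>y. v k j y / real NK \<partial>std n) =
       (\<integral>y. v k j y * y t \<partial>std n)\<^sup>2 / (\<integral>y. v k j y \<partial>std n) / real NK" for j t
      using K by (simp add: power2_eq_square)
    ultimately show ?thesis by (simp add: sum_divide_distrib)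
  qed
  have "(\<Sum>k<NK. \<Sum>j<NJ. \<Sum>t<n. (\<integral>y. v k j y / real NK * y t \<partial>std n)\<^sup>2 / (\<integral>y. v k j y / real NK \<partial>std n))
    \<le> (\<Sum>k<NK. real n * (1 - exp (-2 * R)) / real NK)" using k by (intro sum_mono) auto
  then show ?thesis using K by simp
qed

text \<open>Bayes' rule. The decoder laws mix to the output law, so each of them, scaled by its
  probability, has a density with respect to it; these densities are the posterior probabilities of
  the indices given the output.\<close>

lemma mixture_weights:
  fixes r :: "'u \<Rightarrow> real" and N :: "'u \<Rightarrow> 'a measure"
  assumes Q: "prob_space Q" and U: "finite U"
    and N: "\<And>u. u \<in> U \<Longrightarrow> prob_space (N u)" "\<And>u. u \<in> U \<Longrightarrow> sets (N u) = sets Q"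
    and r: "\<And>u. u \<in> U \<Longrightarrow> 0 \<le> r u"
    and mix: "\<And>B. B \<in> sets Q \<Longrightarrow> emeasure Q B = (\<Sum>u\<in>U. ennreal (r u) * emeasure (N u) B)"
  obtains w where "\<And>u. u \<in> U \<Longrightarrow> w u \<in> borel_measurable Q" "\<And>u x. u \<in> U \<Longrightarrow> 0 \<le> w u x"
    "AE x in Q. (\<Sum>u\<in>U. w u x) = 1"
    "\<And>u g. u \<in> U \<Longrightarrow> integrable Q g \<Longrightarrow> (\<integral>x. w u x * g x \<partial>Q) = r u * (\<integral>x. g x \<partial>N u) \<and> (0 < r u \<longrightarrow> integrable (N u) (g :: 'a \<Rightarrow> real))"
proof -
  interpret Q: prob_space Q by fact
  \<comment> \<open>Only the scaled law is dominated by \<open>Q\<close>: for \<open>r u = 0\<close>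
    the law \<open>N u\<close> may be singular to \<open>Q\<close>. This is why integrability under
    \<open>N u\<close> is claimed for positive \<open>r u\<close> only.\<close>
  define \<nu> where "\<nu> u = density (N u) (\<lambda>_. ennreal (r u))" for u
  have em: "emeasure (\<nu> u) B = ennreal (r u) * emeasure (N u) B" if "u \<in> U" "B \<in> sets Q" for u B
    using that N unfolding \<nu>_def by (subst emeasure_density_const) auto
  have "\<exists>D. D \<in> borel_measurable Q \<and> (\<forall>x. 0 \<le> D x) \<and> density Q (\<lambda>x. ennreal (D x)) = \<nu> u" if u: "u \<in> U" for u
  proof -
    interpret N: prob_space "N u" by (rule N[OF u])
    have s: "sets (\<nu> u) = sets Q" using N u by (simp add: \<nu>_def)
    have f: "finite_measure (\<nu> u)"
      using em[OF u, of "space Q"] sets_eq_imp_space_eq[OF s] N.emeasure_finite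
      by (intro finite_measureI) (auto simp: ennreal_mult_eq_top_iff)
    have ac: "absolutely_continuous Q (\<nu> u)"
      unfolding absolutely_continuous_def
    proof
      fix B assume "B \<in> null_sets Q"
      then have B: "B \<in> sets Q" "emeasure Q B = 0" by auto
      then have "\<forall>v\<in>U. ennreal (r v) * emeasure (N v) B = 0" using mix[OF B(1)] U by (simp add: sum_nonneg_eq_0_iff)
      then show "B \<in> null_sets (\<nu> u)" using em[OF u B(1)] s B u by auto
    qed
    obtain D where D: "D \<in> borel_measurable Q" "AE x in Q. RN_deriv Q (\<nu> u) x = ennreal (D x)" "\<And>x. 0 \<le> D x"
      using Q.real_RN_deriv[OF f ac s] by metis
    have "density Q (\<lambda>x. ennreal (D x)) = density Q (RN_deriv Q (\<nu> u))"
      using D by (intro density_cong) (auto elim: AE_mp)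
    also have "\<dots> = \<nu> u" by (rule Q.density_RN_deriv[OF ac s])
    finally show ?thesis using D by auto
  qed
  then obtain w where w: "\<And>u. u \<in> U \<Longrightarrow> w u \<in> borel_measurable Q" "\<And>u x. u \<in> U \<Longrightarrow> 0 \<le> w u x"
    "\<And>u. u \<in> U \<Longrightarrow> density Q (\<lambda>x. ennreal (w u x)) = \<nu> u" by metis
  \<comment> \<open>The scaled laws add up to \<open>Q\<close>, whose density with respect to itself
    is 1; uniqueness of densities then gives the partition of unity.\<close>
  have "density Q (\<lambda>x. ennreal (\<Sum>u\<in>U. w u x)) = density Q (\<lambda>_. 1)"
  proof (rule measure_eqI)
    fix B assume "B \<in> sets (density Q (\<lambda>x. ennreal (\<Sum>u\<in>U. w u x)))"
    then have B[measurable]: "B \<in> sets Q" by simp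
    have "emeasure (density Q (\<lambda>x. ennreal (\<Sum>u\<in>U. w u x))) B = (\<integral>\<^sup>+x. ennreal (\<Sum>u\<in>U. w u x) * indicator B x \<partial>Q)"
      using w(1) by (intro emeasure_density) auto
    also have "\<dots> = (\<integral>\<^sup>+x. (\<Sum>u\<in>U. ennreal (w u x) * indicator B x) \<partial>Q)"
    proof (intro nn_integral_cong)
      fix x
      have "ennreal (\<Sum>u\<in>U. w u x) = (\<Sum>u\<in>U. ennreal (w u x))"
        using w(2) by (intro sum_ennreal[symmetric])
      then show "ennreal (\<Sum>u\<in>U. w u x) * indicator B x = (\<Sum>u\<in>U. ennreal (w u x) * indicator B x)"
        by (simp only: sum_distrib_right)
    qed
    also have "\<dots> = (\<Sum>u\<in>U. \<integral>\<^sup>+x. ennreal (w u x) * indicator B x \<partial>Q)"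
      using w(1) by (intro nn_integral_sum) auto
    also have "\<dots> = (\<Sum>u\<in>U. emeasure (\<nu> u) B)"
    proof (intro sum.cong refl)
      fix u assume u: "u \<in> U"
      show "(\<integral>\<^sup>+x. ennreal (w u x) * indicator B x \<partial>Q) = emeasure (\<nu> u) B"
        using w(1)[OF u] unfolding w(3)[OF u, symmetric] by (subst emeasure_density) auto
    qed
    also have "\<dots> = emeasure Q B" using mix[OF B] em by simp
    also have "\<dots> = emeasure (density Q (\<lambda>_. 1)) B" by (simp add: density_1)
    finally show "emeasure (density Q (\<lambda>x. ennreal (\<Sum>u\<in>U. w u x))) B = emeasure (density Q (\<lambda>_. 1)) B" .
  qed simp
  then have "AE x in Q. ennreal (\<Sum>u\<in>U. w u x) = 1"
    using w(1) by (subst (asm) Q.density_unique_iff) auto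
  then have s: "AE x in Q. (\<Sum>u\<in>U. w u x) = 1"
    by eventually_elim (simp add: ennreal_eq_1)
  show thesis
  proof (rule that[OF w(1,2) s])
    fix u and g :: "'a \<Rightarrow> real" assume u: "u \<in> U" and g: "integrable Q g"
    have gQ: "g \<in> borel_measurable Q" using g by auto
    then have gm: "g \<in> borel_measurable (N u)" using N(2)[OF u] measurable_cong_sets by blast
    have b: "AE x in Q. 0 \<le> w u x \<and> w u x \<le> 1"
      by (rule AE_weight_bounds[OF U _ s u]) (use w in auto)
    have "(\<integral>x. w u x * g x \<partial>Q) = (\<integral>x. g x \<partial>density Q (\<lambda>x. ennreal (w u x)))"
      using w u gQ by (subst integral_real_density) auto
    also have "\<dots> = r u * (\<integral>x. g x \<partial>N u)"
      unfolding w(3)[OF u] \<nu>_def using gm r u by (subst integral_real_density) auto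
    finally have e: "(\<integral>x. w u x * g x \<partial>Q) = r u * (\<integral>x. g x \<partial>N u)" .
    have "integrable Q (\<lambda>x. w u x * g x)" by (rule integrable_weight_mult[OF w(1)[OF u] b g])
    then have "integrable (density Q (\<lambda>x. ennreal (w u x))) g"
      using w u gQ by (subst integrable_real_density) auto
    then have "integrable (N u) (\<lambda>x. r u * g x)"
      unfolding w(3)[OF u] \<nu>_def using gm r u by (subst (asm) integrable_real_density) auto
    then have "0 < r u \<longrightarrow> integrable (N u) g" by auto
    with e show "(\<integral>x. w u x * g x \<partial>Q) = r u * (\<integral>x. g x \<partial>N u) \<and> (0 < r u \<longrightarrow> integrable (N u) g)" by simp
  qed
qed

section \<open>The lower bound\<close>

text \<open>Cauchy-Schwarz with \<open>1 / r i\<close> split into two roots. Cells of mass 0 drop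
  out on both sides because division by 0 gives 0.\<close>

lemma sum_quotient_le_sqrt:
  fixes m m' r :: "'i \<Rightarrow> real"
  assumes r: "\<And>i. i \<in> S \<Longrightarrow> 0 \<le> r i"
  shows "(\<Sum>i\<in>S. m i * m' i / r i) \<le> sqrt (\<Sum>i\<in>S. (m i)\<^sup>2 / r i) * sqrt (\<Sum>i\<in>S. (m' i)\<^sup>2 / r i)"
proof -
  have "(\<Sum>i\<in>S. m i * m' i / r i) = (\<Sum>i\<in>S. (m i / sqrt (r i)) * (m' i / sqrt (r i)))"
    using r by (intro sum.cong refl) (simp add: real_sqrt_mult_self)
  also have "\<dots> \<le> sqrt ((\<Sum>i\<in>S. (m i / sqrt (r i))\<^sup>2) * (\<Sum>i\<in>S. (m' i / sqrt (r i))\<^sup>2))"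
    by (intro real_le_rsqrt Cauchy_Schwarz_ineq_sum)
  also have "\<dots> = sqrt (\<Sum>i\<in>S. (m i)\<^sup>2 / r i) * sqrt (\<Sum>i\<in>S. (m' i)\<^sup>2 / r i)"
    unfolding real_sqrt_mult using r by (simp add: power_divide cong: sum.cong)
  finally show ?thesis .
qed

text \<open>The second moment of a reconstruction can exceed \<open>\<sigma>\<^sup>2\<close> and so
  lie outside the range of the infimum. Beyond \<open>\<sigma>\<close> the objective increases, and
  the end point \<open>\<sigma>\<close> takes over.\<close>

lemma D_lower_le:
  assumes \<sigma>: "0 < \<sigma>" and R: "0 \<le> R" "0 \<le> Rc" and s: "pos (\<sigma> - sqrt P) \<le> s" and P: "0 \<le> P"
  shows "D_lower \<sigma> R Rc P \<le> \<sigma>\<^sup>2 + s\<^sup>2 - 2 * \<sigma> * sqrt ((1 - exp (-2*R)) * (s\<^sup>2 - (pos (\<sigma> * exp (-(R+Rc)) - sqrt P))\<^sup>2))"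
proof -
  define c where "c = pos (\<sigma> * exp (-(R+Rc)) - sqrt P)"
  define E where "E = 1 - exp (-2*R)"
  define F where "F s = \<sigma>\<^sup>2 + s\<^sup>2 - 2 * \<sigma> * sqrt (E * (s\<^sup>2 - c\<^sup>2))" for s
  have E: "0 \<le> E" "E \<le> 1" using R by (auto simp: E_def)
  \<comment> \<open>A real \<open>Inf\<close> lies below the members of the set only if the set is
    bounded below; the objective dominates \<open>(\<sigma> - x)\<^sup>2\<close>. Where the radicand
    is negative \<open>sqrt\<close> is negative too, and the estimate covers that case as
    well.\<close>
  have bdd: "bdd_below (F ` {pos (\<sigma> - sqrt P)..\<sigma>})"
  proof (rule bdd_belowI2[where m=0])
    fix x assume "x \<in> {pos (\<sigma> - sqrt P)..\<sigma>}"
    then have x: "0 \<le> x" by (simp add: pos_def)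
    have "E * (x\<^sup>2 - c\<^sup>2) \<le> E * x\<^sup>2" using E by (intro mult_left_mono) auto
    also have "\<dots> \<le> 1 * x\<^sup>2" using E by (intro mult_right_mono) auto
    finally have "sqrt (E * (x\<^sup>2 - c\<^sup>2)) \<le> x" using x by (intro real_le_lsqrt) auto
    then have "2 * \<sigma> * sqrt (E * (x\<^sup>2 - c\<^sup>2)) \<le> 2 * \<sigma> * x" using \<sigma> by simp
    moreover have "0 \<le> (\<sigma> - x)\<^sup>2" by simp
    ultimately show "0 \<le> F x" unfolding F_def by (simp add: power2_diff)
  qed
  have DF: "D_lower \<sigma> R Rc P = Inf (F ` {pos (\<sigma> - sqrt P)..\<sigma>})"
    by (simp add: D_lower_def F_def[abs_def] E_def c_def)
  have le: "D_lower \<sigma> R Rc P \<le> F x" if "x \<in> {pos (\<sigma> - sqrt P)..\<sigma>}" for x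
    unfolding DF using that by (intro cInf_lower bdd) auto
  have "D_lower \<sigma> R Rc P \<le> F s"
  proof (cases "s \<le> \<sigma>")
    case True
    then show ?thesis using s by (intro le) auto
  next
    case False
    have s\<sigma>: "\<sigma>\<^sup>2 \<le> s\<^sup>2" using False \<sigma> by (intro power_mono) auto
    have c0: "0 \<le> c" by (simp add: c_def pos_def)
    have "c \<le> \<sigma> * exp (- R)"
    proof -
      have "\<sigma> * exp (-(R+Rc)) \<le> \<sigma> * exp (- R)" using \<sigma> R by simp
      moreover have "0 \<le> sqrt P" "0 \<le> \<sigma> * exp (- R)" using \<sigma> P by auto
      ultimately have "\<sigma> * exp (-(R+Rc)) - sqrt P \<le> \<sigma> * exp (- R)" by linarith
      with \<open>0 \<le> \<sigma> * exp (- R)\<close> show ?thesis unfolding c_def pos_def by simp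
    qed
    then have "c\<^sup>2 \<le> (\<sigma> * exp (- R))\<^sup>2" using c0 by (intro power_mono)
    then have cE: "\<sigma>\<^sup>2 * E \<le> \<sigma>\<^sup>2 - c\<^sup>2"
      by (simp add: E_def power_mult_distrib exp_double[symmetric] algebra_simps)
    \<comment> \<open>As a function of \<open>u\<close> the objective is a parabola with vertex
      \<open>\<sigma> * sqrt E\<close>, and \<open>c \<le> \<sigma> * exp (- R)\<close> puts the
      vertex to the left of \<open>v\<close>; hence it increases from \<open>v\<close> to
      \<open>u\<close>.\<close>
    define u v where "u = sqrt (s\<^sup>2 - c\<^sup>2)" and "v = sqrt (\<sigma>\<^sup>2 - c\<^sup>2)"
    have E0: "0 \<le> \<sigma>\<^sup>2 * E" using E by simp
    have v: "\<sigma> * sqrt E \<le> v" using real_sqrt_le_mono[OF cE] \<sigma> by (simp add: v_def real_sqrt_mult)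
    have uv: "v \<le> u" using s\<sigma> by (simp add: u_def v_def)
    have sq: "u\<^sup>2 = s\<^sup>2 - c\<^sup>2" "v\<^sup>2 = \<sigma>\<^sup>2 - c\<^sup>2" using cE E0 s\<sigma> by (auto simp: u_def v_def)
    have "F s - F \<sigma> = (u - v) * ((u - \<sigma> * sqrt E) + (v - \<sigma> * sqrt E))"
    proof -
      have "F s - F \<sigma> = (s\<^sup>2 - \<sigma>\<^sup>2) - 2 * \<sigma> * sqrt E * (u - v)"
        unfolding F_def real_sqrt_mult u_def v_def by (simp add: algebra_simps)
      also have "s\<^sup>2 - \<sigma>\<^sup>2 = u\<^sup>2 - v\<^sup>2" using sq by simp
      finally show ?thesis by (simp add: power2_eq_square algebra_simps)
    qed
    also have "\<dots> \<ge> 0" using v uv by (intro mult_nonneg_nonneg) auto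
    finally have "F \<sigma> \<le> F s" by simp
    moreover have "D_lower \<sigma> R Rc P \<le> F \<sigma>" using \<sigma> P by (intro le) (auto simp: pos_def)
    ultimately show ?thesis by simp
  qed
  then show ?thesis by (simp add: F_def E_def c_def)
qed

lemma measurable_gauss[simp]: "measurable (gauss m c) N = measurable borel N"
  by (rule measurable_cong_sets) auto

lemma sum_Times: "(\<Sum>u\<in>A \<times> B. f u) = (\<Sum>a\<in>A. \<Sum>b\<in>B. f (a, b))"
  by (simp add: sum.cartesian_product)

text \<open>The triangle inequality in mean square, with the constant \<open>\<mu>\<close> as third
  point: a finite cost carries square integrability over to \<open>q\<close>, and the root of the
  second moment loses at most \<open>sqrt P'\<close>.\<close>

lemma coupling_second_moment:
  assumes \<sigma>: "0 < \<sigma>" and P': "0 \<le> P'"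
    and pi: "sets \<pi> = sets (borel \<Otimes>\<^sub>M borel)" "distr \<pi> borel fst = gauss \<mu> \<sigma>" "distr \<pi> borel snd = q"
    and cost: "(\<integral>\<^sup>+z. ennreal ((fst z - snd z)\<^sup>2) \<partial>\<pi>) \<le> ennreal P'"
  shows "integrable q (\<lambda>x. (x - \<mu>)\<^sup>2)" "\<sigma> - sqrt P' \<le> sqrt (\<integral>x. (x - \<mu>)\<^sup>2 \<partial>q)"
proof -
  note [measurable_cong] = pi(1)
  have m: "fst \<in> \<pi> \<rightarrow>\<^sub>M borel" "snd \<in> \<pi> \<rightarrow>\<^sub>M borel" by measurable
  have e: "\<mu> + \<sigma> * y - \<mu> = \<sigma> * y" for y by simp
  have gm: "integrable (gauss \<mu> \<sigma>) (\<lambda>x. (x - \<mu>)\<^sup>2)" "(\<integral>x. (x - \<mu>)\<^sup>2 \<partial>gauss \<mu> \<sigma>) = \<sigma>\<^sup>2"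
    unfolding gauss_affine[OF \<sigma>, of \<mu>, symmetric]
    by (subst integrable_distr_eq, auto simp: e power_mult_distrib gauss_moments)
       (subst integral_distr, auto simp: e power_mult_distrib gauss_moments)
  have 1: "integrable \<pi> (\<lambda>z. (fst z - snd z)\<^sup>2)"
    using cost by (intro integrableI_bounded) (auto simp: le_less_trans)
  have v1: "(\<integral>z. (fst z - snd z)\<^sup>2 \<partial>\<pi>) \<le> P'" using cost P' nn_integral_eq_integral[OF 1] by simp
  have 2: "integrable \<pi> (\<lambda>z. (fst z - \<mu>)\<^sup>2)" "(\<integral>z. (fst z - \<mu>)\<^sup>2 \<partial>\<pi>) = \<sigma>\<^sup>2"
    using integrable_distr_eq[OF m(1), of "\<lambda>x. (x - \<mu>)\<^sup>2"] integral_distr[OF m(1), of "\<lambda>x. (x - \<mu>)\<^sup>2"] gm pi(2) by auto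
  have 3: "integrable \<pi> (\<lambda>z. (snd z - \<mu>)\<^sup>2)"
  proof (rule Bochner_Integration.integrable_bound)
    show "integrable \<pi> (\<lambda>z. 2 * (fst z - \<mu>)\<^sup>2 + 2 * (fst z - snd z)\<^sup>2)" using 1 2 by simp
    have "(snd z - \<mu>)\<^sup>2 \<le> 2 * (fst z - \<mu>)\<^sup>2 + 2 * (fst z - snd z)\<^sup>2" for z :: "real \<times> real"
      using square_diff_weighted[of 1 "fst z - \<mu>" "snd z - fst z"] by (simp add: power2_commute)
    then show "AE z in \<pi>. norm ((snd z - \<mu>)\<^sup>2) \<le> norm (2 * (fst z - \<mu>)\<^sup>2 + 2 * (fst z - snd z)\<^sup>2)"
      by (intro AE_I2) auto
  qed measurable
  then show "integrable q (\<lambda>x. (x - \<mu>)\<^sup>2)"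
    using integrable_distr_eq[OF m(2), of "\<lambda>x. (x - \<mu>)\<^sup>2"] pi(3) by simp
  have 4: "(\<integral>z. (snd z - \<mu>)\<^sup>2 \<partial>\<pi>) = (\<integral>x. (x - \<mu>)\<^sup>2 \<partial>q)"
    using integral_distr[OF m(2), of "\<lambda>x. (x - \<mu>)\<^sup>2"] pi(3) by simp
  have "sqrt (\<sigma>\<^sup>2) \<le> sqrt (\<integral>x. (x - \<mu>)\<^sup>2 \<partial>q) + sqrt P'"
  proof (rule sqrt_triangle_of_weighted)
    fix \<tau> :: real assume \<tau>: "0 < \<tau>"
    have "(\<integral>z. (fst z - \<mu>)\<^sup>2 \<partial>\<pi>) \<le> (\<integral>z. (1 + \<tau>) * (snd z - \<mu>)\<^sup>2 + (1 + 1 / \<tau>) * (fst z - snd z)\<^sup>2 \<partial>\<pi>)"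
    proof (rule integral_mono)
      fix z :: "real \<times> real"
      show "(fst z - \<mu>)\<^sup>2 \<le> (1 + \<tau>) * (snd z - \<mu>)\<^sup>2 + (1 + 1 / \<tau>) * (fst z - snd z)\<^sup>2"
        using square_diff_weighted[OF \<tau>, of "snd z - \<mu>" "fst z - snd z"] by simp
    qed (use 1 2 3 in simp_all)
    also have "\<dots> = (1 + \<tau>) * (\<integral>x. (x - \<mu>)\<^sup>2 \<partial>q) + (1 + 1 / \<tau>) * (\<integral>z. (fst z - snd z)\<^sup>2 \<partial>\<pi>)" using 1 3 4 by simp
    also have "\<dots> \<le> (1 + \<tau>) * (\<integral>x. (x - \<mu>)\<^sup>2 \<partial>q) + (1 + 1 / \<tau>) * P'" using v1 \<tau> by (intro add_left_mono mult_left_mono) auto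
    finally show "\<sigma>\<^sup>2 \<le> (1 + \<tau>) * (\<integral>x. (x - \<mu>)\<^sup>2 \<partial>q) + (1 + 1 / \<tau>) * P'" using 2 by simp
  qed (use P' in auto)
  then show "\<sigma> - sqrt P' \<le> sqrt (\<integral>x. (x - \<mu>)\<^sup>2 \<partial>q)" using \<sigma> by simp
qed

lemma achievable_ge_D_lower:
  fixes \<mu> \<sigma> R Rc P D :: real
  assumes \<sigma>: "0 < \<sigma>" and R: "0 \<le> R" and Rc: "0 \<le> Rc" and P: "0 \<le> P"
    and ach: "achievable (gauss \<mu> \<sigma>) R Rc P D"
  shows "D_lower \<sigma> R Rc P \<le> D"
proof -
  note g = prob_space_gauss[OF \<sigma>, of \<mu>] sets_gauss[of \<mu> \<sigma>]
  obtain n NJ NK enc dec q where V: "valid_code n NJ NK enc dec"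
    and RJ: "ln (real NJ) / real n \<le> R" and RK: "ln (real NK) / real n \<le> Rc" and D0: "0 \<le> D"
    and dist: "ennreal (1 / real n) * (\<Sum>t<n. \<integral>\<^sup>+ z. ennreal ((fst z t - snd z t)\<^sup>2) \<partial>code_joint n (gauss \<mu> \<sigma>) NK enc dec) \<le> ennreal D"
    and perc: "ennreal (1 / real n) * (\<Sum>t<n. W2sq (distr (code_joint n (gauss \<mu> \<sigma>) NK enc dec) borel (\<lambda>z. fst z t))
        (distr (code_joint n (gauss \<mu> \<sigma>) NK enc dec) borel (\<lambda>z. snd z t))) \<le> ennreal P"
    and q: "prob_space q" "sets q = sets (borel :: real measure)"
    and mq: "distr (code_joint n (gauss \<mu> \<sigma>) NK enc dec) (Rn n) snd = PiM {..<n} (\<lambda>_. q)"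
    using ach unfolding achievable_def Let_def by (elim exE conjE) (rule that)
  define M where "M = code_joint n (gauss \<mu> \<sigma>) NK enc dec"
  define Q where "Q = PiM {..<n} (\<lambda>_. q)"
  have n: "1 \<le> n" and NJ: "1 \<le> NJ" and NK: "1 \<le> NK" using V unfolding valid_code_def by blast+
  have sM[measurable_cong]: "sets M = sets (Rn n \<Otimes>\<^sub>M Rn n)" unfolding M_def by (rule sets_code_joint[OF V g])
  have sQ[measurable_cong]: "sets Q = sets (Rn n)" unfolding Q_def by (intro sets_PiM_cong) (auto simp: q)
  interpret Q: prob_space Q unfolding Q_def by (intro prob_space_PiM q)
  have ct[measurable]: "(\<lambda>x. x t) \<in> borel_measurable (Rn n)" if "t < n" for t
    using that by (intro measurable_component_singleton) simp
  have fsM[measurable]: "fst \<in> M \<rightarrow>\<^sub>M Rn n" "snd \<in> M \<rightarrow>\<^sub>M Rn n"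
    using measurable_cong_sets[OF sM refl] measurable_fst measurable_snd by blast+
  have W: "W2sq (gauss \<mu> \<sigma>) q \<le> ennreal P"
    using perc unfolding average_perception[OF V g q mq] .
  \<comment> \<open>The infimum in \<open>W2sq\<close> is only approached, from
    \<open>P' > P\<close>, which avoids the existence of an optimal coupling. Every bound obtained
    for \<open>P'\<close> is carried to \<open>P\<close> by continuity.\<close>
  have coupling: "\<exists>\<pi>. prob_space \<pi> \<and> sets \<pi> = sets (borel \<Otimes>\<^sub>M borel) \<and> distr \<pi> borel fst = gauss \<mu> \<sigma> \<and> distr \<pi> borel snd = q
      \<and> (\<integral>\<^sup>+z. ennreal ((fst z - snd z)\<^sup>2) \<partial>\<pi>) \<le> ennreal P'" if P': "P < P'" for P'
  proof -
    have "W2sq (gauss \<mu> \<sigma>) q < ennreal P'" using W P P' by (simp add: ennreal_less_iff le_less_trans)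
    then show ?thesis unfolding W2sq_def by (subst (asm) INF_less_iff) (auto intro: less_imp_le)
  qed
  \<comment> \<open>The second moment about \<open>\<mu>\<close> instead of the variance of \<open>q\<close>: the mean of \<open>q\<close> then never enters.\<close>
  define s where "s = sqrt (\<integral>x. (x - \<mu>)\<^sup>2 \<partial>q)"
  have q2: "integrable q (\<lambda>x. (x - \<mu>)\<^sup>2)" and sge: "\<sigma> - sqrt P' \<le> s" if P': "P < P'" for P'
  proof -
    obtain \<pi> where pi: "sets \<pi> = sets (borel \<Otimes>\<^sub>M borel)" "distr \<pi> borel fst = gauss \<mu> \<sigma>" "distr \<pi> borel snd = q"
      "(\<integral>\<^sup>+z. ennreal ((fst z - snd z)\<^sup>2) \<partial>\<pi>) \<le> ennreal P'" using coupling[OF P'] by blast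
    have "0 \<le> P'" using P P' by simp
    from coupling_second_moment[OF \<sigma> this pi]
    show "integrable q (\<lambda>x. (x - \<mu>)\<^sup>2)" "\<sigma> - sqrt P' \<le> s" by (simp_all only: s_def)
  qed
  note q2 = q2[of "P + 1", simplified]
  have s2: "(\<integral>x. (x - \<mu>)\<^sup>2 \<partial>q) = s\<^sup>2" and s0: "0 \<le> s" by (auto simp: s_def)
  \<comment> \<open>A limit from the right is enough, and since \<open>sqrt\<close> is continuous at
    0 as well, it covers \<open>P = 0\<close>.\<close>
  have limP: "f P \<le> c" if f: "isCont f P" and le: "\<And>P'. P < P' \<Longrightarrow> f P' \<le> c" for f :: "real \<Rightarrow> real" and c
  proof (rule tendsto_upperbound)
    show "(f \<longlongrightarrow> f P) (at_right P)" using f by (simp add: isCont_def filterlim_at_split)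
    show "\<forall>\<^sub>F x in at_right P. f x \<le> c" using le by (auto simp: eventually_at_right_field intro!: exI[of _ "P + 1"])
  qed simp
  have spos: "pos (\<sigma> - sqrt P) \<le> s"
  proof -
    have "isCont (\<lambda>P. \<sigma> - sqrt P) P" by (intro continuous_intros isCont_real_sqrt)
    then have "\<sigma> - sqrt P \<le> s" using sge by (rule limP)
    then show ?thesis using s0 by (simp add: pos_def)
  qed

  define a where "a y = (\<lambda>t\<in>{..<n}. \<mu> + \<sigma> * y t)" for y :: "nat \<Rightarrow> real"
  have a: "a \<in> std n \<rightarrow>\<^sub>M Rn n"
    unfolding a_def[abs_def] measurable_cong_sets[OF sets_PiM_gauss refl] by (rule measurable_affine_Rn)
  define v where "v k j y = measure (enc (a y) k) {j}" for k j y
  \<comment> \<open>One cell for each pair of seed and message: \<open>w\<close> is its probability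
    given the source, \<open>r\<close> its total probability, and \<open>m\<close> is
    \<open>r\<close> times the mean of the source on it.\<close>
  define w where "w u y = v (fst u) (snd u) y / real NK" for u y
  define U where "U = {..<NK} \<times> {..<NJ}"
  define d where "d u = dec (snd u) (fst u)" for u
  define r where "r u = (\<integral>y. w u y \<partial>std n)" for u
  define m where "m u t = (\<integral>y. w u y * y t \<partial>std n)" for u t
  have U: "finite U" "U \<noteq> {}" using NJ NK by (auto simp: U_def lessThan_empty_iff)
  have vm: "v k j \<in> borel_measurable (std n)" if "k < NK" for k j
    unfolding v_def by (rule measurable_compose[OF a code_encoder(1)[OF V g that]])
  have v0: "0 \<le> v k j y" for k j y by (simp add: v_def)
  have v1: "(\<Sum>j<NJ. v k j y) = 1" if "k < NK" "y \<in> space (Rn n)" for k y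
    unfolding v_def using code_encoder(2)[OF V g, of k "a y"] that measurable_space[OF a] by (simp add: space_PiM)
  have wm: "w u \<in> borel_measurable (std n)" if "u \<in> U" for u
    using vm that unfolding w_def U_def by auto
  have w0: "0 \<le> w u y" for u y by (simp add: w_def v0)
  have w1: "(\<Sum>u\<in>U. w u y) = 1" if y: "y \<in> space (std n)" for y
  proof -
    have "(\<Sum>u\<in>U. w u y) = (\<Sum>k<NK. \<Sum>j<NJ. v k j y / real NK)"
      unfolding U_def w_def by (simp add: sum.cartesian_product split_beta')
    also have "\<dots> = (\<Sum>k<NK. 1 / real NK)"
      using v1 y by (intro sum.cong refl) (simp add: sum_divide_distrib[symmetric] space_PiM)
    finally show ?thesis using NK by simp
  qed
  have w1': "AE y in std n. (\<Sum>u\<in>U. w u y) = 1" using w1 by (intro AE_I2) auto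
  have wb: "AE y in std n. 0 \<le> w u y \<and> w u y \<le> 1" if "u \<in> U" for u
    by (rule AE_weight_bounds[OF U(1) _ w1' that]) (simp add: w0)
  have iw: "integrable (std n) (\<lambda>y. w u y * g y)" if "u \<in> U" "integrable (std n) g" for u and g :: "_ \<Rightarrow> real"
    using that by (intro integrable_weight_mult wm wb)
  have iw1: "integrable (std n) (w u)" if u: "u \<in> U" for u
  proof -
    interpret prob_space "std n" by simp
    show ?thesis using iw[OF u, of "\<lambda>_. 1"] by simp
  qed
  have r0: "0 \<le> r u" for u unfolding r_def by (intro integral_nonneg_AE) (simp add: w0)
  have dU: "prob_space (d u)" "sets (d u) = sets (Rn n)" if "u \<in> U" for u
    using code_decoder[OF V g] that by (auto simp: d_def U_def)
  have code: "(\<integral>\<^sup>+z. f z \<partial>M) = (\<Sum>u\<in>U. \<integral>\<^sup>+y. ennreal (w u y) * (\<integral>\<^sup>+z. f (a y, z) \<partial>d u) \<partial>std n)"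
    if "f \<in> borel_measurable (Rn n \<Otimes>\<^sub>M Rn n)" for f
    unfolding M_def nn_integral_code_joint_std[OF \<sigma> V that] U_def
    by (simp add: sum.cartesian_product split_beta' w_def v_def d_def a_def)
  have mix: "emeasure Q B = (\<Sum>u\<in>U. ennreal (r u) * emeasure (d u) B)" if B: "B \<in> sets Q" for B
  proof -
    have B': "B \<in> sets (Rn n)" using B sQ by simp
    have "emeasure Q B = emeasure (distr M (Rn n) snd) B" using mq by (simp add: Q_def M_def)
    also have "\<dots> = (\<integral>\<^sup>+x. indicator B x \<partial>distr M (Rn n) snd)" using B' by simp
    also have "\<dots> = (\<integral>\<^sup>+z. indicator B (snd z) \<partial>M)"
      using B' by (intro nn_integral_distr) auto
    also have "\<dots> = (\<Sum>u\<in>U. \<integral>\<^sup>+y. ennreal (w u y) * (\<integral>\<^sup>+z. indicator B z \<partial>d u) \<partial>std n)"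
      using B' by (subst code) auto
    also have "\<dots> = (\<Sum>u\<in>U. ennreal (r u) * emeasure (d u) B)"
    proof (intro sum.cong refl)
      fix u assume u: "u \<in> U"
      have "(\<integral>\<^sup>+y. ennreal (w u y) * (\<integral>\<^sup>+z. indicator B z \<partial>d u) \<partial>std n) = (\<integral>\<^sup>+y. ennreal (w u y) \<partial>std n) * emeasure (d u) B"
        using B' dU[OF u] wm[OF u] by (simp add: nn_integral_multc)
      also have "(\<integral>\<^sup>+y. ennreal (w u y) \<partial>std n) = ennreal (r u)"
        unfolding r_def by (intro nn_integral_eq_integral iw1 u) (simp add: w0)
      finally show "(\<integral>\<^sup>+y. ennreal (w u y) * (\<integral>\<^sup>+z. indicator B z \<partial>d u) \<partial>std n) = ennreal (r u) * emeasure (d u) B" .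
    qed
    finally show ?thesis .
  qed
  have dQ: "sets (d u) = sets Q" if "u \<in> U" for u using dU(2)[OF that] sQ by simp
  \<comment> \<open>The same cells seen from the output: the posterior probabilities of seed and
    message, with the same masses \<open>r u\<close>.\<close>
  obtain w' where w'm: "\<And>u. u \<in> U \<Longrightarrow> w' u \<in> borel_measurable Q" and w'0: "\<And>u x. u \<in> U \<Longrightarrow> 0 \<le> w' u x"
    and w'1: "AE x in Q. (\<Sum>u\<in>U. w' u x) = 1"
    and w'i: "\<And>u g. u \<in> U \<Longrightarrow> integrable Q g \<Longrightarrow> (\<integral>x. w' u x * g x \<partial>Q) = r u * (\<integral>x. g x \<partial>d u) \<and> (0 < r u \<longrightarrow> integrable (d u) (g :: (nat \<Rightarrow> real) \<Rightarrow> real))"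
    by (rule mixture_weights[OF Q.prob_space_axioms U(1) dU(1) dQ r0 mix]; (assumption | blast intro: that))
  have w'0': "AE x in Q. 0 \<le> w' u x" if "u \<in> U" for u using w'0[OF that] by simp
  define m' where "m' u t = (\<integral>x. w' u x * (x t - \<mu>) \<partial>Q)" for u t
  have qm: "(\<lambda>x. (x - \<mu>)\<^sup>2) \<in> borel_measurable q" using q2 by auto
  have i2: "integrable Q (\<lambda>x. (x t - \<mu>)\<^sup>2)" "(\<integral>x. (x t - \<mu>)\<^sup>2 \<partial>Q) = s\<^sup>2" if "t < n" for t
    unfolding Q_def using integral_PiM_component[OF q(1), of t "{..<n}" "\<lambda>x. (x - \<mu>)\<^sup>2"] that q2 s2 qm by auto
  have i1: "integrable Q (\<lambda>x. x t - \<mu>)" if t: "t < n" for t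
  proof -
    have "(\<lambda>x. x t - \<mu>) \<in> borel_measurable Q"
      unfolding measurable_cong_sets[OF sQ refl] using ct[OF t] by (intro borel_measurable_diff) auto
    then show ?thesis using i2(1)[OF t] by (rule Q.square_integrable_imp_integrable)
  qed
  have r': "(\<integral>x. w' u x \<partial>Q) = r u" if u: "u \<in> U" for u
    using w'i[OF u, of "\<lambda>_. 1"] prob_space.prob_space[OF dU(1)[OF u]] by simp
  have y1: "integrable (std n) (\<lambda>y. y t)" "integrable (std n) (\<lambda>y. (y t)\<^sup>2)" "(\<integral>y. (y t)\<^sup>2 \<partial>std n) = 1" if "t < n" for t
    using that by (auto intro: std_component_moments)

  have cell: "ennreal (\<sigma>\<^sup>2 * (\<integral>y. w u y * (y t)\<^sup>2 \<partial>std n) - 2 * \<sigma> * (m u t * m' u t / r u) + (\<integral>x. w' u x * (x t - \<mu>)\<^sup>2 \<partial>Q))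
     \<le> (\<integral>\<^sup>+y. ennreal (w u y) * (\<integral>\<^sup>+z. ennreal ((a y t - z t)\<^sup>2) \<partial>d u) \<partial>std n)" if u: "u \<in> U" and t: "t < n" for u t
  proof (cases "r u = 0")
    \<comment> \<open>A cell of probability 0 gives no control over its decoder law, whose moments
      may be infinite. But all its weights vanish, so the left side is 0.\<close>
    case True
    then have "AE y in std n. w u y = 0"
      using integral_nonneg_eq_0_iff_AE[OF iw1[OF u]] w0 by (simp add: r_def)
    then have "(\<integral>y. w u y * (y t)\<^sup>2 \<partial>std n) = (\<integral>y. 0 \<partial>std n)"
      using wm[OF u] y1(2)[OF t] by (intro integral_cong_AE) auto
    then show ?thesis using True w'i[OF u i2(1)[OF t]] by simp
  next
    case False
    then have rp: "0 < r u" using r0[of u] by simp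
    have b1: "(\<integral>x. w' u x * (x t - \<mu>)\<^sup>2 \<partial>Q) = r u * (\<integral>x. (x t - \<mu>)\<^sup>2 \<partial>d u)" "integrable (d u) (\<lambda>x. (x t - \<mu>)\<^sup>2)"
      using w'i[OF u i2(1)[OF t]] rp by auto
    have b2: "m' u t = r u * (\<integral>x. x t - \<mu> \<partial>d u)" "integrable (d u) (\<lambda>x. x t - \<mu>)"
      using w'i[OF u i1[OF t]] rp by (auto simp: m'_def)
    have e: "w u y * (\<sigma> * y t)\<^sup>2 = \<sigma>\<^sup>2 * (w u y * (y t)\<^sup>2)" "w u y * (\<sigma> * y t) = \<sigma> * (w u y * y t)" for y
      by (simp_all add: power_mult_distrib)
    have at: "a y t - z t = \<sigma> * y t - (z t - \<mu>)" for y z using t by (simp add: a_def)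
    have "(\<integral>\<^sup>+y. ennreal (w u y) * (\<integral>\<^sup>+z. ennreal ((a y t - z t)\<^sup>2) \<partial>d u) \<partial>std n)
      = ennreal ((\<integral>y. w u y * (\<sigma> * y t)\<^sup>2 \<partial>std n) - 2 * (\<integral>y. w u y * (\<sigma> * y t) \<partial>std n) * (\<integral>x. x t - \<mu> \<partial>d u)
         + (\<integral>y. w u y \<partial>std n) * (\<integral>x. (x t - \<mu>)\<^sup>2 \<partial>d u))"
      unfolding at using w0 u t y1 by (intro nn_integral_pair_square(1) iw1 b1 b2 dU) (auto simp: e intro!: iw)
    also have "(\<integral>y. w u y * (\<sigma> * y t)\<^sup>2 \<partial>std n) - 2 * (\<integral>y. w u y * (\<sigma> * y t) \<partial>std n) * (\<integral>x. x t - \<mu> \<partial>d u)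
         + (\<integral>y. w u y \<partial>std n) * (\<integral>x. (x t - \<mu>)\<^sup>2 \<partial>d u) =
       \<sigma>\<^sup>2 * (\<integral>y. w u y * (y t)\<^sup>2 \<partial>std n) - 2 * \<sigma> * (m u t * m' u t / r u) + (\<integral>x. w' u x * (x t - \<mu>)\<^sup>2 \<partial>Q)"
      unfolding e b1(1) b2(1) r_def[symmetric] using rp by (simp add: m_def)
    finally show ?thesis by simp
  qed

  define K1 where "K1 = (\<Sum>u\<in>U. \<Sum>t<n. (m u t)\<^sup>2 / r u)"
  define K2 where "K2 = (\<Sum>u\<in>U. \<Sum>t<n. (m' u t)\<^sup>2 / r u)"
  define T where "T = (\<Sum>u\<in>U. \<Sum>t<n. m u t * m' u t / r u)"
  have K10: "0 \<le> K1" "0 \<le> K2" unfolding K1_def K2_def by (auto intro!: sum_nonneg simp: r0)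
  have K1: "K1 \<le> real n * (1 - exp (-2 * R))"
  proof -
    have "K1 = (\<Sum>k<NK. \<Sum>j<NJ. \<Sum>t<n. (\<integral>y. v k j y / real NK * y t \<partial>std n)\<^sup>2 / (\<integral>y. v k j y / real NK \<partial>std n))"
      unfolding K1_def U_def m_def r_def w_def sum_Times by simp
    also have "\<dots> \<le> real n * (1 - exp (-2 * R))"
      using vm v0 v1 by (intro encoder_energy[OF n NJ NK RJ]) auto
    finally show ?thesis .
  qed
  have TK: "T \<le> sqrt K1 * sqrt K2"
  proof -
    have "T = (\<Sum>i\<in>U \<times> {..<n}. m (fst i) (snd i) * m' (fst i) (snd i) / r (fst i))"
      unfolding T_def sum_Times by simp
    also have "\<dots> \<le> sqrt (\<Sum>i\<in>U \<times> {..<n}. (m (fst i) (snd i))\<^sup>2 / r (fst i)) * sqrt (\<Sum>i\<in>U \<times> {..<n}. (m' (fst i) (snd i))\<^sup>2 / r (fst i))"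
      by (rule sum_quotient_le_sqrt) (rule r0)
    also have "\<dots> = sqrt K1 * sqrt K2"
      unfolding K1_def K2_def sum_Times by simp
    finally show ?thesis .
  qed
  have w'b: "AE x in Q. 0 \<le> w' u x \<and> w' u x \<le> 1" if "u \<in> U" for u
    by (rule AE_weight_bounds[OF U(1) w'0' w'1 that])
  have iw': "integrable Q (\<lambda>x. w' u x * g x)" if "u \<in> U" "integrable Q g" for u and g :: "_ \<Rightarrow> real"
    using that by (intro integrable_weight_mult w'm w'b)
  have iw'1: "integrable Q (w' u)" if u: "u \<in> U" for u using iw'[OF u, of "\<lambda>_. 1"] by simp
  have sum2: "(\<Sum>u\<in>U. \<Sum>t<n. \<integral>x. w' u x * (x t - \<mu>)\<^sup>2 \<partial>Q) = real n * s\<^sup>2"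
  proof -
    have "(\<Sum>u\<in>U. \<Sum>t<n. \<integral>x. w' u x * (x t - \<mu>)\<^sup>2 \<partial>Q) = (\<Sum>t<n. \<Sum>u\<in>U. \<integral>x. w' u x * (x t - \<mu>)\<^sup>2 \<partial>Q)"
      by (rule sum.swap)
    also have "\<dots> = (\<Sum>t<n. s\<^sup>2)"
    proof (intro sum.cong refl)
      fix t assume "t \<in> {..<n}"
      then show "(\<Sum>u\<in>U. \<integral>x. w' u x * (x t - \<mu>)\<^sup>2 \<partial>Q) = s\<^sup>2"
        using sum_integral_weights[OF U(1) w'm w'0' w'1 i2(1)] i2(2) by auto
    qed
    finally show ?thesis by simp
  qed
  have sum1: "(\<Sum>u\<in>U. \<Sum>t<n. \<integral>y. w u y * (y t)\<^sup>2 \<partial>std n) = real n"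
    by (rule sum_weighted_second_moments[OF U(1) wm _ w1']) (simp_all add: w0)
  define c where "c = pos (\<sigma> * exp (-(R+Rc)) - sqrt P)"
  have K2: "K2 \<le> real n * s\<^sup>2 - real n * c\<^sup>2"
  proof -
    \<comment> \<open>The energy around the centroids is what the quantizer of the output with
      \<open>NK * NJ\<close> cells leaves over. The coupling bounds it from below, and thereby
      \<open>K2\<close> from above.\<close>
    have resid: "(\<Sum>u\<in>U. \<Sum>t<n. \<integral>x. w' u x * (x t - (\<mu> + m' u t / r u))\<^sup>2 \<partial>Q) = real n * s\<^sup>2 - K2"
    proof -
      have "(\<Sum>u\<in>U. \<Sum>t<n. \<integral>x. w' u x * (x t - (\<mu> + m' u t / r u))\<^sup>2 \<partial>Q)
        = (\<Sum>u\<in>U. \<Sum>t<n. (\<integral>x. w' u x * (x t - \<mu>)\<^sup>2 \<partial>Q) - (m' u t)\<^sup>2 / r u)"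
      proof (intro sum.cong refl)
        fix u t assume u: "u \<in> U" and t: "t \<in> {..<n}"
        have "(\<integral>x. w' u x * (x t - \<mu> - m' u t / r u)\<^sup>2 \<partial>Q) = (\<integral>x. w' u x * (x t - \<mu>)\<^sup>2 \<partial>Q) - (m' u t)\<^sup>2 / r u"
          unfolding r'[OF u, symmetric] m'_def using u t
          by (intro weighted_variance iw'1 iw' i1 i2) auto
        then show "(\<integral>x. w' u x * (x t - (\<mu> + m' u t / r u))\<^sup>2 \<partial>Q) = (\<integral>x. w' u x * (x t - \<mu>)\<^sup>2 \<partial>Q) - (m' u t)\<^sup>2 / r u"
          by (simp add: diff_diff_eq)
      qed
      then show ?thesis by (simp add: sum_subtractf sum2 K2_def)
    qed
    have resid0: "0 \<le> real n * s\<^sup>2 - K2"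
      unfolding resid[symmetric] by (intro sum_nonneg integral_nonneg_AE) (simp add: w'0)
    have up: "\<sigma> * exp (-(R+Rc)) - sqrt P' \<le> sqrt (s\<^sup>2 - K2 / real n)" if P': "P < P'" for P'
    proof -
      obtain \<pi> where pi: "prob_space \<pi>" "sets \<pi> = sets (borel \<Otimes>\<^sub>M borel)" "distr \<pi> borel fst = gauss \<mu> \<sigma>" "distr \<pi> borel snd = q"
        "(\<integral>\<^sup>+z. ennreal ((fst z - snd z)\<^sup>2) \<partial>\<pi>) \<le> ennreal P'" using coupling[OF P'] by auto
      have P'0: "0 < P'" using P P' by simp
      have w'mR: "w' u \<in> borel_measurable (Rn n)" if "u \<in> U" for u
        using w'm[OF that] measurable_cong_sets[OF sQ refl] by blast
      have "sqrt (real n) * (\<sigma> * real (card U) powr (- 1 / real n)) \<le>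
        sqrt (\<Sum>u\<in>U. \<Sum>t<n. \<integral>x. w' u x * (x t - (\<mu> + m' u t / r u))\<^sup>2 \<partial>Q) + sqrt (real n * P')"
        unfolding Q_def
        by (rule coupled_reconstruction_bound[OF \<sigma> P'0 pi q2 U n w'mR w'0'[unfolded Q_def] w'1[unfolded Q_def]])
      also have "sqrt (\<Sum>u\<in>U. \<Sum>t<n. \<integral>x. w' u x * (x t - (\<mu> + m' u t / r u))\<^sup>2 \<partial>Q) = sqrt (real n) * sqrt (s\<^sup>2 - K2 / real n)"
        unfolding resid real_sqrt_mult[symmetric] using n by (simp add: right_diff_distrib)
      also have "\<dots> + sqrt (real n * P') = sqrt (real n) * (sqrt (s\<^sup>2 - K2 / real n) + sqrt P')"
        by (simp add: real_sqrt_mult distrib_left)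
      finally have "\<sigma> * real (card U) powr (- 1 / real n) \<le> sqrt (s\<^sup>2 - K2 / real n) + sqrt P'"
        using n by simp
      moreover have "exp (-(R+Rc)) \<le> real (card U) powr (- 1 / real n)"
      proof -
        \<comment> \<open>Message and seed together index the cells of the output, so the two rates
          add up here.\<close>
        have "ln (real (card U)) = ln (real NK) + ln (real NJ)"
          using NJ NK by (simp add: U_def ln_mult)
        then have "ln (real (card U)) / real n \<le> R + Rc" using RJ RK by (simp add: add_divide_distrib)
        then show ?thesis using U by (simp add: powr_def)
      qed
      ultimately show ?thesis using mult_left_mono[of "exp (-(R+Rc))" "real (card U) powr (- 1 / real n)" \<sigma>] \<sigma> by linarith
    qed
    have "isCont (\<lambda>P. \<sigma> * exp (-(R+Rc)) - sqrt P) P" by (intro continuous_intros isCont_real_sqrt)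
    from limP[OF this up] have "\<sigma> * exp (-(R+Rc)) - sqrt P \<le> sqrt (s\<^sup>2 - K2 / real n)" .
    moreover have "0 \<le> s\<^sup>2 - K2 / real n" using resid0 n by (simp add: field_simps)
    ultimately have "c \<le> sqrt (s\<^sup>2 - K2 / real n)" by (simp add: c_def pos_def)
    then have "c\<^sup>2 \<le> (sqrt (s\<^sup>2 - K2 / real n))\<^sup>2" by (intro power_mono) (auto simp: c_def pos_def)
    also have "\<dots> = s\<^sup>2 - K2 / real n" using \<open>0 \<le> s\<^sup>2 - K2 / real n\<close> by simp
    finally have "real n * c\<^sup>2 \<le> real n * (s\<^sup>2 - K2 / real n)" by (intro mult_left_mono) auto
    then show ?thesis using n by (simp add: right_diff_distrib)
  qed
  have Tn: "T \<le> real n * sqrt ((1 - exp (-2*R)) * (s\<^sup>2 - c\<^sup>2))"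
  proof -
    have "T \<le> sqrt (real n * (1 - exp (-2 * R))) * sqrt (real n * s\<^sup>2 - real n * c\<^sup>2)"
      using K10 K1 K2 by (intro order_trans[OF TK] mult_mono real_sqrt_le_mono) auto
    also have "\<dots> = real n * sqrt ((1 - exp (-2*R)) * (s\<^sup>2 - c\<^sup>2))"
      unfolding right_diff_distrib[symmetric] by (simp add: real_sqrt_mult)
    finally show ?thesis .
  qed
  have "ennreal (\<sigma>\<^sup>2 * real n - 2 * \<sigma> * T + real n * s\<^sup>2) \<le> ennreal (real n * D)"
  proof -
    define b where "b u t = \<sigma>\<^sup>2 * (\<integral>y. w u y * (y t)\<^sup>2 \<partial>std n) - 2 * \<sigma> * (m u t * m' u t / r u) + (\<integral>x. w' u x * (x t - \<mu>)\<^sup>2 \<partial>Q)" for u t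
    have "\<sigma>\<^sup>2 * real n - 2 * \<sigma> * T + real n * s\<^sup>2 = (\<Sum>u\<in>U. \<Sum>t<n. b u t)"
      unfolding b_def sum.distrib sum_subtractf sum_distrib_left[symmetric] sum1 sum2 T_def by simp
    also have "\<dots> = (\<Sum>t<n. \<Sum>u\<in>U. b u t)" by (rule sum.swap)
    \<comment> \<open>Sums commute with \<open>ennreal\<close> only for nonnegative terms.
      Truncation at 0 loses nothing, because \<open>cell\<close> bounds
      \<open>ennreal (b u t)\<close>, which is truncated anyway.\<close>
    also have "ennreal \<dots> \<le> ennreal (\<Sum>t<n. \<Sum>u\<in>U. max 0 (b u t))"
      by (intro ennreal_leI sum_mono) simp
    also have "\<dots> = (\<Sum>t<n. \<Sum>u\<in>U. ennreal (max 0 (b u t)))"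
      by (subst sum_ennreal[symmetric], simp add: sum_nonneg, intro sum.cong refl, subst sum_ennreal) auto
    also have "\<dots> \<le> (\<Sum>t<n. \<integral>\<^sup>+ z. ennreal ((fst z t - snd z t)\<^sup>2) \<partial>M)"
    proof (intro sum_mono)
      fix t assume t: "t \<in> {..<n}"
      have "(\<Sum>u\<in>U. ennreal (max 0 (b u t))) \<le> (\<Sum>u\<in>U. \<integral>\<^sup>+y. ennreal (w u y) * (\<integral>\<^sup>+z. ennreal ((a y t - z t)\<^sup>2) \<partial>d u) \<partial>std n)"
        using cell t by (intro sum_mono) (auto simp: b_def max_def ennreal_neg)
      also have "\<dots> = (\<integral>\<^sup>+ z. ennreal ((fst z t - snd z t)\<^sup>2) \<partial>M)"
        using t by (subst code) (auto intro!: measurable_compose[OF _ measurable_ennreal])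
      finally show "(\<Sum>u\<in>U. ennreal (max 0 (b u t))) \<le> (\<integral>\<^sup>+ z. ennreal ((fst z t - snd z t)\<^sup>2) \<partial>M)" .
    qed
    also have "\<dots> = ennreal (real n) * (ennreal (1 / real n) * (\<Sum>t<n. \<integral>\<^sup>+ z. ennreal ((fst z t - snd z t)\<^sup>2) \<partial>M))"
    proof -
      have "ennreal (real n) * ennreal (1 / real n) = 1" using n by (simp add: ennreal_mult[symmetric])
      then show ?thesis by (simp add: mult.assoc[symmetric])
    qed
    also have "\<dots> \<le> ennreal (real n) * ennreal D" using dist unfolding M_def by (intro mult_left_mono) auto
    also have "\<dots> = ennreal (real n * D)" using D0 by (simp add: ennreal_mult)
    finally show ?thesis .
  qed
  then have "\<sigma>\<^sup>2 * real n - 2 * \<sigma> * T + real n * s\<^sup>2 \<le> real n * D"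
    using D0 by (subst (asm) ennreal_le_iff) auto
  moreover have "2 * \<sigma> * T \<le> 2 * \<sigma> * (real n * sqrt ((1 - exp (-2*R)) * (s\<^sup>2 - c\<^sup>2)))"
    using Tn \<sigma> by (intro mult_left_mono) auto
  ultimately have "real n * (\<sigma>\<^sup>2 + s\<^sup>2 - 2 * \<sigma> * sqrt ((1 - exp (-2*R)) * (s\<^sup>2 - c\<^sup>2))) \<le> real n * D"
    by (simp add: algebra_simps)
  then have "\<sigma>\<^sup>2 + s\<^sup>2 - 2 * \<sigma> * sqrt ((1 - exp (-2*R)) * (s\<^sup>2 - c\<^sup>2)) \<le> D" using n by simp
  then show ?thesis using D_lower_le[OF \<sigma> R Rc spos P] by (simp add: c_def)
qed

section \<open>Balanced random quantizers\<close>

lemma balanced_completion: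
  fixes \<omega>0 c :: "'i \<Rightarrow> 'a \<Rightarrow> real" and A :: "'a \<Rightarrow> real" and B :: "'i \<Rightarrow> real"
  assumes Q: "prob_space Q" and I: "finite I" "I \<noteq> {}"
    and m: "\<And>i. i \<in> I \<Longrightarrow> \<omega>0 i \<in> borel_measurable Q" and nn: "\<And>i x. 0 \<le> \<omega>0 i x"
    and le1: "\<And>x. (\<Sum>i\<in>I. \<omega>0 i x) \<le> 1" and leM: "\<And>i. i \<in> I \<Longrightarrow> (\<integral>x. \<omega>0 i x \<partial>Q) \<le> 1 / real (card I)"
    and c: "\<And>i. i \<in> I \<Longrightarrow> c i \<in> borel_measurable Q" "\<And>i x. 0 \<le> c i x" "\<And>i x. c i x \<le> A x + B i"
    and A: "integrable Q A" "\<And>x. 0 \<le> A x"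
    and \<kappa>: "0 \<le> \<kappa>" "\<And>i x. i \<in> I \<Longrightarrow> 0 < \<omega>0 i x \<Longrightarrow> c i x \<le> \<kappa>"
  shows "\<exists>\<omega>. (\<forall>i\<in>I. \<omega> i \<in> borel_measurable Q \<and> (\<forall>x. 0 \<le> \<omega> i x) \<and> (\<integral>x. \<omega> i x \<partial>Q) = 1 / real (card I))
    \<and> (\<forall>x. (\<Sum>i\<in>I. \<omega> i x) = 1)
    \<and> (\<Sum>i\<in>I. \<integral>x. \<omega> i x * c i x \<partial>Q) \<le> \<kappa> + (\<integral>x. (1 - (\<Sum>i\<in>I. \<omega>0 i x)) * A x \<partial>Q)
        + (\<Sum>i\<in>I. (1 / real (card I) - (\<integral>x. \<omega>0 i x \<partial>Q)) * B i)"
proof -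
  interpret prob_space Q by fact
  define M where "M = real (card I)"
  have M: "0 < M" using I by (simp add: M_def card_gt_0_iff)
  define g where "g x = 1 - (\<Sum>i\<in>I. \<omega>0 i x)" for x
  have g: "0 \<le> g x" "g x \<le> 1" for x using le1[of x] nn by (auto simp: g_def sum_nonneg)
  have gm: "g \<in> borel_measurable Q" unfolding g_def using m by auto
  have le1i: "\<omega>0 i x \<le> 1" if "i \<in> I" for i x
    using member_le_sum[of i I "\<lambda>i. \<omega>0 i x"] I nn le1[of x] that by auto
  have ib: "integrable Q (\<lambda>x. f x * h x)" if "f \<in> borel_measurable Q" "\<And>x. 0 \<le> f x" "\<And>x. f x \<le> 1" "integrable Q h" for f h :: "'a \<Rightarrow> real"
    by (rule integrable_weight_mult) (use that in auto)
  have i0: "integrable Q (\<omega>0 i)" if "i \<in> I" for i using ib[OF m[OF that] nn le1i[OF that], of "\<lambda>_. 1"] by simp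
  have ig: "integrable Q g" using ib[OF gm g, of "\<lambda>_. 1"] by simp
  have ic: "integrable Q (c i)" if "i \<in> I" for i
  proof (rule Bochner_Integration.integrable_bound)
    show "integrable Q (\<lambda>x. A x + B i)" using A by simp
    show "AE x in Q. norm (c i x) \<le> norm (A x + B i)"
      using c(2,3) by (intro AE_I2) (auto intro: order_trans[OF _ abs_ge_self])
  qed (rule c(1)[OF that])
  define e where "e = (\<integral>x. g x \<partial>Q)"
  have e: "e = 1 - (\<Sum>i\<in>I. \<integral>x. \<omega>0 i x \<partial>Q)"
    unfolding e_def g_def using i0 by (simp add: prob_space)
  \<comment> \<open>If the total deficit \<open>e\<close> is 0 the proportions are arbitrary, and
    \<open>1 / M\<close> keeps their sum equal to 1.\<close>
  define l where "l i = (if e = 0 then 1 / M else (1 / M - (\<integral>x. \<omega>0 i x \<partial>Q)) / e)" for i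
  have e0: "0 \<le> e" unfolding e_def using g by (intro integral_nonneg_AE) auto
  have l0: "0 \<le> l i" if "i \<in> I" for i using leM[OF that] e0 M by (auto simp: l_def M_def)
  have sM: "(\<Sum>i\<in>I. 1 / M) = 1" using M by (simp add: M_def)
  have l1: "(\<Sum>i\<in>I. l i) = 1"
  proof (cases "e = 0")
    case False
    have "(\<Sum>i\<in>I. l i) = (\<Sum>i\<in>I. 1 / M - (\<integral>x. \<omega>0 i x \<partial>Q)) / e"
      using False by (simp add: l_def sum_divide_distrib)
    also have "(\<Sum>i\<in>I. 1 / M - (\<integral>x. \<omega>0 i x \<partial>Q)) = e" unfolding sum_subtractf sM e ..
    finally show ?thesis using False by simp
  qed (simp add: l_def sM del: sum_constant)
  have el: "e * l i = 1 / M - (\<integral>x. \<omega>0 i x \<partial>Q)" if i: "i \<in> I" for i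
  proof (cases "e = 0")
    \<comment> \<open>No deficit is negative, so a total of 0 forces each of them to vanish.\<close>
    case True
    have "(\<Sum>i\<in>I. 1 / M - (\<integral>x. \<omega>0 i x \<partial>Q)) = 0" unfolding sum_subtractf sM using e True by simp
    moreover have "\<forall>i\<in>I. 0 \<le> 1 / M - (\<integral>x. \<omega>0 i x \<partial>Q)" using leM by (simp add: M_def)
    ultimately have "1 / M - (\<integral>x. \<omega>0 i x \<partial>Q) = 0" using i I by (simp add: sum_nonneg_eq_0_iff)
    then show ?thesis using True by simp
  qed (simp add: l_def)
  define \<omega> where "\<omega> i x = \<omega>0 i x + g x * l i" for i x
  have c0: "(\<integral>x. \<omega>0 i x * c i x \<partial>Q) \<le> \<kappa> * (\<integral>x. \<omega>0 i x \<partial>Q)" if i: "i \<in> I" for i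
  proof -
    have "(\<integral>x. \<omega>0 i x * c i x \<partial>Q) \<le> (\<integral>x. \<omega>0 i x * \<kappa> \<partial>Q)"
    proof (rule integral_mono)
      show "integrable Q (\<lambda>x. \<omega>0 i x * c i x)" by (rule ib[OF m[OF i] nn le1i[OF i] ic[OF i]])
      show "integrable Q (\<lambda>x. \<omega>0 i x * \<kappa>)" using i0[OF i] by simp
      fix x show "\<omega>0 i x * c i x \<le> \<omega>0 i x * \<kappa>"
        using nn[of i x] \<kappa>(2)[OF i, of x] by (cases "\<omega>0 i x = 0") auto
    qed
    then show ?thesis by (simp add: mult.commute)
  qed
  have c1: "(\<integral>x. g x * l i * c i x \<partial>Q) \<le> l i * (\<integral>x. g x * A x \<partial>Q) + (1 / M - (\<integral>x. \<omega>0 i x \<partial>Q)) * B i" if i: "i \<in> I" for i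
  proof -
    have "(\<integral>x. g x * l i * c i x \<partial>Q) \<le> (\<integral>x. l i * (g x * A x) + l i * B i * g x \<partial>Q)"
    proof (rule integral_mono)
      show "integrable Q (\<lambda>x. g x * l i * c i x)" using integrable_mult_right[OF ib[OF gm g ic[OF i]], of "l i"] by (simp only: mult_ac)
      show "integrable Q (\<lambda>x. l i * (g x * A x) + l i * B i * g x)" using ib[OF gm g A(1)] ig by simp
      fix x
      have "g x * l i * c i x \<le> g x * l i * (A x + B i)" using g l0[OF i] c(3) by (intro mult_left_mono) auto
      then show "g x * l i * c i x \<le> l i * (g x * A x) + l i * B i * g x" by (simp add: algebra_simps)
    qed
    also have "\<dots> = l i * (\<integral>x. g x * A x \<partial>Q) + e * l i * B i"
      using ib[OF gm g A(1)] ig by (simp add: e_def)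
    finally show ?thesis using el[OF i] by simp
  qed
  have "(\<Sum>i\<in>I. \<integral>x. \<omega> i x * c i x \<partial>Q) = (\<Sum>i\<in>I. (\<integral>x. \<omega>0 i x * c i x \<partial>Q) + (\<integral>x. g x * l i * c i x \<partial>Q))"
  proof (intro sum.cong refl)
    fix i assume i: "i \<in> I"
    have 1: "integrable Q (\<lambda>x. \<omega>0 i x * c i x)" by (rule ib[OF m[OF i] nn le1i[OF i] ic[OF i]])
    have 2: "integrable Q (\<lambda>x. g x * l i * c i x)" using integrable_mult_right[OF ib[OF gm g ic[OF i]], of "l i"] by (simp only: mult_ac)
    show "(\<integral>x. \<omega> i x * c i x \<partial>Q) = (\<integral>x. \<omega>0 i x * c i x \<partial>Q) + (\<integral>x. g x * l i * c i x \<partial>Q)"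
      using Bochner_Integration.integral_add[OF 1 2] by (simp add: \<omega>_def distrib_right)
  qed
  also have "\<dots> \<le> (\<Sum>i\<in>I. \<kappa> * (\<integral>x. \<omega>0 i x \<partial>Q) + (l i * (\<integral>x. g x * A x \<partial>Q) + (1 / M - (\<integral>x. \<omega>0 i x \<partial>Q)) * B i))"
    by (intro sum_mono add_mono c0 c1)
  also have "\<dots> = \<kappa> * (1 - e) + (\<integral>x. g x * A x \<partial>Q) + (\<Sum>i\<in>I. (1 / M - (\<integral>x. \<omega>0 i x \<partial>Q)) * B i)"
    unfolding sum.distrib sum_distrib_left[symmetric] sum_distrib_right[symmetric] l1 using e by simp
  also have "\<kappa> * (1 - e) \<le> \<kappa>" using \<kappa> e0 by (simp add: mult_left_le)
  finally have cost: "(\<Sum>i\<in>I. \<integral>x. \<omega> i x * c i x \<partial>Q) \<le> \<kappa> + (\<integral>x. (1 - (\<Sum>i\<in>I. \<omega>0 i x)) * A x \<partial>Q)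
        + (\<Sum>i\<in>I. (1 / real (card I) - (\<integral>x. \<omega>0 i x \<partial>Q)) * B i)"
    by (simp add: g_def M_def)
  have "(\<integral>x. \<omega> i x \<partial>Q) = 1 / M" if i: "i \<in> I" for i
    unfolding \<omega>_def using i0[OF i] ig el[OF i] by (simp add: e_def)
  moreover have "\<omega> i \<in> borel_measurable Q" if "i \<in> I" for i
    unfolding \<omega>_def using m[OF that] gm by auto
  moreover have "0 \<le> \<omega> i x" if "i \<in> I" for i x
    unfolding \<omega>_def using nn g l0[OF that] by (simp add: add_nonneg_nonneg)
  moreover have "(\<Sum>i\<in>I. \<omega> i x) = 1" for x
    unfolding \<omega>_def sum.distrib sum_distrib_left[symmetric] l1 by (simp add: g_def)
  ultimately show ?thesis using cost by (intro exI[of _ \<omega>]) (auto simp: M_def)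
qed

text \<open>The density of \<open>N(a v, (1 - a^2) I)\<close> relative to \<open>N(0, I)\<close>.\<close>

definition lr :: "real \<Rightarrow> nat \<Rightarrow> (nat \<Rightarrow> real) \<Rightarrow> (nat \<Rightarrow> real) \<Rightarrow> real" where
  "lr a n x v = (1 / sqrt (1 - a\<^sup>2)) ^ n * exp (sqn n x / 2 - sqd n x (\<lambda>t. a * v t) / (2 * (1 - a\<^sup>2)))"

text \<open>\<open>lr\<close> is the density of a pair of standard normal vectors with correlation
  \<open>a\<close> in each letter, relative to the product of the two laws, and the members of such
  a pair are exchangeable. Thus integrals over the codeword reduce to integrals over the
  source.\<close>

lemma lr_commute:
  assumes a: "a\<^sup>2 < 1"
  shows "lr a n x v = lr a n v x"
proof -
  have e: "sqn n x / 2 - sqd n x (\<lambda>t. a * v t) / (2 * (1 - a\<^sup>2)) =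
     (\<Sum>t<n. (2 * a * x t * v t - a\<^sup>2 * ((x t)\<^sup>2 + (v t)\<^sup>2)) / (2 * (1 - a\<^sup>2)))" for x v
    unfolding sqn_def sqd_def sum_divide_distrib sum_subtractf[symmetric]
  proof (intro sum.cong refl)
    fix t
    define c where "c = 1 - a\<^sup>2"
    have "(x t)\<^sup>2 / 2 - (x t - a * v t)\<^sup>2 / (2 * c) = (c * (x t)\<^sup>2 - (x t - a * v t)\<^sup>2) / (2 * c)"
      using a by (simp add: diff_divide_distrib c_def[symmetric]) (simp add: c_def)
    also have "c * (x t)\<^sup>2 - (x t - a * v t)\<^sup>2 = 2 * a * x t * v t - a\<^sup>2 * ((x t)\<^sup>2 + (v t)\<^sup>2)"
      by (simp add: c_def power2_diff power_mult_distrib algebra_simps)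
    finally show "(x t)\<^sup>2 / 2 - (x t - a * v t)\<^sup>2 / (2 * (1 - a\<^sup>2)) = (2 * a * x t * v t - a\<^sup>2 * ((x t)\<^sup>2 + (v t)\<^sup>2)) / (2 * (1 - a\<^sup>2))"
      by (simp add: c_def)
  qed
  show ?thesis unfolding lr_def e by (simp add: add.commute mult_ac)
qed

lemma lr_nonneg: "a\<^sup>2 < 1 \<Longrightarrow> 0 \<le> lr a n x v" by (simp add: lr_def)

lemma measurable_lr[measurable]:
  assumes f: "f \<in> M \<rightarrow>\<^sub>M Rn n" and g: "g \<in> M \<rightarrow>\<^sub>M Rn n"
  shows "(\<lambda>z. sqd n (f z) (\<lambda>t. a * g z t)) \<in> borel_measurable M" "(\<lambda>z. lr a n (f z) (g z)) \<in> borel_measurable M"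
proof -
  have [measurable]: "(\<lambda>x. f x t) \<in> borel_measurable M" "(\<lambda>x. g x t) \<in> borel_measurable M" if "t \<in> {..<n}" for t
    using measurable_compose[OF f measurable_component_singleton[OF that]]
      measurable_compose[OF g measurable_component_singleton[OF that]] by auto
  show [measurable]: "(\<lambda>z. sqd n (f z) (\<lambda>t. a * g z t)) \<in> borel_measurable M" unfolding sqd_def by measurable
  show "(\<lambda>z. lr a n (f z) (g z)) \<in> borel_measurable M" unfolding lr_def using measurable_sqd(2)[OF f] by measurable
qed

lemma density_lr:
  assumes a: "a\<^sup>2 < 1"
  shows "density (std n) (\<lambda>x. ennreal (lr a n x v)) =
    distr (std n) (Rn n) (\<lambda>y. \<lambda>t\<in>{..<n}. a * v t + sqrt (1 - a\<^sup>2) * y t)"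
proof -
  define c where "c = 1 - a\<^sup>2"
  have c: "0 < c" using a by (simp add: c_def)
  define f where "f t x = ennreal (1 / sqrt c * exp (x\<^sup>2 / 2 - (x - a * v t)\<^sup>2 / (2 * c)))" for t x
  have fm: "f t \<in> borel_measurable (gauss 0 1)" for t unfolding f_def by simp
  have d: "density (gauss 0 1) (f t) = gauss (a * v t) (sqrt c)" for t
  proof -
    have "density (gauss 0 1) (f t) = density lborel (\<lambda>x. ennreal (std_normal_density x) * f t x)"
      unfolding gauss_def using fm[of t] by (intro density_density_eq) simp_all
    also have "\<dots> = gauss (a * v t) (sqrt c)"
      unfolding gauss_def
    proof (intro density_cong AE_I2)
      fix x
      have "std_normal_density x * (1 / sqrt c * exp (x\<^sup>2 / 2 - (x - a * v t)\<^sup>2 / (2 * c))) = normal_density (a * v t) (sqrt c) x"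
      proof -
        have "exp (- x\<^sup>2 / 2) * exp (x\<^sup>2 / 2 - (x - a * v t)\<^sup>2 / (2 * c)) = exp (- (x - a * v t)\<^sup>2 / (2 * c))"
          by (simp add: exp_add[symmetric])
        then show ?thesis using c by (simp add: normal_density_def real_sqrt_mult)
      qed
      then show "ennreal (std_normal_density x) * f t x = ennreal (normal_density (a * v t) (sqrt c) x)"
        using c by (simp add: f_def ennreal_mult[symmetric])
    qed (use fm[of t] in simp_all)
    finally show ?thesis .
  qed
  have e: "ennreal (lr a n x v) = (\<Prod>t\<in>{..<n}. f t (x t))" for x
  proof -
    have "(\<Prod>t\<in>{..<n}. f t (x t)) = ennreal (\<Prod>t\<in>{..<n}. 1 / sqrt c * exp ((x t)\<^sup>2 / 2 - (x t - a * v t)\<^sup>2 / (2 * c)))"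
      unfolding f_def using c by (intro prod_ennreal) auto
    also have "(\<Prod>t\<in>{..<n}. 1 / sqrt c * exp ((x t)\<^sup>2 / 2 - (x t - a * v t)\<^sup>2 / (2 * c))) = lr a n x v"
      unfolding prod.distrib lr_def c_def[symmetric]
      by (simp add: exp_sum[symmetric] sqn_def sqd_def sum_subtractf sum_divide_distrib power_one_over)
    finally show ?thesis by simp
  qed
  have "density (std n) (\<lambda>x. ennreal (lr a n x v)) = PiM {..<n} (\<lambda>t. density (gauss 0 1) (f t))"
    unfolding e by (rule density_PiM) (use fm[unfolded measurable_gauss] in \<open>auto simp: d c intro!: prob_space_gauss\<close>)
  also have "\<dots> = distr (std n) (Rn n) (\<lambda>y. \<lambda>t\<in>{..<n}. a * v t + sqrt c * y t)"
    unfolding d using c by (intro PiM_gauss_affine[symmetric]) simp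
  finally show ?thesis by (simp add: c_def)
qed

lemma measurable_std[simp]: "measurable (std n) N = measurable (Rn n) N"
  by (rule measurable_cong_sets) auto

lemma nn_integral_lr:
  assumes a: "a\<^sup>2 < 1" and g: "g \<in> borel_measurable (Rn n)"
  shows "(\<integral>\<^sup>+x. ennreal (lr a n x v) * g x \<partial>std n) = (\<integral>\<^sup>+y. g (\<lambda>t\<in>{..<n}. a * v t + sqrt (1 - a\<^sup>2) * y t) \<partial>std n)"
proof -
  have m: "(\<lambda>x. ennreal (lr a n x v)) \<in> borel_measurable (std n)"
  proof -
    \<comment> \<open>\<open>lr\<close> sees only the letters of \<open>v\<close> below
      \<open>n\<close>. The restriction is a point of the space, so it may be inserted as a constant
      into the joint measurability.\<close>
    have "restrict v {..<n} \<in> space (Rn n)" by (auto simp: space_PiM PiE_def)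
    then have "(\<lambda>x. lr a n x (\<lambda>t\<in>{..<n}. v t)) \<in> borel_measurable (Rn n)"
      by (intro measurable_lr measurable_ident_sets[OF refl] measurable_const)
    also have "(\<lambda>x. lr a n x (\<lambda>t\<in>{..<n}. v t)) = (\<lambda>x. lr a n x v)"
    proof
      fix x
      have "sqd n x (\<lambda>t. a * restrict v {..<n} t) = sqd n x (\<lambda>t. a * v t)"
        unfolding sqd_def by (intro sum.cong) auto
      then show "lr a n x (\<lambda>t\<in>{..<n}. v t) = lr a n x v" by (simp only: lr_def)
    qed
    finally show ?thesis by simp
  qed
  have "(\<integral>\<^sup>+x. ennreal (lr a n x v) * g x \<partial>std n) = (\<integral>\<^sup>+x. g x \<partial>density (std n) (\<lambda>x. ennreal (lr a n x v)))"
    using g m by (subst nn_integral_density) auto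
  also have "\<dots> = (\<integral>\<^sup>+y. g (\<lambda>t\<in>{..<n}. a * v t + sqrt (1 - a\<^sup>2) * y t) \<partial>std n)"
    unfolding density_lr[OF a] using g measurable_affine_Rn by (subst nn_integral_distr) auto
  finally show ?thesis .
qed

section \<open>Typical pairs and the truncated likelihood ratio\<close>

lemma std_norm_concentration:
  assumes \<delta>: "0 < \<delta>" and n: "1 \<le> n"
  shows "(\<integral>\<^sup>+x. indicator {x. \<bar>sqn n x - real n\<bar> > real n * \<delta>} x \<partial>std n) \<le> ennreal (2 / (real n * \<delta>\<^sup>2))"
proof -
  have "(\<integral>\<^sup>+x. indicator {x. \<bar>sqn n x - real n\<bar> > real n * \<delta>} x \<partial>std n) \<le> (\<integral>\<^sup>+x. ennreal ((sqn n x - real n)\<^sup>2 / (real n * \<delta>)\<^sup>2) \<partial>std n)"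
  proof (intro nn_integral_mono)
    fix x
    show "indicator {x. \<bar>sqn n x - real n\<bar> > real n * \<delta>} x \<le> ennreal ((sqn n x - real n)\<^sup>2 / (real n * \<delta>)\<^sup>2)"
    proof (cases "\<bar>sqn n x - real n\<bar> > real n * \<delta>")
      case True
      then have "(real n * \<delta>)\<^sup>2 \<le> \<bar>sqn n x - real n\<bar>\<^sup>2" using \<delta> by (intro power_mono) auto
      moreover have "0 < (real n * \<delta>)\<^sup>2" using \<delta> n by simp
      ultimately have "1 \<le> (sqn n x - real n)\<^sup>2 / (real n * \<delta>)\<^sup>2" by (simp add: field_simps)
      then show ?thesis using True by simp
    qed simp
  qed
  also have "\<dots> = ennreal (\<integral>x. (sqn n x - real n)\<^sup>2 / (real n * \<delta>)\<^sup>2 \<partial>std n)"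
    using std_sqn_variance by (intro nn_integral_eq_integral) auto
  also have "(\<integral>x. (sqn n x - real n)\<^sup>2 / (real n * \<delta>)\<^sup>2 \<partial>std n) = 2 / (real n * \<delta>\<^sup>2)"
    using std_sqn_variance n by (simp add: power2_eq_square)
  finally show ?thesis .
qed

text \<open>Each bound has its task: the lower bound on the noise and the upper bound on the norm of
  \<open>x\<close> cap the likelihood ratio, while the upper bound on the noise caps the distortion
  between \<open>x\<close> and \<open>a * v\<close>.\<close>

definition typical :: "real \<Rightarrow> nat \<Rightarrow> real \<Rightarrow> (nat \<Rightarrow> real) \<Rightarrow> (nat \<Rightarrow> real) \<Rightarrow> bool" where
  "typical a n \<delta> x v \<longleftrightarrow> \<bar>sqd n x (\<lambda>t. a * v t) / (1 - a\<^sup>2) - real n\<bar> \<le> real n * \<delta> \<and> sqn n x \<le> real n * (1 + \<delta>)"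

definition lrT :: "real \<Rightarrow> nat \<Rightarrow> real \<Rightarrow> (nat \<Rightarrow> real) \<Rightarrow> (nat \<Rightarrow> real) \<Rightarrow> real" where
  "lrT a n \<delta> x v = (if typical a n \<delta> x v then lr a n x v else 0)"

text \<open>The cap has the mutual information \<open>- ln (1 - a\<^sup>2) / 2\<close> of a normal
  pair with correlation \<open>a\<close> as exponent per letter. The slack \<open>\<delta>\<close>
  is half the difference between \<open>1 + \<delta>\<close> and \<open>1 - \<delta>\<close>, the
  extreme values that \<open>typical\<close> allows.\<close>

lemma lrT_bounds:
  assumes a: "a\<^sup>2 < 1"
  shows "0 \<le> lrT a n \<delta> x v" "lrT a n \<delta> x v \<le> exp (real n * (\<delta> - ln (1 - a\<^sup>2) / 2))" "lrT a n \<delta> x v \<le> lr a n x v"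
proof -
  define c where "c = 1 - a\<^sup>2"
  have c: "0 < c" using a by (simp add: c_def)
  show "0 \<le> lrT a n \<delta> x v" "lrT a n \<delta> x v \<le> lr a n x v" using lr_nonneg[OF a] by (auto simp: lrT_def)
  show "lrT a n \<delta> x v \<le> exp (real n * (\<delta> - ln (1 - a\<^sup>2) / 2))"
  proof (cases "typical a n \<delta> x v")
    case True
    have p: "(1 / sqrt c) ^ n = exp (real n * (- ln c / 2))"
    proof -
      have "1 / sqrt c = exp (- ln c / 2)" 
      proof -
        have "exp (- ln c / 2) = exp (- ln (sqrt c))" using c by (simp add: ln_sqrt)
        also have "\<dots> = 1 / sqrt c" using c by (simp only: exp_minus) (simp add: inverse_eq_divide)
        finally show ?thesis by simp
      qed
      then show ?thesis by (simp only: exp_of_nat_mult)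
    qed
    have "sqn n x / 2 - sqd n x (\<lambda>t. a * v t) / (2 * c) = (sqn n x - sqd n x (\<lambda>t. a * v t) / c) / 2"
      by (simp add: diff_divide_distrib)
    also have "\<dots> \<le> real n * \<delta>" using True unfolding typical_def c_def by (simp add: algebra_simps abs_le_iff)
    finally have "exp (sqn n x / 2 - sqd n x (\<lambda>t. a * v t) / (2 * c)) \<le> exp (real n * \<delta>)" by simp
    then have "lr a n x v \<le> exp (real n * (- ln c / 2)) * exp (real n * \<delta>)"
      unfolding lr_def c_def[symmetric] p by (intro mult_left_mono) auto
    also have "\<dots> = exp (real n * (\<delta> - ln c / 2))" by (simp add: exp_add[symmetric] algebra_simps)
    finally show ?thesis using True by (simp add: lrT_def c_def)
  qed (simp add: lrT_def)
qed

lemma measurable_lrT[measurable]: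
  assumes f: "f \<in> M \<rightarrow>\<^sub>M Rn n" and g: "g \<in> M \<rightarrow>\<^sub>M Rn n"
  shows "(\<lambda>z. lrT a n \<delta> (f z) (g z)) \<in> borel_measurable M" "Measurable.pred M (\<lambda>z. typical a n \<delta> (f z) (g z))"
proof -
  show [measurable]: "Measurable.pred M (\<lambda>z. typical a n \<delta> (f z) (g z))"
    unfolding typical_def using measurable_lr(1)[OF f g] measurable_sqd(2)[OF f] by measurable
  show "(\<lambda>z. lrT a n \<delta> (f z) (g z)) \<in> borel_measurable M"
    unfolding lrT_def using measurable_lr(2)[OF f g] by measurable
qed

lemma nn_integral_lr_one: "a\<^sup>2 < 1 \<Longrightarrow> (\<integral>\<^sup>+x. ennreal (lr a n x v) \<partial>std n) = 1"
  using nn_integral_lr[of a "\<lambda>_. 1" n v] prob_space.emeasure_space_1[OF prob_space_std, of n] by simp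

lemma integral_lrT:
  assumes a: "a\<^sup>2 < 1" and x: "x \<in> space (Rn n)"
  shows "integrable (std n) (\<lambda>v. lrT a n \<delta> x v)" "(\<integral>v. lrT a n \<delta> x v \<partial>std n) \<le> 1" "0 \<le> (\<integral>v. lrT a n \<delta> x v \<partial>std n)"
    "integrable (std n) (\<lambda>v. lrT a n \<delta> v x)" "(\<integral>v. lrT a n \<delta> v x \<partial>std n) \<le> 1"
proof -
  interpret prob_space "std n" by simp
  have m: "(\<lambda>v. lrT a n \<delta> x v) \<in> borel_measurable (Rn n)" "(\<lambda>v. lrT a n \<delta> v x) \<in> borel_measurable (Rn n)"
    using x by (auto intro!: measurable_lrT measurable_ident_sets[OF refl])
  show 1: "integrable (std n) (\<lambda>v. lrT a n \<delta> x v)"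
    by (rule integrable_const_bound[where B="exp (real n * (\<delta> - ln (1 - a\<^sup>2) / 2))"]) (use m lrT_bounds[OF a] in auto)
  show 2: "integrable (std n) (\<lambda>v. lrT a n \<delta> v x)"
    by (rule integrable_const_bound[where B="exp (real n * (\<delta> - ln (1 - a\<^sup>2) / 2))"]) (use m lrT_bounds[OF a] in auto)
  show "0 \<le> (\<integral>v. lrT a n \<delta> x v \<partial>std n)" using lrT_bounds[OF a] by (intro integral_nonneg_AE) auto
  have "ennreal (\<integral>v. lrT a n \<delta> v x \<partial>std n) = (\<integral>\<^sup>+v. ennreal (lrT a n \<delta> v x) \<partial>std n)"
    using lrT_bounds[OF a] by (intro nn_integral_eq_integral[symmetric] 2) auto
  also have "\<dots> \<le> (\<integral>\<^sup>+v. ennreal (lr a n v x) \<partial>std n)" by (intro nn_integral_mono ennreal_leI lrT_bounds a)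
  finally show "(\<integral>v. lrT a n \<delta> v x \<partial>std n) \<le> 1" using nn_integral_lr_one[OF a] by (simp add: ennreal_le_1)
  have "ennreal (\<integral>v. lrT a n \<delta> x v \<partial>std n) = (\<integral>\<^sup>+v. ennreal (lrT a n \<delta> x v) \<partial>std n)"
    using lrT_bounds[OF a] by (intro nn_integral_eq_integral[symmetric] 1) auto
  also have "\<dots> \<le> (\<integral>\<^sup>+v. ennreal (lr a n v x) \<partial>std n)"
    unfolding lr_commute[OF a, of n _ x] by (intro nn_integral_mono ennreal_leI lrT_bounds a)
  finally show "(\<integral>v. lrT a n \<delta> x v \<partial>std n) \<le> 1" using nn_integral_lr_one[OF a] by (simp add: ennreal_le_1)
qed

text \<open>Under the joint density \<open>lr\<close> both the normalized noise
  \<open>(x - a * v) / sqrt (1 - a\<^sup>2)\<close> and, by \<open>lr_commute\<close>, the vector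
  \<open>x\<close> itself are standard normal. An atypical pair has one of the two norms off, and
  each of these events costs \<open>2 / (n * \<delta>\<^sup>2)\<close> by Chebyshev.\<close>

lemma atypical_mass:
  assumes a: "a\<^sup>2 < 1" and \<delta>: "0 < \<delta>" and n: "1 \<le> n"
  shows "(\<integral>\<^sup>+x. \<integral>\<^sup>+v. ennreal (lr a n x v - lrT a n \<delta> x v) \<partial>std n \<partial>std n) \<le> ennreal (4 / (real n * \<delta>\<^sup>2))"
proof -
  interpret S: prob_space "std n" by simp
  interpret SS: pair_sigma_finite "std n" "std n" ..
  define E where "E = {x. \<bar>sqn n x - real n\<bar> > real n * \<delta>}"
  \<comment> \<open>The set does not depend on its bound variable, so this indicator at 0 is just
    the truth value of the condition, as a number.\<close>
  define G where "G = (\<lambda>(x, v). ennreal (lr a n x v) * indicator {y. \<bar>sqd n x (\<lambda>t. a * v t) / (1 - a\<^sup>2) - real n\<bar> > real n * \<delta>} (0::nat))"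
  have fs[measurable]: "fst \<in> std n \<Otimes>\<^sub>M std n \<rightarrow>\<^sub>M Rn n" "snd \<in> std n \<Otimes>\<^sub>M std n \<rightarrow>\<^sub>M Rn n"
    using measurable_fst[of "std n" "std n"] measurable_snd[of "std n" "std n"]
    by (simp_all only: measurable_cong_sets[OF refl sets_PiM_gauss[of "{..<n}" "\<lambda>_. 0" "\<lambda>_. 1"]])
  have iE: "indicator E \<in> borel_measurable (Rn n)"
    unfolding E_def using measurable_sqd(2)[OF measurable_ident_sets[OF refl], of n]
    by (intro borel_measurable_indicator') measurable
  have split: "ennreal (lr a n x v - lrT a n \<delta> x v) \<le> G (x, v) + ennreal (lr a n x v) * indicator E x" for x v
  proof (cases "typical a n \<delta> x v")
    case False
    then consider "\<bar>sqd n x (\<lambda>t. a * v t) / (1 - a\<^sup>2) - real n\<bar> > real n * \<delta>" | "sqn n x > real n * (1 + \<delta>)"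
      unfolding typical_def by linarith
    then show ?thesis
    proof cases
      case 2
      then have "x \<in> E" by (simp add: E_def algebra_simps)
      then show ?thesis using False by (simp add: lrT_def add_increasing)
    qed (use False in \<open>simp add: lrT_def G_def add_increasing2\<close>)
  qed (simp add: lrT_def)
  have Gm: "G \<in> borel_measurable (std n \<Otimes>\<^sub>M std n)"
    unfolding G_def split_beta' using measurable_lr[OF fs] by measurable
  have Hm: "(\<lambda>(x, v). ennreal (lr a n x v) * indicator E x) \<in> borel_measurable (std n \<Otimes>\<^sub>M std n)"
    unfolding split_beta' using measurable_lr(2)[OF fs] measurable_compose[OF fs(1) iE] by measurable
  have "(\<integral>\<^sup>+x. \<integral>\<^sup>+v. ennreal (lr a n x v - lrT a n \<delta> x v) \<partial>std n \<partial>std n)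
    \<le> (\<integral>\<^sup>+x. \<integral>\<^sup>+v. G (x, v) + ennreal (lr a n x v) * indicator E x \<partial>std n \<partial>std n)"
    by (intro nn_integral_mono split)
  also have "\<dots> = (\<integral>\<^sup>+x. (\<integral>\<^sup>+v. G (x, v) \<partial>std n) + (\<integral>\<^sup>+v. ennreal (lr a n x v) * indicator E x \<partial>std n) \<partial>std n)"
    using measurable_compose[OF measurable_Pair1' Gm] measurable_compose[OF measurable_Pair1' Hm]
    by (intro nn_integral_cong nn_integral_add) auto
  also have "\<dots> = (\<integral>\<^sup>+x. \<integral>\<^sup>+v. G (x, v) \<partial>std n \<partial>std n) + (\<integral>\<^sup>+x. \<integral>\<^sup>+v. ennreal (lr a n x v) * indicator E x \<partial>std n \<partial>std n)"
    using S.borel_measurable_nn_integral_fst[OF Gm] S.borel_measurable_nn_integral_fst[OF Hm]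
    by (intro nn_integral_add) auto
  \<comment> \<open>The noise is standard normal for a fixed codeword and varying source, hence the
    exchange of integrals. The event on the norm of \<open>x\<close> keeps its order, since there
    \<open>v\<close> integrates out to 1.\<close>
  also have "(\<integral>\<^sup>+x. \<integral>\<^sup>+v. G (x, v) \<partial>std n \<partial>std n) = (\<integral>\<^sup>+v. \<integral>\<^sup>+x. G (x, v) \<partial>std n \<partial>std n)"
    by (rule SS.Fubini'[symmetric]) (use Gm in simp)
  also have "\<dots> \<le> (\<integral>\<^sup>+v. ennreal (2 / (real n * \<delta>\<^sup>2)) \<partial>std n)"
  proof (intro nn_integral_mono)
    fix v assume v: "v \<in> space (std n)"
    define h where "h x = (indicator {y. \<bar>sqd n x (\<lambda>t. a * v t) / (1 - a\<^sup>2) - real n\<bar> > real n * \<delta>} (0::nat) :: ennreal)" for x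
    have hm: "h \<in> borel_measurable (Rn n)"
      unfolding h_def using measurable_sqd(1)[OF measurable_ident_sets[OF refl], of n] by measurable
    have "(\<integral>\<^sup>+x. G (x, v) \<partial>std n) = (\<integral>\<^sup>+y. h (\<lambda>t\<in>{..<n}. a * v t + sqrt (1 - a\<^sup>2) * y t) \<partial>std n)"
      unfolding nn_integral_lr[OF a hm, symmetric] by (simp add: G_def h_def)
    also have "\<dots> = (\<integral>\<^sup>+y. indicator E y \<partial>std n)"
    proof (intro nn_integral_cong)
      fix y
      have "sqd n (\<lambda>t\<in>{..<n}. a * v t + sqrt (1 - a\<^sup>2) * y t) (\<lambda>t. a * v t) = (1 - a\<^sup>2) * sqn n y"
        unfolding sqd_def sqn_def sum_distrib_left using a by (intro sum.cong refl) (simp add: power_mult_distrib)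
      then show "h (\<lambda>t\<in>{..<n}. a * v t + sqrt (1 - a\<^sup>2) * y t) = indicator E y"
        using a by (simp add: h_def E_def indicator_def)
    qed
    also have "\<dots> \<le> ennreal (2 / (real n * \<delta>\<^sup>2))" unfolding E_def by (rule std_norm_concentration[OF \<delta> n])
    finally show "(\<integral>\<^sup>+x. G (x, v) \<partial>std n) \<le> ennreal (2 / (real n * \<delta>\<^sup>2))" .
  qed
  also have "(\<integral>\<^sup>+v. ennreal (2 / (real n * \<delta>\<^sup>2)) \<partial>std n) = ennreal (2 / (real n * \<delta>\<^sup>2))"
    using S.emeasure_space_1 by simp
  also have "(\<integral>\<^sup>+x. \<integral>\<^sup>+v. ennreal (lr a n x v) * indicator E x \<partial>std n \<partial>std n) = (\<integral>\<^sup>+x. indicator E x \<partial>std n)"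
  proof (intro nn_integral_cong)
    fix x assume x: "x \<in> space (std n)"
    have m: "(\<lambda>v. ennreal (lr a n v x)) \<in> borel_measurable (std n)"
      using x by (auto intro!: measurable_compose[OF _ measurable_ennreal] measurable_lr measurable_ident_sets[OF refl] simp: space_PiM)
    show "(\<integral>\<^sup>+v. ennreal (lr a n x v) * indicator E x \<partial>std n) = indicator E x"
      unfolding lr_commute[OF a, of n x] using nn_integral_multc[OF m, of "indicator E x"] nn_integral_lr_one[OF a] by simp
  qed
  also have "\<dots> \<le> ennreal (2 / (real n * \<delta>\<^sup>2))" unfolding E_def by (rule std_norm_concentration[OF \<delta> n])
  also have "ennreal (2 / (real n * \<delta>\<^sup>2)) + ennreal (2 / (real n * \<delta>\<^sup>2)) = ennreal (4 / (real n * \<delta>\<^sup>2))"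
    by (subst ennreal_plus[symmetric]) auto
  finally show ?thesis by (simp add: add_mono)
qed

definition coverage :: "real \<Rightarrow> nat \<Rightarrow> real \<Rightarrow> 'i set \<Rightarrow> ('i \<Rightarrow> nat \<Rightarrow> real) \<Rightarrow> (nat \<Rightarrow> real) \<Rightarrow> real" where
  "coverage a n \<delta> I v x = (\<Sum>i\<in>I. lrT a n \<delta> x (v i)) / real (card I)"

text \<open>Averaged over many random codewords \<open>lr\<close> is close to 1: the mixture of the
  laws around the codewords resembles the standard normal law. \<open>coverage\<close> is this
  average after truncation. Only the shortfall below 1 is recorded, because an excess can be scaled
  down.\<close>

definition uncovered :: "real \<Rightarrow> nat \<Rightarrow> real \<Rightarrow> 'i set \<Rightarrow> ('i \<Rightarrow> nat \<Rightarrow> real) \<Rightarrow> real" where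
  "uncovered a n \<delta> I v = (\<integral>x. max 0 (1 - coverage a n \<delta> I v x) \<partial>std n)"

lemma coverage_nonneg: "a\<^sup>2 < 1 \<Longrightarrow> 0 \<le> coverage a n \<delta> I v x"
  unfolding coverage_def by (intro divide_nonneg_nonneg sum_nonneg lrT_bounds) auto

lemma measurable_coverage[measurable]:
  assumes f: "f \<in> M \<rightarrow>\<^sub>M Rn n" and g: "\<And>i. i \<in> I \<Longrightarrow> (\<lambda>z. g z i) \<in> M \<rightarrow>\<^sub>M Rn n"
  shows "(\<lambda>z. coverage a n \<delta> I (g z) (f z)) \<in> borel_measurable M"
  unfolding coverage_def using measurable_lrT(1)[OF f g] by (intro borel_measurable_divide borel_measurable_sum) auto

lemma std_norm_deviation:
  shows "integrable (std n) (\<lambda>x. \<bar>sqn n x - real n\<bar>)"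
    and "0 < \<tau> \<Longrightarrow> 1 \<le> n \<Longrightarrow> (\<integral>x. \<bar>sqn n x - real n\<bar> \<partial>std n) \<le> real n * (\<tau> / 2) + 1 / \<tau>"
proof -
  interpret prob_space "std n" by simp
  show i: "integrable (std n) (\<lambda>x. \<bar>sqn n x - real n\<bar>)" using std_sqn by auto
  assume \<tau>: "0 < \<tau>" and n: "1 \<le> n"
  have "(\<integral>x. \<bar>sqn n x - real n\<bar> \<partial>std n) \<le> (\<integral>x. real n * \<tau> / 2 + (sqn n x - real n)\<^sup>2 / (2 * real n * \<tau>) \<partial>std n)"
  proof (rule integral_mono[OF i])
    show "integrable (std n) (\<lambda>x. real n * \<tau> / 2 + (sqn n x - real n)\<^sup>2 / (2 * real n * \<tau>))"
      using std_sqn_variance by auto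
    fix x
    \<comment> \<open>The deviation is bounded by \<open>t / 2 + y\<^sup>2 / (2 * t)\<close>; with
      \<open>t\<close> proportional to \<open>n\<close> the variance \<open>2 * n\<close> leaves
      only \<open>1 / \<tau>\<close>, which is negligible against \<open>n\<close>.\<close>
    define y t where "y = \<bar>sqn n x - real n\<bar>" and "t = real n * \<tau>"
    have t: "0 < t" using \<tau> n by (simp add: t_def)
    have "0 \<le> (t - y)\<^sup>2 / (2 * t)" using t by simp
    also have "\<dots> = t / 2 + y\<^sup>2 / (2 * t) - y" using t by (simp add: power2_eq_square field_simps)
    finally show "\<bar>sqn n x - real n\<bar> \<le> real n * \<tau> / 2 + (sqn n x - real n)\<^sup>2 / (2 * real n * \<tau>)"
      by (simp add: y_def t_def mult.assoc)
  qed
  also have "\<dots> = real n * \<tau> / 2 + 2 * real n / (2 * real n * \<tau>)"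
    using std_sqn_variance by (simp add: prob_space)
  finally show "(\<integral>x. \<bar>sqn n x - real n\<bar> \<partial>std n) \<le> real n * (\<tau> / 2) + 1 / \<tau>" using n by simp
qed

text \<open>The cells are truncated posterior weights of the codewords. On the assigned part
  typicality bounds the distortion. The rest goes through \<open>balanced_completion\<close>, where
  distances are bounded by the norms of source and codeword, and the norms are replaced by
  \<open>n\<close> up to their deviation.\<close>

lemma codebook_quantizer:
  assumes a: "a\<^sup>2 < 1" and \<delta>: "0 < \<delta>" and I: "finite I" "I \<noteq> {}"
    and v: "\<And>i. i \<in> I \<Longrightarrow> v i \<in> space (Rn n)"
  shows "\<exists>\<omega>. (\<forall>i\<in>I. \<omega> i \<in> borel_measurable (Rn n) \<and> (\<forall>x. 0 \<le> \<omega> i x) \<and> (\<integral>x. \<omega> i x \<partial>std n) = 1 / real (card I))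
    \<and> (\<forall>x. (\<Sum>i\<in>I. \<omega> i x) = 1)
    \<and> (\<Sum>i\<in>I. \<integral>x. \<omega> i x * sqd n x (\<lambda>t. a * v i t) \<partial>std n) \<le>
        real n * (1 - a\<^sup>2) * (1 + \<delta>) + 4 * real n * uncovered a n \<delta> I v + 2 * (\<integral>x. \<bar>sqn n x - real n\<bar> \<partial>std n)
        + 2 * (\<Sum>i\<in>I. \<bar>sqn n (v i) - real n\<bar>) / real (card I)"
proof -
  interpret prob_space "std n" by simp
  define M where "M = real (card I)"
  have M: "0 < M" using I by (simp add: M_def card_gt_0_iff)
  define S where "S x = coverage a n \<delta> I v x" for x
  have S0: "0 \<le> S x" for x unfolding S_def by (rule coverage_nonneg[OF a])
  have Sm[measurable]: "S \<in> borel_measurable (Rn n)"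
    unfolding S_def using v by (intro measurable_coverage measurable_ident_sets[OF refl] measurable_const)
  have lm[measurable]: "(\<lambda>x. lrT a n \<delta> x (v i)) \<in> borel_measurable (Rn n)" if "i \<in> I" for i
    using v[OF that] by (intro measurable_lrT measurable_ident_sets[OF refl] measurable_const)
  \<comment> \<open>Dividing by \<open>max 1 (S x)\<close> keeps each cell at mass at most
    \<open>1 / M\<close>, because a truncated likelihood ratio integrates to at most 1. Dividing by
    \<open>S x\<close> alone could make a cell too heavy to be balanced.\<close>
  define w0 where "w0 i x = lrT a n \<delta> x (v i) / (M * max 1 (S x))" for i x
  have w0: "0 \<le> w0 i x" for i x unfolding w0_def using M lrT_bounds[OF a] by (intro divide_nonneg_nonneg) auto
  have sum: "(\<Sum>i\<in>I. w0 i x) = S x / max 1 (S x)" for x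
    unfolding w0_def S_def coverage_def M_def[symmetric] by (simp add: sum_divide_distrib)
  have g: "1 - (\<Sum>i\<in>I. w0 i x) = max 0 (1 - S x)" for x
    unfolding sum using S0[of x] by (simp add: max_def)
  have le1: "(\<Sum>i\<in>I. w0 i x) \<le> 1" for x using g[of x] by (simp add: max_def split: if_splits)
  have w0m: "w0 i \<in> borel_measurable (std n)" if "i \<in> I" for i
    unfolding w0_def using lm[OF that] by simp
  have w0le: "w0 i x \<le> lrT a n \<delta> x (v i) / M" for i x
    unfolding w0_def using M lrT_bounds(1)[OF a] by (intro divide_left_mono) (auto simp: mult_le_cancel_left1)
  have il: "integrable (std n) (\<lambda>x. lrT a n \<delta> x (v i) / M)" if "i \<in> I" for i
    using integral_lrT(4)[OF a v[OF that]] by simp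
  have i0: "integrable (std n) (w0 i)" if i: "i \<in> I" for i
  proof (rule Bochner_Integration.integrable_bound[OF il[OF i] w0m[OF i]], rule AE_I2)
    fix x
    show "norm (w0 i x) \<le> norm (lrT a n \<delta> x (v i) / M)"
      unfolding real_norm_def using w0[of i x] w0le[of i x] by linarith
  qed
  have leM: "(\<integral>x. w0 i x \<partial>std n) \<le> 1 / M" if i: "i \<in> I" for i
  proof -
    have "(\<integral>x. w0 i x \<partial>std n) \<le> (\<integral>x. lrT a n \<delta> x (v i) / M \<partial>std n)"
      by (intro integral_mono i0 il i w0le)
    also have "\<dots> \<le> 1 / M" using integral_lrT(5)[OF a v[OF i]] M by (simp add: divide_right_mono)
    finally show ?thesis .
  qed
  have a2: "sqn n (\<lambda>t. a * x t) \<le> sqn n x" for x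
    unfolding sqn_def using a by (intro sum_mono) (simp add: power_mult_distrib mult_left_le_one_le)
  obtain \<omega> where \<omega>: "\<forall>i\<in>I. \<omega> i \<in> borel_measurable (std n) \<and> (\<forall>x. 0 \<le> \<omega> i x) \<and> (\<integral>x. \<omega> i x \<partial>std n) = 1 / real (card I)"
    "\<forall>x. (\<Sum>i\<in>I. \<omega> i x) = 1"
    "(\<Sum>i\<in>I. \<integral>x. \<omega> i x * sqd n x (\<lambda>t. a * v i t) \<partial>std n) \<le> real n * (1 - a\<^sup>2) * (1 + \<delta>)
        + (\<integral>x. (1 - (\<Sum>i\<in>I. w0 i x)) * (2 * sqn n x) \<partial>std n)
        + (\<Sum>i\<in>I. (1 / real (card I) - (\<integral>x. w0 i x \<partial>std n)) * (2 * sqn n (v i)))"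
  proof -
    have "\<exists>\<omega>. (\<forall>i\<in>I. \<omega> i \<in> borel_measurable (std n) \<and> (\<forall>x. 0 \<le> \<omega> i x) \<and> (\<integral>x. \<omega> i x \<partial>std n) = 1 / real (card I))
    \<and> (\<forall>x. (\<Sum>i\<in>I. \<omega> i x) = 1)
    \<and> (\<Sum>i\<in>I. \<integral>x. \<omega> i x * sqd n x (\<lambda>t. a * v i t) \<partial>std n) \<le> real n * (1 - a\<^sup>2) * (1 + \<delta>)
        + (\<integral>x. (1 - (\<Sum>i\<in>I. w0 i x)) * (2 * sqn n x) \<partial>std n)
        + (\<Sum>i\<in>I. (1 / real (card I) - (\<integral>x. w0 i x \<partial>std n)) * (2 * sqn n (v i)))"
    proof (rule balanced_completion[OF prob_space_axioms I w0m w0 le1])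
      show "(\<integral>x. w0 i x \<partial>std n) \<le> 1 / real (card I)" if "i \<in> I" for i using leM[OF that] by (simp add: M_def)
      show "(\<lambda>x. sqd n x (\<lambda>t. a * v i t)) \<in> borel_measurable (std n)" if "i \<in> I" for i
        using measurable_sqd(1)[OF measurable_ident_sets[OF refl], of n] by simp
      show "sqd n x (\<lambda>t. a * v i t) \<le> 2 * sqn n x + 2 * sqn n (v i)" for i x
        using sqd_le[of n x "\<lambda>t. a * v i t"] a2[of "v i"] by simp
      show "integrable (std n) (\<lambda>x. 2 * sqn n x)" using std_sqn by simp
      show "0 \<le> real n * (1 - a\<^sup>2) * (1 + \<delta>)" using a \<delta> by simp
      fix i x assume "i \<in> I" "0 < w0 i x"
      then have "typical a n \<delta> x (v i)" by (auto simp: w0_def lrT_def split: if_splits)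
      then have "sqd n x (\<lambda>t. a * v i t) / (1 - a\<^sup>2) \<le> real n * (1 + \<delta>)"
        unfolding typical_def distrib_left by linarith
      then show "sqd n x (\<lambda>t. a * v i t) \<le> real n * (1 - a\<^sup>2) * (1 + \<delta>)" using a by (simp add: field_simps)
    qed auto
    then show thesis using that by blast
  qed
  have ig: "integrable (std n) (\<lambda>x. max 0 (1 - S x))"
    using S0 by (intro integrable_const_bound[where B=1] AE_I2) auto
  have ug: "uncovered a n \<delta> I v = (\<integral>x. max 0 (1 - S x) \<partial>std n)" by (simp add: uncovered_def S_def)
  \<comment> \<open>The norm is split into \<open>n\<close> and its deviation; the missing fraction
    lies between 0 and 1, so the deviation enters at most in full.\<close>
  have A: "(\<integral>x. (1 - (\<Sum>i\<in>I. w0 i x)) * (2 * sqn n x) \<partial>std n) \<le> 2 * real n * uncovered a n \<delta> I v + 2 * (\<integral>x. \<bar>sqn n x - real n\<bar> \<partial>std n)"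
  proof -
    have "(\<integral>x. (1 - (\<Sum>i\<in>I. w0 i x)) * (2 * sqn n x) \<partial>std n) \<le> (\<integral>x. 2 * real n * max 0 (1 - S x) + 2 * \<bar>sqn n x - real n\<bar> \<partial>std n)"
      unfolding g
    proof (rule integral_mono)
      show "integrable (std n) (\<lambda>x. max 0 (1 - S x) * (2 * sqn n x))"
        by (rule integrable_weight_mult) (use S0 std_sqn in \<open>auto intro!: AE_I2\<close>)
      show "integrable (std n) (\<lambda>x. 2 * real n * max 0 (1 - S x) + 2 * \<bar>sqn n x - real n\<bar>)"
        using ig std_norm_deviation(1) by simp
      fix x
      have "max 0 (1 - S x) * (sqn n x - real n) \<le> max 0 (1 - S x) * \<bar>sqn n x - real n\<bar>" by (intro mult_left_mono) auto
      also have "\<dots> \<le> \<bar>sqn n x - real n\<bar>" using S0[of x] by (intro mult_left_le_one_le) auto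
      finally show "max 0 (1 - S x) * (2 * sqn n x) \<le> 2 * real n * max 0 (1 - S x) + 2 * \<bar>sqn n x - real n\<bar>"
        by (simp add: algebra_simps)
    qed
    also have "\<dots> = 2 * real n * uncovered a n \<delta> I v + 2 * (\<integral>x. \<bar>sqn n x - real n\<bar> \<partial>std n)"
      using ig std_norm_deviation(1) by (simp add: ug)
    finally show ?thesis .
  qed
  have un: "(\<Sum>i\<in>I. 1 / M - (\<integral>x. w0 i x \<partial>std n)) = uncovered a n \<delta> I v"
  proof -
    have "uncovered a n \<delta> I v = (\<integral>x. 1 - (\<Sum>i\<in>I. w0 i x) \<partial>std n)" unfolding ug g ..
    also have "\<dots> = 1 - (\<Sum>i\<in>I. \<integral>x. w0 i x \<partial>std n)" using i0 by (simp add: prob_space)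
    finally show ?thesis using M by (simp add: sum_subtractf M_def)
  qed
  have B: "(\<Sum>i\<in>I. (1 / M - (\<integral>x. w0 i x \<partial>std n)) * (2 * sqn n (v i))) \<le> 2 * real n * uncovered a n \<delta> I v + 2 * (\<Sum>i\<in>I. \<bar>sqn n (v i) - real n\<bar>) / M"
  proof -
    have "(\<Sum>i\<in>I. (1 / M - (\<integral>x. w0 i x \<partial>std n)) * (2 * sqn n (v i))) \<le>
      (\<Sum>i\<in>I. (1 / M - (\<integral>x. w0 i x \<partial>std n)) * (2 * real n) + 2 * (\<bar>sqn n (v i) - real n\<bar> / M))"
    proof (intro sum_mono)
      fix i assume i: "i \<in> I"
      define p where "p = 1 / M - (\<integral>x. w0 i x \<partial>std n)"
      have "0 \<le> (\<integral>x. w0 i x \<partial>std n)" using w0 by (intro integral_nonneg_AE) auto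
      then have p: "0 \<le> p" "p \<le> 1 / M" using leM[OF i] by (auto simp: p_def)
      have "p * (sqn n (v i) - real n) \<le> p * \<bar>sqn n (v i) - real n\<bar>" using p by (intro mult_left_mono) auto
      also have "\<dots> \<le> 1 / M * \<bar>sqn n (v i) - real n\<bar>" using p by (intro mult_right_mono) auto
      finally show "(1 / M - (\<integral>x. w0 i x \<partial>std n)) * (2 * sqn n (v i)) \<le> (1 / M - (\<integral>x. w0 i x \<partial>std n)) * (2 * real n) + 2 * (\<bar>sqn n (v i) - real n\<bar> / M)"
        unfolding p_def[symmetric] by (simp add: algebra_simps)
    qed
    also have "\<dots> = uncovered a n \<delta> I v * (2 * real n) + 2 * ((\<Sum>i\<in>I. \<bar>sqn n (v i) - real n\<bar>) / M)"
      unfolding sum.distrib sum_distrib_right[symmetric] sum_distrib_left[symmetric] un sum_divide_distrib[symmetric] ..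
    finally show ?thesis by (simp add: mult_ac)
  qed
  have "(\<Sum>i\<in>I. \<integral>x. \<omega> i x * sqd n x (\<lambda>t. a * v i t) \<partial>std n) \<le>
        real n * (1 - a\<^sup>2) * (1 + \<delta>) + 4 * real n * uncovered a n \<delta> I v + 2 * (\<integral>x. \<bar>sqn n x - real n\<bar> \<partial>std n)
        + 2 * (\<Sum>i\<in>I. \<bar>sqn n (v i) - real n\<bar>) / real (card I)"
    using \<omega>(3) A B unfolding M_def by linarith
  then show ?thesis using \<omega>(1,2) by (intro exI[of _ \<omega>]) auto
qed

text \<open>Soft covering by second moments. For fixed \<open>x\<close> the coverage has mean
  \<open>m\<close> over the codebook. The shortfall is at most \<open>1 - m\<close> plus the
  fluctuation around \<open>m\<close>, whose variance is at most \<open>L / M\<close> by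
  independence of the codewords. The inequality
  \<open>y \<le> \<tau> / 2 + y\<^sup>2 / (2 * \<tau>)\<close> brings in the variance without a
  root.\<close>

lemma nn_integral_uncovered:
  assumes a: "a\<^sup>2 < 1" and \<delta>: "0 < \<delta>" and \<tau>: "0 < \<tau>" and n: "1 \<le> n"
    and U: "finite U" and IU: "I \<subseteq> U" "I \<noteq> {}"
  shows "(\<lambda>v. ennreal (uncovered a n \<delta> I v)) \<in> borel_measurable (PiM U (\<lambda>_. std n))"
    and "(\<integral>\<^sup>+v. ennreal (uncovered a n \<delta> I v) \<partial>PiM U (\<lambda>_. std n)) \<le>
      ennreal (4 / (real n * \<delta>\<^sup>2) + \<tau> / 2 + exp (real n * (\<delta> - ln (1 - a\<^sup>2) / 2)) / (2 * \<tau> * real (card I)))"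
proof -
  let ?O = "PiM U (\<lambda>_. std n)"
  define M where "M = real (card I)"
  have fI: "finite I" using U IU finite_subset by blast
  have M: "0 < M" using fI IU by (simp add: M_def card_gt_0_iff)
  define L where "L = exp (real n * (\<delta> - ln (1 - a\<^sup>2) / 2))"
  interpret S: prob_space "std n" by simp
  interpret O: prob_space ?O by (intro prob_space_PiM) simp
  interpret P: pair_sigma_finite ?O "std n" ..
  define F where "F v x = ennreal (max 0 (1 - coverage a n \<delta> I v x))" for v x
  have comp: "(\<lambda>v. v i) \<in> ?O \<rightarrow>\<^sub>M Rn n" if "i \<in> I" for i
  proof -
    have "(\<lambda>v. v i) \<in> ?O \<rightarrow>\<^sub>M std n" using that IU by (intro measurable_component_singleton) auto
    then show ?thesis by (simp only: measurable_cong_sets[OF refl sets_PiM_gauss[of "{..<n}" "\<lambda>_. 0" "\<lambda>_. 1"]])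
  qed
  have sndm: "snd \<in> ?O \<Otimes>\<^sub>M std n \<rightarrow>\<^sub>M Rn n"
    using measurable_snd[of ?O "std n"] by (simp only: measurable_cong_sets[OF refl sets_PiM_gauss[of "{..<n}" "\<lambda>_. 0" "\<lambda>_. 1"]])
  have Fm: "(\<lambda>z. F (fst z) (snd z)) \<in> borel_measurable (?O \<Otimes>\<^sub>M std n)"
    unfolding F_def
    by (intro measurable_compose[OF _ measurable_ennreal] borel_measurable_max borel_measurable_const borel_measurable_diff
        measurable_coverage[OF sndm] measurable_compose[OF measurable_fst comp])
  have eq: "ennreal (uncovered a n \<delta> I v) = (\<integral>\<^sup>+x. F v x \<partial>std n)" if v: "v \<in> space ?O" for v
  proof -
    have vi: "v i \<in> space (Rn n)" if "i \<in> I" for i using measurable_space[OF comp[OF that] v] .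
    have "(\<lambda>x. coverage a n \<delta> I v x) \<in> borel_measurable (Rn n)"
      using vi by (intro measurable_coverage measurable_ident_sets[OF refl] measurable_const)
    then have "integrable (std n) (\<lambda>x. max 0 (1 - coverage a n \<delta> I v x))"
      using coverage_nonneg[OF a] by (intro S.integrable_const_bound[where B=1] AE_I2) auto
    then show ?thesis unfolding F_def uncovered_def by (intro nn_integral_eq_integral[symmetric]) auto
  qed
  have Fm': "(\<lambda>v. \<integral>\<^sup>+x. F v x \<partial>std n) \<in> borel_measurable ?O"
    using S.borel_measurable_nn_integral_fst[OF Fm] by simp
  then show "(\<lambda>v. ennreal (uncovered a n \<delta> I v)) \<in> borel_measurable ?O"
    by (rule measurable_cong[THEN iffD2, rotated]) (rule eq)
  have "(\<integral>\<^sup>+v. ennreal (uncovered a n \<delta> I v) \<partial>?O) = (\<integral>\<^sup>+v. \<integral>\<^sup>+x. F v x \<partial>std n \<partial>?O)"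
    by (intro nn_integral_cong eq)
  also have "\<dots> = (\<integral>\<^sup>+x. \<integral>\<^sup>+v. F v x \<partial>?O \<partial>std n)"
    by (rule P.Fubini'[symmetric]) (use Fm in \<open>simp add: split_beta'\<close>)
  also have "\<dots> \<le> (\<integral>\<^sup>+x. (\<integral>\<^sup>+v. ennreal (lr a n x v - lrT a n \<delta> x v) \<partial>std n) + ennreal (\<tau> / 2 + L / (2 * \<tau> * M)) \<partial>std n)"
  proof (intro nn_integral_mono)
    fix x assume "x \<in> space (std n)"
    then have x: "x \<in> space (Rn n)" by (simp add: space_PiM)
    define m where "m = (\<integral>v. lrT a n \<delta> x v \<partial>std n)"
    note mb = integral_lrT(1-3)[OF a x, of \<delta>, folded m_def]
    have lm: "(\<lambda>v. lrT a n \<delta> x v) \<in> borel_measurable (Rn n)" "(\<lambda>v. lr a n x v) \<in> borel_measurable (Rn n)"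
      using x by (auto intro!: measurable_lrT measurable_lr measurable_ident_sets[OF refl])
    have i2: "integrable (std n) (\<lambda>v. (lrT a n \<delta> x v)\<^sup>2)"
    proof (rule S.integrable_const_bound[where B="L\<^sup>2"])
      show "AE v in std n. norm ((lrT a n \<delta> x v)\<^sup>2) \<le> L\<^sup>2"
        using lrT_bounds[OF a] by (intro AE_I2) (auto simp: L_def intro!: power_mono)
    qed (use lm in simp)
    \<comment> \<open>Here the truncation pays off: the square is at most the cap times the function
      itself, whose integral is at most 1.\<close>
    have v2: "(\<integral>v. (lrT a n \<delta> x v)\<^sup>2 \<partial>std n) \<le> L"
    proof -
      have "(\<integral>v. (lrT a n \<delta> x v)\<^sup>2 \<partial>std n) \<le> (\<integral>v. L * lrT a n \<delta> x v \<partial>std n)"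
      proof (rule integral_mono[OF i2])
        fix v show "(lrT a n \<delta> x v)\<^sup>2 \<le> L * lrT a n \<delta> x v"
          using lrT_bounds[OF a, of n \<delta> x v] unfolding power2_eq_square L_def by (intro mult_right_mono) auto
      qed (use mb in simp)
      also have "\<dots> = L * m" by (simp add: m_def)
      also have "\<dots> \<le> L" using mb(2) by (simp add: L_def)
      finally show ?thesis .
    qed
    define h where "h v = (lrT a n \<delta> x v - m) / M" for v
    have h1: "integrable (std n) h" "(\<integral>v. h v \<partial>std n) = 0"
      unfolding h_def using mb(1) by (simp_all add: S.prob_space m_def)
    have he: "(h v)\<^sup>2 = ((lrT a n \<delta> x v)\<^sup>2 - 2 * m * lrT a n \<delta> x v + m\<^sup>2) / M\<^sup>2" for v
      by (simp add: h_def power_divide power2_diff algebra_simps)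
    have h2: "integrable (std n) (\<lambda>v. (h v)\<^sup>2)"
      unfolding he using mb(1) i2 by simp
    have h3: "(\<integral>v. (h v)\<^sup>2 \<partial>std n) \<le> L / M\<^sup>2"
    proof -
      have "(\<integral>v. (h v)\<^sup>2 \<partial>std n) = ((\<integral>v. (lrT a n \<delta> x v)\<^sup>2 \<partial>std n) - 2 * m * m + m\<^sup>2) / M\<^sup>2"
        unfolding he using mb(1) i2 by (simp add: m_def S.prob_space)
      also have "\<dots> \<le> L / M\<^sup>2"
      proof (rule divide_right_mono)
        have "0 \<le> m * m" by simp
        then show "(\<integral>v. (lrT a n \<delta> x v)\<^sup>2 \<partial>std n) - 2 * m * m + m\<^sup>2 \<le> L"
          using v2 by (simp only: power2_eq_square)
      qed simp
      finally show ?thesis .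
    qed
    note sq = PiM_sum_square[OF U IU(1) prob_space_std h1 h2]
    have ce: "coverage a n \<delta> I v x - m = (\<Sum>i\<in>I. h (v i))" for v
      unfolding coverage_def h_def sum_divide_distrib[symmetric] sum_subtractf using M by (simp add: M_def field_simps)
    have pt: "max 0 (1 - coverage a n \<delta> I v x) \<le> (1 - m) + (\<tau> / 2 + (\<Sum>i\<in>I. h (v i))\<^sup>2 / (2 * \<tau>))" for v
    proof -
      define y where "y = \<bar>\<Sum>i\<in>I. h (v i)\<bar>"
      have "0 \<le> (\<tau> - y)\<^sup>2 / (2 * \<tau>)" using \<tau> by simp
      also have "\<dots> = \<tau> / 2 + y\<^sup>2 / (2 * \<tau>) - y" using \<tau> by (simp add: power2_eq_square field_simps)
      finally have "y \<le> \<tau> / 2 + (\<Sum>i\<in>I. h (v i))\<^sup>2 / (2 * \<tau>)" by (simp add: y_def)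
      moreover have "max 0 (1 - coverage a n \<delta> I v x) \<le> (1 - m) + y"
        using mb(2) ce[of v] by (simp add: y_def)
      ultimately show ?thesis by simp
    qed
    have "(\<integral>\<^sup>+v. F v x \<partial>?O) \<le> (\<integral>\<^sup>+v. ennreal ((1 - m) + (\<tau> / 2 + (\<Sum>i\<in>I. h (v i))\<^sup>2 / (2 * \<tau>))) \<partial>?O)"
      unfolding F_def by (intro nn_integral_mono ennreal_leI pt)
    also have "\<dots> = ennreal (\<integral>v. (1 - m) + (\<tau> / 2 + (\<Sum>i\<in>I. h (v i))\<^sup>2 / (2 * \<tau>)) \<partial>?O)"
      using sq(2) mb(2) \<tau> by (intro nn_integral_eq_integral) auto
    also have "(\<integral>v. (1 - m) + (\<tau> / 2 + (\<Sum>i\<in>I. h (v i))\<^sup>2 / (2 * \<tau>)) \<partial>?O) = (1 - m) + (\<tau> / 2 + (\<Sum>i\<in>I. \<integral>v. (h v)\<^sup>2 \<partial>std n) / (2 * \<tau>))"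
      using sq by (simp add: O.prob_space)
    also have "\<dots> \<le> (1 - m) + (\<tau> / 2 + L / (2 * \<tau> * M))"
    proof -
      have "(\<Sum>i\<in>I. \<integral>v. (h v)\<^sup>2 \<partial>std n) \<le> (\<Sum>i\<in>I. L / M\<^sup>2)" using h3 by (intro sum_mono)
      also have "\<dots> = L / M" using M by (simp add: M_def power2_eq_square)
      finally have "(\<Sum>i\<in>I. \<integral>v. (h v)\<^sup>2 \<partial>std n) / (2 * \<tau>) \<le> L / M / (2 * \<tau>)" using \<tau> by (intro divide_right_mono) auto
      then show ?thesis by (simp add: mult_ac)
    qed
    finally have "(\<integral>\<^sup>+v. F v x \<partial>?O) \<le> ennreal ((1 - m) + (\<tau> / 2 + L / (2 * \<tau> * M)))" by (simp add: ennreal_leI)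
    also have "\<dots> = ennreal (1 - m) + ennreal (\<tau> / 2 + L / (2 * \<tau> * M))"
      using mb(2) \<tau> M by (intro ennreal_plus) (auto simp: L_def)
    \<comment> \<open>By symmetry the full likelihood ratio integrates to 1 over the codeword as
      well, so \<open>1 - m\<close> is exactly what the truncation removes at
      \<open>x\<close>.\<close>
    also have "ennreal (1 - m) = (\<integral>\<^sup>+v. ennreal (lr a n x v - lrT a n \<delta> x v) \<partial>std n)"
    proof -
      have lr1: "(\<integral>\<^sup>+v. ennreal (lr a n x v) \<partial>std n) = 1"
        unfolding lr_commute[OF a, of n x] by (rule nn_integral_lr_one[OF a])
      have "integrable (std n) (\<lambda>v. lr a n x v)"
        using lm(2) lr1 lr_nonneg[OF a] by (intro integrableI_bounded) auto
      then have ilr: "integrable (std n) (\<lambda>v. lr a n x v)" "(\<integral>v. lr a n x v \<partial>std n) = 1"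
        using nn_integral_eq_integral[of "std n" "\<lambda>v. lr a n x v"] lr1 lr_nonneg[OF a] by (auto simp: ennreal_eq_1)
      have "(\<integral>\<^sup>+v. ennreal (lr a n x v - lrT a n \<delta> x v) \<partial>std n) = ennreal (\<integral>v. lr a n x v - lrT a n \<delta> x v \<partial>std n)"
        using ilr mb(1) lrT_bounds(3)[OF a] by (intro nn_integral_eq_integral) auto
      then show ?thesis using ilr mb(1) by (simp add: m_def)
    qed
    finally show "(\<integral>\<^sup>+v. F v x \<partial>?O) \<le> (\<integral>\<^sup>+v. ennreal (lr a n x v - lrT a n \<delta> x v) \<partial>std n) + ennreal (\<tau> / 2 + L / (2 * \<tau> * M))" .
  qed
  also have "\<dots> = (\<integral>\<^sup>+x. (\<integral>\<^sup>+v. ennreal (lr a n x v - lrT a n \<delta> x v) \<partial>std n) \<partial>std n) + ennreal (\<tau> / 2 + L / (2 * \<tau> * M))"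
  proof (subst nn_integral_add)
    have fs: "fst \<in> std n \<Otimes>\<^sub>M std n \<rightarrow>\<^sub>M Rn n" "snd \<in> std n \<Otimes>\<^sub>M std n \<rightarrow>\<^sub>M Rn n"
      using measurable_fst[of "std n" "std n"] measurable_snd[of "std n" "std n"]
      by (simp_all only: measurable_cong_sets[OF refl sets_PiM_gauss[of "{..<n}" "\<lambda>_. 0" "\<lambda>_. 1"]])
    have "(\<lambda>z. ennreal (lr a n (fst z) (snd z) - lrT a n \<delta> (fst z) (snd z))) \<in> borel_measurable (std n \<Otimes>\<^sub>M std n)"
      by (intro measurable_compose[OF _ measurable_ennreal] borel_measurable_diff measurable_lr measurable_lrT fs)
    from S.borel_measurable_nn_integral_fst[OF this]
    show "(\<lambda>x. \<integral>\<^sup>+v. ennreal (lr a n x v - lrT a n \<delta> x v) \<partial>std n) \<in> borel_measurable (std n)" by simp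
  qed (simp_all add: S.emeasure_space_1)
  also have "\<dots> \<le> ennreal (4 / (real n * \<delta>\<^sup>2)) + ennreal (\<tau> / 2 + L / (2 * \<tau> * M))"
    by (intro add_right_mono atypical_mass a \<delta> n)
  also have "\<dots> = ennreal (4 / (real n * \<delta>\<^sup>2) + (\<tau> / 2 + L / (2 * \<tau> * M)))"
    using \<tau> M by (intro ennreal_plus[symmetric]) (auto simp: L_def)
  finally show "(\<integral>\<^sup>+v. ennreal (uncovered a n \<delta> I v) \<partial>?O) \<le>
      ennreal (4 / (real n * \<delta>\<^sup>2) + \<tau> / 2 + exp (real n * (\<delta> - ln (1 - a\<^sup>2) / 2)) / (2 * \<tau> * real (card I)))"
    by (simp add: L_def M_def add.assoc)
qed

text \<open>One codebook has to serve three purposes: the part of each seed covers the source, on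
  average over the seeds; the whole covers the output; and the codewords have squared norms near
  \<open>n\<close>. All three errors are bounded in expectation, so a bound on the sum of the
  expectations is met by some outcome for all of them together.\<close>

lemma good_codebook:
  assumes a: "a\<^sup>2 < 1" and b: "b\<^sup>2 < 1" and \<delta>: "0 < \<delta>" and n: "1 \<le> n" and NJ: "1 \<le> NJ" and NK: "1 \<le> NK"
    and C: "2 * (4 / (real n * \<delta>\<^sup>2) + \<delta> / 2) + exp (real n * (\<delta> - ln (1 - a\<^sup>2) / 2)) / (2 * \<delta> * real NJ)
       + exp (real n * (\<delta> - ln (1 - b\<^sup>2) / 2)) / (2 * \<delta> * (real NK * real NJ)) + (\<delta> / 2 + 1 / (real n * \<delta>)) < C"
  shows "\<exists>v. (\<forall>u\<in>{..<NK} \<times> {..<NJ}. v u \<in> space (Rn n)) \<and>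
    (\<Sum>k<NK. uncovered a n \<delta> ({k} \<times> {..<NJ}) v) / real NK + uncovered b n \<delta> ({..<NK} \<times> {..<NJ}) v
      + (\<Sum>u\<in>{..<NK} \<times> {..<NJ}. \<bar>sqn n (v u) - real n\<bar>) / (real n * (real NK * real NJ)) < C"
proof -
  define U where "U = {..<NK} \<times> {..<NJ}"
  let ?O = "PiM U (\<lambda>_. std n)"
  interpret S: prob_space "std n" by simp
  interpret O: prob_space ?O by (intro prob_space_PiM) simp
  have U: "finite U" "U \<noteq> {}" "real (card U) = real NK * real NJ" using NJ NK by (auto simp: U_def lessThan_empty_iff)
  define Ba where "Ba = 4 / (real n * \<delta>\<^sup>2) + \<delta> / 2 + exp (real n * (\<delta> - ln (1 - a\<^sup>2) / 2)) / (2 * \<delta> * real NJ)"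
  define Bb where "Bb = 4 / (real n * \<delta>\<^sup>2) + \<delta> / 2 + exp (real n * (\<delta> - ln (1 - b\<^sup>2) / 2)) / (2 * \<delta> * (real NK * real NJ))"
  define Bc where "Bc = \<delta> / 2 + 1 / (real n * \<delta>)"
  have B0: "0 \<le> Ba" "0 \<le> Bb" "0 \<le> Bc" using \<delta> by (auto simp: Ba_def Bb_def Bc_def)
  have unc0: "0 \<le> uncovered a n \<delta> I v" for a and I :: "(nat \<times> nat) set" and v
    unfolding uncovered_def by (intro integral_nonneg_AE) auto
  define f1 where "f1 v = (\<Sum>k<NK. uncovered a n \<delta> ({k} \<times> {..<NJ}) v) / real NK" for v
  define f2 where "f2 v = uncovered b n \<delta> U v" for v
  define f3 where "f3 v = (\<Sum>u\<in>U. \<bar>sqn n (v u) - real n\<bar>) / (real n * (real NK * real NJ))" for v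
  have f0: "0 \<le> f1 v" "0 \<le> f2 v" "0 \<le> f3 v" for v
    unfolding f1_def f2_def f3_def using unc0 by (auto intro!: divide_nonneg_nonneg sum_nonneg)
  have Ik: "{k} \<times> {..<NJ} \<subseteq> U" "{k} \<times> {..<NJ} \<noteq> {}" "real (card ({k} \<times> {..<NJ})) = real NJ" if "k < NK" for k
    using that NJ by (auto simp: U_def lessThan_empty_iff)
  have e1: "ennreal (f1 v) = (\<Sum>k<NK. ennreal (1 / real NK) * ennreal (uncovered a n \<delta> ({k} \<times> {..<NJ}) v))" for v
  proof -
    have "(\<Sum>k<NK. ennreal (1 / real NK) * ennreal (uncovered a n \<delta> ({k} \<times> {..<NJ}) v)) = (\<Sum>k<NK. ennreal (1 / real NK * uncovered a n \<delta> ({k} \<times> {..<NJ}) v))"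
      using unc0 by (intro sum.cong refl ennreal_mult[symmetric]) auto
    also have "\<dots> = ennreal (\<Sum>k<NK. 1 / real NK * uncovered a n \<delta> ({k} \<times> {..<NJ}) v)"
      using unc0 by (intro sum_ennreal) auto
    finally show ?thesis by (simp add: f1_def sum_divide_distrib)
  qed
  have m1: "(\<lambda>v. ennreal (f1 v)) \<in> borel_measurable ?O"
    unfolding e1 using nn_integral_uncovered(1)[OF a \<delta> \<delta> n U(1) Ik(1,2)]
    by (intro borel_measurable_sum borel_measurable_times_ennreal borel_measurable_const) auto
  have i1: "(\<integral>\<^sup>+v. ennreal (f1 v) \<partial>?O) \<le> ennreal Ba"
  proof -
    have "(\<integral>\<^sup>+v. ennreal (f1 v) \<partial>?O) = (\<Sum>k<NK. \<integral>\<^sup>+v. ennreal (1 / real NK) * ennreal (uncovered a n \<delta> ({k} \<times> {..<NJ}) v) \<partial>?O)"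
      unfolding e1 using nn_integral_uncovered(1)[OF a \<delta> \<delta> n U(1) Ik(1,2)]
      by (intro nn_integral_sum borel_measurable_times_ennreal borel_measurable_const) auto
    also have "\<dots> \<le> (\<Sum>k<NK. ennreal (1 / real NK) * ennreal Ba)"
    proof (intro sum_mono)
      fix k assume k: "k \<in> {..<NK}"
      then have k': "k < NK" by simp
      show "(\<integral>\<^sup>+v. ennreal (1 / real NK) * ennreal (uncovered a n \<delta> ({k} \<times> {..<NJ}) v) \<partial>?O) \<le> ennreal (1 / real NK) * ennreal Ba"
        using nn_integral_uncovered(2)[OF a \<delta> \<delta> n U(1) Ik(1,2)[OF k']] nn_integral_uncovered(1)[OF a \<delta> \<delta> n U(1) Ik(1,2)[OF k']]
        unfolding Ik(3)[OF k'] Ba_def[symmetric] by (subst nn_integral_cmult) (auto intro!: mult_left_mono)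
    qed
    also have "\<dots> = ennreal (\<Sum>k<NK. 1 / real NK * Ba)"
      using B0 by (subst sum_ennreal[symmetric]) (auto simp: ennreal_mult[symmetric])
    also have "(\<Sum>k<NK. 1 / real NK * Ba) = Ba" using NK by simp
    finally show ?thesis .
  qed
  have m2: "(\<lambda>v. ennreal (f2 v)) \<in> borel_measurable ?O"
    unfolding f2_def by (rule nn_integral_uncovered(1)[OF b \<delta> \<delta> n U(1) subset_refl U(2)])
  have i2: "(\<integral>\<^sup>+v. ennreal (f2 v) \<partial>?O) \<le> ennreal Bb"
    using nn_integral_uncovered(2)[OF b \<delta> \<delta> n U(1) subset_refl U(2)] unfolding U(3) f2_def Bb_def .
  have comp: "(\<lambda>x. \<bar>sqn n x - real n\<bar>) \<in> borel_measurable (std n)" using std_norm_deviation(1) by (rule borel_measurable_integrable)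
  have u3: "integrable ?O (\<lambda>v. \<bar>sqn n (v u) - real n\<bar>)" "(\<integral>v. \<bar>sqn n (v u) - real n\<bar> \<partial>?O) \<le> real n * (\<delta> / 2) + 1 / \<delta>" if "u \<in> U" for u
    using integral_PiM_component[OF prob_space_std that comp] std_norm_deviation(1)[of n] std_norm_deviation(2)[of \<delta> n] \<delta> n by auto
  have f3i: "integrable ?O f3" unfolding f3_def using u3(1) by simp
  have i3: "(\<integral>\<^sup>+v. ennreal (f3 v) \<partial>?O) \<le> ennreal Bc"
  proof -
    have "(\<integral>\<^sup>+v. ennreal (f3 v) \<partial>?O) = ennreal (\<integral>v. f3 v \<partial>?O)"
      using f3i f0 by (intro nn_integral_eq_integral) auto
    also have "(\<integral>v. f3 v \<partial>?O) = (\<Sum>u\<in>U. \<integral>v. \<bar>sqn n (v u) - real n\<bar> \<partial>?O) / (real n * (real NK * real NJ))"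
      unfolding f3_def using u3(1) by simp
    also have "\<dots> \<le> (\<Sum>u\<in>U. real n * (\<delta> / 2) + 1 / \<delta>) / (real n * (real NK * real NJ))"
      using u3(2) by (intro divide_right_mono sum_mono) auto
    also have "\<dots> = Bc"
    proof -
      define N where "N = real NK * real NJ"
      have N: "0 < N" using NJ NK by (simp add: N_def)
      have "(\<Sum>u\<in>U. real n * (\<delta> / 2) + 1 / \<delta>) = N * (real n * (\<delta> / 2) + 1 / \<delta>)" using U(3) by (simp add: N_def)
      then show ?thesis using N n \<delta> unfolding N_def[symmetric] Bc_def by (simp add: field_simps)
    qed
    finally show ?thesis by (simp add: ennreal_leI)
  qed
  have "\<exists>v\<in>space ?O. f1 v + f2 v + f3 v < C"
  proof (rule ccontr)
    assume "\<not> ?thesis"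
    then have ge: "C \<le> f1 v + f2 v + f3 v" if "v \<in> space ?O" for v using that by (auto simp: not_less)
    have "ennreal C = (\<integral>\<^sup>+v. ennreal C \<partial>?O)" by (simp add: O.emeasure_space_1)
    also have "\<dots> \<le> (\<integral>\<^sup>+v. ennreal (f1 v) + ennreal (f2 v) + ennreal (f3 v) \<partial>?O)"
      using ge f0 by (intro nn_integral_mono) (auto simp: ennreal_plus[symmetric] simp del: ennreal_plus intro!: ennreal_leI)
    also have "\<dots> = (\<integral>\<^sup>+v. ennreal (f1 v) \<partial>?O) + (\<integral>\<^sup>+v. ennreal (f2 v) \<partial>?O) + (\<integral>\<^sup>+v. ennreal (f3 v) \<partial>?O)"
      using m1 m2 f3i by (simp add: nn_integral_add)
    also have "\<dots> \<le> ennreal Ba + ennreal Bb + ennreal Bc" by (intro add_mono i1 i2 i3)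
    also have "\<dots> = ennreal (Ba + Bb + Bc)" using B0 by simp
    finally have "C \<le> Ba + Bb + Bc" using B0 by (subst (asm) ennreal_le_iff) auto
    moreover have "Ba + Bb + Bc < C" using C by (simp add: Ba_def Bb_def Bc_def)
    ultimately show False by simp
  qed
  then obtain v where v: "v \<in> space ?O" "f1 v + f2 v + f3 v < C" by auto
  have "v u \<in> space (Rn n)" if "u \<in> U" for u using v(1) that by (auto simp: space_PiM PiE_iff)
  then show ?thesis using v(2) by (intro exI[of _ v]) (auto simp: f1_def f2_def f3_def U_def)
qed

text \<open>The centroids \<open>g\<close>, \<open>g'\<close> of two quantizers with common codewords \<open>W\<close> are almost \<open>a W\<close> and \<open>b W\<close>:
  the energy bound on \<open>g\<close> turns the distortion of the quantizer into smallness of \<open>g - a W\<close>.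
  No control of the norm of \<open>W\<close> is needed because it cancels.\<close>

lemma correlation_from_costs:
  fixes g g' W :: "'i \<Rightarrow> real"
  assumes a: "0 < a" and b: "0 < b" and n: "0 < n"
    and X: "n - 2 * a * (\<Sum>i\<in>S. g i * W i) + a\<^sup>2 * (\<Sum>i\<in>S. (W i)\<^sup>2) \<le> n * ((1 - a\<^sup>2) + e)"
    and Z: "n - 2 * b * (\<Sum>i\<in>S. g' i * W i) + b\<^sup>2 * (\<Sum>i\<in>S. (W i)\<^sup>2) \<le> n * ((1 - b\<^sup>2) + e)"
    and gX: "(\<Sum>i\<in>S. (g i)\<^sup>2) \<le> n * A" and gZ: "(\<Sum>i\<in>S. (g' i)\<^sup>2) \<le> n * B"
  shows "n * (a * b - e * a / (2 * b) - e * b / (2 * a) - sqrt ((A - a\<^sup>2 + e) * (B - b\<^sup>2 + e))) \<le> (\<Sum>i\<in>S. g i * g' i)"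
proof -
  define p q s where "p = (\<Sum>i\<in>S. g i * W i)" and "q = (\<Sum>i\<in>S. g' i * W i)" and "s = (\<Sum>i\<in>S. (W i)\<^sup>2)"
  have dev: "(\<Sum>i\<in>S. (h i - c * W i)\<^sup>2) = (\<Sum>i\<in>S. (h i)\<^sup>2) - 2 * c * (\<Sum>i\<in>S. h i * W i) + c\<^sup>2 * (\<Sum>i\<in>S. (W i)\<^sup>2)" for h c
    by (simp add: power2_diff sum.distrib sum_subtractf sum_distrib_left power_mult_distrib mult_ac)
  have d1: "(\<Sum>i\<in>S. (g i - a * W i)\<^sup>2) \<le> n * (A - a\<^sup>2 + e)"
    unfolding dev using X gX by (simp add: algebra_simps)
  have d2: "(\<Sum>i\<in>S. (g' i - b * W i)\<^sup>2) \<le> n * (B - b\<^sup>2 + e)"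
    unfolding dev using Z gZ by (simp add: algebra_simps)
  have cs: "- (\<Sum>i\<in>S. (g i - a * W i) * (g' i - b * W i)) \<le> n * sqrt ((A - a\<^sup>2 + e) * (B - b\<^sup>2 + e))"
  proof -
    have "(\<Sum>i\<in>S. (g i - a * W i) * (g' i - b * W i))\<^sup>2 \<le> (\<Sum>i\<in>S. (g i - a * W i)\<^sup>2) * (\<Sum>i\<in>S. (g' i - b * W i)\<^sup>2)"
      by (rule Cauchy_Schwarz_ineq_sum)
    also have "\<dots> \<le> (n * (A - a\<^sup>2 + e)) * (n * (B - b\<^sup>2 + e))"
      using d1 d2 by (intro mult_mono) (auto intro: sum_nonneg order_trans[OF sum_nonneg d1])
    also have "\<dots> = n\<^sup>2 * ((A - a\<^sup>2 + e) * (B - b\<^sup>2 + e))" by (simp add: power2_eq_square mult_ac)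
    finally have "\<bar>\<Sum>i\<in>S. (g i - a * W i) * (g' i - b * W i)\<bar> \<le> sqrt (n\<^sup>2 * ((A - a\<^sup>2 + e) * (B - b\<^sup>2 + e)))"
      using real_le_rsqrt[of "\<bar>\<Sum>i\<in>S. (g i - a * W i) * (g' i - b * W i)\<bar>"] by simp
    then show ?thesis using n by (simp add: real_sqrt_mult abs_le_iff)
  qed
  \<comment> \<open>In this expansion the cost bounds contribute half of \<open>a * b * s\<close>
    through \<open>b * p\<close> and the other half through \<open>a * q\<close>, which removes
    \<open>s\<close>.\<close>
  have e: "(\<Sum>i\<in>S. g i * g' i) = (\<Sum>i\<in>S. (g i - a * W i) * (g' i - b * W i)) + b * p + a * q - a * b * s"
    unfolding p_def q_def s_def sum_distrib_left sum.distrib[symmetric] sum_subtractf[symmetric]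
    by (intro sum.cong refl) (simp add: power2_eq_square algebra_simps)
  have "b * (n * (a\<^sup>2 - e) + a\<^sup>2 * s) \<le> b * (2 * a * p)"
    using X b unfolding p_def s_def by (intro mult_left_mono) (auto simp: algebra_simps)
  then have bp: "b / (2 * a) * (n * (a\<^sup>2 - e) + a\<^sup>2 * s) \<le> b * p" using a by (simp add: field_simps)
  have "a * (n * (b\<^sup>2 - e) + b\<^sup>2 * s) \<le> a * (2 * b * q)"
    using Z a unfolding q_def s_def by (intro mult_left_mono) (auto simp: algebra_simps)
  then have aq: "a / (2 * b) * (n * (b\<^sup>2 - e) + b\<^sup>2 * s) \<le> a * q" using b by (simp add: field_simps)
  have "b / (2 * a) * (n * (a\<^sup>2 - e) + a\<^sup>2 * s) + a / (2 * b) * (n * (b\<^sup>2 - e) + b\<^sup>2 * s) - a * b * s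
    = n * (a * b - e * a / (2 * b) - e * b / (2 * a))"
    using a b by (simp add: field_simps power2_eq_square)
  then show ?thesis using bp aq cs unfolding e right_diff_distrib by linarith
qed

section \<open>Pairs of quantizers with a common index\<close>

lemma integral_weight_sqd:
  fixes \<omega> :: "(nat \<Rightarrow> real) \<Rightarrow> real"
  assumes w: "\<omega> \<in> borel_measurable (Rn n)" "\<And>x. 0 \<le> \<omega> x" "\<And>x. \<omega> x \<le> 1"
  shows "(\<integral>y. \<omega> y * sqd n y (\<lambda>t. a * V t) \<partial>std n) =
    (\<Sum>t<n. (\<integral>y. \<omega> y * (y t)\<^sup>2 \<partial>std n) - 2 * a * ((\<integral>y. \<omega> y * y t \<partial>std n) * V t) + a\<^sup>2 * ((\<integral>y. \<omega> y \<partial>std n) * (V t)\<^sup>2))"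
proof -
  interpret prob_space "std n" by simp
  have i: "integrable (std n) (\<lambda>y. \<omega> y * f y)" if "integrable (std n) f" for f :: "_ \<Rightarrow> real"
    by (rule integrable_weight_mult) (use w that in auto)
  have i0: "integrable (std n) \<omega>" using i[of "\<lambda>_. 1"] by simp
  have "(\<integral>y. \<omega> y * sqd n y (\<lambda>t. a * V t) \<partial>std n) =
    (\<integral>y. (\<Sum>t<n. \<omega> y * (y t)\<^sup>2 - 2 * a * V t * (\<omega> y * y t) + a\<^sup>2 * (V t)\<^sup>2 * \<omega> y) \<partial>std n)"
    unfolding sqd_def sum_distrib_left
    by (intro Bochner_Integration.integral_cong refl sum.cong) (simp add: power2_diff power_mult_distrib algebra_simps)
  also have "\<dots> = (\<Sum>t<n. \<integral>y. \<omega> y * (y t)\<^sup>2 - 2 * a * V t * (\<omega> y * y t) + a\<^sup>2 * (V t)\<^sup>2 * \<omega> y \<partial>std n)"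
    using i i0 std_component_moments by (intro Bochner_Integration.integral_sum) auto
  also have "\<dots> = (\<Sum>t<n. (\<integral>y. \<omega> y * (y t)\<^sup>2 \<partial>std n) - 2 * a * ((\<integral>y. \<omega> y * y t \<partial>std n) * V t) + a\<^sup>2 * ((\<integral>y. \<omega> y \<partial>std n) * (V t)\<^sup>2))"
  proof (intro sum.cong refl)
    fix t assume "t \<in> {..<n}"
    then have "integrable (std n) (\<lambda>y. \<omega> y * (y t)\<^sup>2)" "integrable (std n) (\<lambda>y. \<omega> y * y t)"
      using i std_component_moments by auto
    then have "(\<integral>y. \<omega> y * (y t)\<^sup>2 - 2 * a * V t * (\<omega> y * y t) + a\<^sup>2 * (V t)\<^sup>2 * \<omega> y \<partial>std n) =
      (\<integral>y. \<omega> y * (y t)\<^sup>2 \<partial>std n) - 2 * a * V t * (\<integral>y. \<omega> y * y t \<partial>std n) + a\<^sup>2 * (V t)\<^sup>2 * (\<integral>y. \<omega> y \<partial>std n)"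
      using i0 by simp
    then show "(\<integral>y. \<omega> y * (y t)\<^sup>2 - 2 * a * V t * (\<omega> y * y t) + a\<^sup>2 * (V t)\<^sup>2 * \<omega> y \<partial>std n) =
      (\<integral>y. \<omega> y * (y t)\<^sup>2 \<partial>std n) - 2 * a * ((\<integral>y. \<omega> y * y t \<partial>std n) * V t) + a\<^sup>2 * ((\<integral>y. \<omega> y \<partial>std n) * (V t)\<^sup>2)"
      by (simp only: mult_ac)
  qed
  finally show ?thesis .
qed

text \<open>\<open>w\<close> cuts the source space anew for every seed, while \<open>w'\<close> is a
  single partition of the output space over all pairs of seed and message. After division of
  \<open>w\<close> by \<open>NK\<close> both give each pair the same mass, which is what allows the
  gluing.\<close>

definition quantizers :: "nat \<Rightarrow> nat \<Rightarrow> nat \<Rightarrow> (nat \<Rightarrow> nat \<Rightarrow> (nat \<Rightarrow> real) \<Rightarrow> real) \<Rightarrow> (nat \<Rightarrow> nat \<Rightarrow> (nat \<Rightarrow> real) \<Rightarrow> real) \<Rightarrow> bool" where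
  "quantizers n NJ NK w w' \<longleftrightarrow>
    (\<forall>k<NK. \<forall>j<NJ. w k j \<in> borel_measurable (Rn n) \<and> (\<forall>x. 0 \<le> w k j x) \<and> (\<integral>x. w k j x \<partial>std n) = 1 / real NJ) \<and>
    (\<forall>k<NK. \<forall>x. (\<Sum>j<NJ. w k j x) = 1) \<and>
    (\<forall>k<NK. \<forall>j<NJ. w' k j \<in> borel_measurable (Rn n) \<and> (\<forall>x. 0 \<le> w' k j x) \<and> (\<integral>x. w' k j x \<partial>std n) = 1 / (real NK * real NJ)) \<and>
    (\<forall>x. (\<Sum>k<NK. \<Sum>j<NJ. w' k j x) = 1)"

text \<open>The excess \<open>e\<close> measures how far both quantizers are from optimal. The
  energy bounds that make it conclusive come from the converse, with \<open>NJ\<close> cells per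
  seed on the source side and \<open>NK * NJ\<close> cells on the output side.\<close>

lemma quantizer_correlation:
  assumes q: "quantizers n NJ NK w w'" and n: "1 \<le> n" and NJ: "1 \<le> NJ" and NK: "1 \<le> NK"
    and RJ: "ln (real NJ) / real n \<le> R" and RK: "ln (real NK) / real n \<le> Rc"
    and a: "0 < a" and b: "0 < b"
    and costX: "(\<Sum>k<NK. \<Sum>j<NJ. \<integral>x. w k j x * sqd n x (\<lambda>t. a * v (k, j) t) \<partial>std n) / real NK \<le> real n * ((1 - a\<^sup>2) + e)"
    and costZ: "(\<Sum>k<NK. \<Sum>j<NJ. \<integral>x. w' k j x * sqd n x (\<lambda>t. b * v (k, j) t) \<partial>std n) \<le> real n * ((1 - b\<^sup>2) + e)"
  shows "real n * (a * b - e * a / (2 * b) - e * b / (2 * a) - sqrt ((1 - exp (-2 * R) - a\<^sup>2 + e) * (1 - exp (-2 * (R + Rc)) - b\<^sup>2 + e)))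
    \<le> (\<Sum>k<NK. \<Sum>j<NJ. \<Sum>t<n. real NJ * ((\<integral>x. w k j x * x t \<partial>std n) * (\<integral>x. w' k j x * x t \<partial>std n)))"
proof -
  define U where "U = {..<NK} \<times> {..<NJ}"
  define N where "N = real NK * real NJ"
  have N: "0 < N" using NJ NK by (simp add: N_def)
  have U: "finite U" "U \<noteq> {}" "real (card U) = N" using NJ NK by (auto simp: U_def N_def lessThan_empty_iff)
  define x1 where "x1 u = (\<lambda>y. w (fst u) (snd u) y / real NK)" for u
  define z1 where "z1 u = w' (fst u) (snd u)" for u
  interpret prob_space "std n" by simp
  have w: "w k j \<in> borel_measurable (Rn n)" "0 \<le> w k j x" "(\<integral>x. w k j x \<partial>std n) = 1 / real NJ" if "k < NK" "j < NJ" for k j x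
    using q that by (auto simp: quantizers_def)
  have w1: "(\<Sum>j<NJ. w k j x) = 1" if "k < NK" for k x using q that by (auto simp: quantizers_def)
  have wle: "w k j x \<le> 1" if "k < NK" "j < NJ" for k j x
    using member_le_sum[of j "{..<NJ}" "\<lambda>j. w k j x"] w w1 that by auto
  have x1: "x1 u \<in> borel_measurable (Rn n)" "0 \<le> x1 u x" "x1 u x \<le> 1" "(\<integral>x. x1 u x \<partial>std n) = 1 / N" if "u \<in> U" for u x
  proof -
    have u: "fst u < NK" "snd u < NJ" using that by (auto simp: U_def)
    show "x1 u \<in> borel_measurable (Rn n)" unfolding x1_def using w(1)[OF u] by simp
    show "0 \<le> x1 u x" unfolding x1_def using w(2)[OF u] by simp
    have "w (fst u) (snd u) x \<le> real NK" using wle[OF u, of x] NK by (simp add: order_trans)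
    then show "x1 u x \<le> 1" using NK by (simp add: x1_def)
    show "(\<integral>x. x1 u x \<partial>std n) = 1 / N" unfolding x1_def using w(3)[OF u] by (simp add: N_def)
  qed
  have xs: "(\<Sum>u\<in>U. x1 u y) = 1" for y
    unfolding U_def sum_Times x1_def using w1 NK by (simp add: sum_divide_distrib[symmetric])
  have z: "z1 u \<in> borel_measurable (Rn n)" "0 \<le> z1 u x" "(\<integral>x. z1 u x \<partial>std n) = 1 / N" if "u \<in> U" for u x
    using q that by (auto simp: quantizers_def z1_def U_def N_def)
  have zs: "(\<Sum>u\<in>U. z1 u y) = 1" for y
    unfolding U_def sum_Times z1_def using q by (simp add: quantizers_def)
  have z1: "z1 u x \<le> 1" if "u \<in> U" for u x
    using member_le_sum[of u U "\<lambda>u. z1 u x"] z zs U that by auto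
  define m where "m i = (\<integral>x. x1 (fst i) x * x (snd i) \<partial>std n)" for i
  define m' where "m' i = (\<integral>x. z1 (fst i) x * x (snd i) \<partial>std n)" for i
  define S where "S = U \<times> {..<n}"
  \<comment> \<open>\<open>m i\<close> is a centroid times the cell mass \<open>1 / N\<close>, so
    \<open>sqrt N * m i\<close> is the centroid times the root of the mass. The codewords in
    \<open>W\<close> get the same root, and plain sums of squares become energies.\<close>
  define g where "g i = sqrt N * m i" for i
  define g' where "g' i = sqrt N * m' i" for i
  define W where "W i = v (fst i) (snd i) / sqrt N" for i
  have gW: "g i * W i = m i * v (fst i) (snd i)" "g' i * W i = m' i * v (fst i) (snd i)"
    "(W i)\<^sup>2 = 1 / N * (v (fst i) (snd i))\<^sup>2" "(g i)\<^sup>2 = (m i)\<^sup>2 / (1 / N)" "(g' i)\<^sup>2 = (m' i)\<^sup>2 / (1 / N)" "g i * g' i = N * (m i * m' i)" for i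
  proof -
    have "g i * g' i = (sqrt N * sqrt N) * (m i * m' i)" unfolding g_def g'_def by (simp only: mult_ac)
    then show "g i * g' i = N * (m i * m' i)" using N by simp
  qed (use N in \<open>simp_all add: g_def g'_def W_def power_mult_distrib power_divide\<close>)
  have expand: "(\<Sum>u\<in>U. \<integral>y. f u y * sqd n y (\<lambda>t. c * v u t) \<partial>std n) =
      real n - 2 * c * (\<Sum>i\<in>S. (\<integral>x. f (fst i) x * x (snd i) \<partial>std n) * v (fst i) (snd i)) + c\<^sup>2 * (\<Sum>i\<in>S. 1 / N * (v (fst i) (snd i))\<^sup>2)"
    if f: "\<And>u. u \<in> U \<Longrightarrow> f u \<in> borel_measurable (Rn n)" "\<And>u y. u \<in> U \<Longrightarrow> 0 \<le> f u y" "\<And>u y. u \<in> U \<Longrightarrow> f u y \<le> 1"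
      "\<And>u. u \<in> U \<Longrightarrow> (\<integral>x. f u x \<partial>std n) = 1 / N" "\<And>y. (\<Sum>u\<in>U. f u y) = 1" for f :: "_ \<Rightarrow> _ \<Rightarrow> real" and c
  proof -
    have "(\<Sum>u\<in>U. \<integral>y. f u y * sqd n y (\<lambda>t. c * v u t) \<partial>std n) = (\<Sum>u\<in>U. \<Sum>t<n. (\<integral>y. f u y * (y t)\<^sup>2 \<partial>std n)
      - 2 * c * ((\<integral>y. f u y * y t \<partial>std n) * v u t) + c\<^sup>2 * (1 / N * (v u t)\<^sup>2))"
      using integral_weight_sqd[OF f(1,2,3)] f(4) by (intro sum.cong refl) auto
    also have "\<dots> = real n - 2 * c * (\<Sum>u\<in>U. \<Sum>t<n. (\<integral>y. f u y * y t \<partial>std n) * v u t) + c\<^sup>2 * (\<Sum>u\<in>U. \<Sum>t<n. 1 / N * (v u t)\<^sup>2)"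
    proof -
      have "(\<Sum>u\<in>U. \<Sum>t<n. \<integral>y. f u y * (y t)\<^sup>2 \<partial>std n) = real n"
        by (rule sum_weighted_second_moments) (use U(1) f in auto)
      then show ?thesis unfolding sum.distrib sum_subtractf sum_distrib_left[symmetric] by simp
    qed
    finally show ?thesis by (simp add: S_def sum_Times)
  qed
  have X: "real n - 2 * a * (\<Sum>i\<in>S. g i * W i) + a\<^sup>2 * (\<Sum>i\<in>S. (W i)\<^sup>2) \<le> real n * ((1 - a\<^sup>2) + e)"
  proof -
    have "real n - 2 * a * (\<Sum>i\<in>S. g i * W i) + a\<^sup>2 * (\<Sum>i\<in>S. (W i)\<^sup>2) = (\<Sum>u\<in>U. \<integral>y. x1 u y * sqd n y (\<lambda>t. a * v u t) \<partial>std n)"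
      unfolding gW m_def by (rule expand[symmetric, OF x1 xs])
    also have "\<dots> = (\<Sum>k<NK. \<Sum>j<NJ. \<integral>x. w k j x * sqd n x (\<lambda>t. a * v (k, j) t) \<partial>std n) / real NK"
      unfolding U_def sum_Times x1_def by (simp add: sum_divide_distrib)
    finally show ?thesis using costX by simp
  qed
  have Z: "real n - 2 * b * (\<Sum>i\<in>S. g' i * W i) + b\<^sup>2 * (\<Sum>i\<in>S. (W i)\<^sup>2) \<le> real n * ((1 - b\<^sup>2) + e)"
  proof -
    have "real n - 2 * b * (\<Sum>i\<in>S. g' i * W i) + b\<^sup>2 * (\<Sum>i\<in>S. (W i)\<^sup>2) = (\<Sum>u\<in>U. \<integral>y. z1 u y * sqd n y (\<lambda>t. b * v u t) \<partial>std n)"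
      unfolding gW m'_def by (rule expand[symmetric, OF z(1,2) z1 z(3) zs])
    also have "\<dots> = (\<Sum>k<NK. \<Sum>j<NJ. \<integral>x. w' k j x * sqd n x (\<lambda>t. b * v (k, j) t) \<partial>std n)"
      unfolding U_def sum_Times z1_def by simp
    finally show ?thesis using costZ by simp
  qed
  have gX: "(\<Sum>i\<in>S. (g i)\<^sup>2) \<le> real n * (1 - exp (-2 * R))"
  proof -
    have "(\<Sum>i\<in>S. (g i)\<^sup>2) = (\<Sum>u\<in>U. \<Sum>t<n. (\<integral>x. x1 u x * x t \<partial>std n)\<^sup>2 / (\<integral>x. x1 u x \<partial>std n))"
      unfolding gW m_def S_def sum_Times using x1(4) by (intro sum.cong refl) auto
    also have "\<dots> = (\<Sum>k<NK. \<Sum>j<NJ. \<Sum>t<n. (\<integral>y. w k j y / real NK * y t \<partial>std n)\<^sup>2 / (\<integral>y. w k j y / real NK \<partial>std n))"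
      unfolding U_def sum_Times x1_def by simp
    also have "\<dots> \<le> real n * (1 - exp (-2 * R))"
      using w w1 by (intro encoder_energy[OF n NJ NK RJ]) auto
    finally show ?thesis .
  qed
  have gZ: "(\<Sum>i\<in>S. (g' i)\<^sup>2) \<le> real n * (1 - exp (-2 * (R + Rc)))"
  proof -
    have "(\<Sum>i\<in>S. (g' i)\<^sup>2) = (\<Sum>u\<in>U. \<Sum>t<n. (\<integral>x. z1 u x * x t \<partial>std n)\<^sup>2 / (\<integral>x. z1 u x \<partial>std n))"
      unfolding gW m'_def S_def sum_Times using z(3) by (intro sum.cong refl) auto
    also have "\<dots> \<le> real n - real n * real (card U) powr (- 2 / real n)"
      using z zs by (intro gaussian_centroid_energy U n) auto
    also have "\<dots> \<le> real n * (1 - exp (-2 * (R + Rc)))"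
    proof -
      have "ln N = ln (real NK) + ln (real NJ)" using NJ NK by (simp add: N_def ln_mult)
      then have "ln N / real n \<le> R + Rc" using RJ RK by (simp add: add_divide_distrib)
      then have "ln N * (2 / real n) \<le> 2 * (R + Rc)" using n by (simp add: field_simps)
      then have "exp (-2 * (R + Rc)) \<le> N powr (- 2 / real n)" using N by (simp add: powr_def mult.commute)
      then have "real n * exp (-2 * (R + Rc)) \<le> real n * N powr (- 2 / real n)" by (intro mult_left_mono) auto
      then show ?thesis unfolding U(3) right_diff_distrib by simp
    qed
    finally show ?thesis .
  qed
  have "real n * (a * b - e * a / (2 * b) - e * b / (2 * a) - sqrt ((1 - exp (-2 * R) - a\<^sup>2 + e) * (1 - exp (-2 * (R + Rc)) - b\<^sup>2 + e)))
    \<le> (\<Sum>i\<in>S. g i * g' i)"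
    using n by (intro correlation_from_costs[OF a b _ X Z gX gZ]) simp
  also have "\<dots> = (\<Sum>k<NK. \<Sum>j<NJ. \<Sum>t<n. real NJ * ((\<integral>x. w k j x * x t \<partial>std n) * (\<integral>x. w' k j x * x t \<partial>std n)))"
    unfolding gW S_def U_def sum_Times m_def m'_def x1_def z1_def using NK by (simp add: N_def)
  finally show ?thesis .
qed

text \<open>The correlations are those of rates lowered by \<open>3 * \<delta>\<close>. Together
  with the slack \<open>\<delta>\<close> in the cap of \<open>lrT\<close> the exponents still fall
  short of the codebook rates by \<open>2 * \<delta>\<close>, so the covering errors decay like
  \<open>exp (- (2 * n * \<delta>))\<close>.\<close>

lemma quantizers_exist:
  assumes R: "0 < R" and Rc: "0 \<le> Rc" and \<delta>: "0 < \<delta>" "\<delta> \<le> 1" "3 * \<delta> < R"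
  defines "a \<equiv> sqrt (1 - exp (-2 * (R - 3 * \<delta>)))" and "b \<equiv> sqrt (1 - exp (-2 * (R + Rc - 3 * \<delta>)))"
  shows "\<exists>n NJ NK w w' v. quantizers n NJ NK w w' \<and> 1 \<le> n \<and> 1 \<le> NJ \<and> 1 \<le> NK \<and> ln (real NJ) / real n \<le> R \<and> ln (real NK) / real n \<le> Rc \<and>
    (\<Sum>k<NK. \<Sum>j<NJ. \<integral>x. w k j x * sqd n x (\<lambda>t. a * v (k, j) t) \<partial>std n) / real NK \<le> real n * ((1 - a\<^sup>2) + 17 * \<delta>) \<and>
    (\<Sum>k<NK. \<Sum>j<NJ. \<integral>x. w' k j x * sqd n x (\<lambda>t. b * v (k, j) t) \<partial>std n) \<le> real n * ((1 - b\<^sup>2) + 17 * \<delta>)"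
proof -
  have a2: "1 - a\<^sup>2 = exp (-2 * (R - 3 * \<delta>))" using \<delta> by (simp add: a_def)
  have b2: "1 - b\<^sup>2 = exp (-2 * (R + Rc - 3 * \<delta>))" using \<delta> Rc by (simp add: b_def)
  have a1: "a\<^sup>2 < 1" using a2 by (smt (verit) exp_gt_zero)
  have b1: "b\<^sup>2 < 1" using b2 by (smt (verit) exp_gt_zero)
  \<comment> \<open>Collects every term of order \<open>1 / n\<close>:
    \<open>8 / \<delta>\<^sup>2\<close> from two atypical masses, \<open>1 / \<delta>\<close> from
    the norms of the codewords, and \<open>1 / (2 * \<delta>\<^sup>2)\<close> and
    \<open>1 / \<delta>\<^sup>2\<close> from the two covering errors. The other terms amount to
    \<open>3 * \<delta> / 2\<close>, so \<open>K / n < \<delta> / 2\<close> keeps the total below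
    \<open>2 * \<delta>\<close>.\<close>
  define K where "K = 8 / \<delta>\<^sup>2 + 1 / \<delta> + 3 / (2 * \<delta>\<^sup>2)"
  obtain n where n: "K / (\<delta> / 2) < real n" using reals_Archimedean2 by blast
  have K0: "0 < K" unfolding K_def using \<delta> by (intro add_pos_pos) auto
  have n0: "0 < real n" using n K0 \<delta> by (smt (verit) divide_pos_pos half_gt_zero)
  then have n1: "1 \<le> n" by simp
  have Kn: "K / real n < \<delta> / 2" using n n0 \<delta> by (simp add: field_simps)
  define NJ where "NJ = nat \<lfloor>exp (real n * R)\<rfloor>"
  define NK where "NK = nat \<lfloor>exp (real n * Rc)\<rfloor>"
  \<comment> \<open>Rounding down loses at most the factor 2, hence at most 4 for the product of the
    two sizes.\<close>
  have fl: "1 \<le> nat \<lfloor>x\<rfloor> \<and> x / 2 \<le> real (nat \<lfloor>x\<rfloor>) \<and> real (nat \<lfloor>x\<rfloor>) \<le> x" if "1 \<le> x" for x :: real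
  proof -
    have "1 \<le> \<lfloor>x\<rfloor>" using that by simp
    moreover have "x < real_of_int \<lfloor>x\<rfloor> + 1" by linarith
    ultimately have "x / 2 \<le> real_of_int \<lfloor>x\<rfloor>" by linarith
    then show ?thesis using \<open>1 \<le> \<lfloor>x\<rfloor>\<close> by simp
  qed
  have NJ: "1 \<le> NJ" "exp (real n * R) / 2 \<le> real NJ" "real NJ \<le> exp (real n * R)"
    unfolding NJ_def using fl[of "exp (real n * R)"] R by auto
  have NK: "1 \<le> NK" "exp (real n * Rc) / 2 \<le> real NK" "real NK \<le> exp (real n * Rc)"
    unfolding NK_def using fl[of "exp (real n * Rc)"] Rc by auto
  have RJ: "ln (real NJ) / real n \<le> R"
  proof -
    have "ln (real NJ) \<le> ln (exp (real n * R))" using NJ by (subst ln_le_cancel_iff) auto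
    then show ?thesis using n0 by (simp add: field_simps)
  qed
  have RK: "ln (real NK) / real n \<le> Rc"
  proof -
    have "ln (real NK) \<le> ln (exp (real n * Rc))" using NK by (subst ln_le_cancel_iff) auto
    then show ?thesis using n0 by (simp add: field_simps)
  qed
  \<comment> \<open>A decay of order \<open>1 / n\<close> suffices, and every error then takes the
    same form.\<close>
  have dec: "exp (- (2 * real n * \<delta>)) \<le> 1 / (2 * real n * \<delta>)"
  proof -
    have "2 * real n * \<delta> \<le> exp (2 * real n * \<delta>)" using exp_ge_add_one_self[of "2 * real n * \<delta>"] by linarith
    then show ?thesis using n0 \<delta> by (simp add: exp_minus field_simps)
  qed
  have La: "exp (real n * (\<delta> - ln (1 - a\<^sup>2) / 2)) / (2 * \<delta> * real NJ) \<le> 1 / (2 * \<delta>\<^sup>2 * real n)"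
  proof -
    have "exp (real n * (\<delta> - ln (1 - a\<^sup>2) / 2)) = exp (- (2 * real n * \<delta>)) * exp (real n * R)"
      unfolding a2 by (simp add: exp_add[symmetric] algebra_simps diff_divide_distrib add_divide_distrib)
    also have "\<dots> \<le> exp (- (2 * real n * \<delta>)) * (2 * real NJ)" using NJ by (intro mult_left_mono) auto
    also have "\<dots> \<le> 1 / (2 * real n * \<delta>) * (2 * real NJ)" using dec by (intro mult_right_mono) auto
    finally have "exp (real n * (\<delta> - ln (1 - a\<^sup>2) / 2)) / (2 * \<delta> * real NJ) \<le> 1 / (2 * real n * \<delta>) * (2 * real NJ) / (2 * \<delta> * real NJ)"
      using \<delta> by (intro divide_right_mono) auto
    also have "\<dots> = 1 / (2 * \<delta>\<^sup>2 * real n)" using \<delta> NJ n0 by (simp add: power2_eq_square)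
    finally show ?thesis .
  qed
  have Lb: "exp (real n * (\<delta> - ln (1 - b\<^sup>2) / 2)) / (2 * \<delta> * (real NK * real NJ)) \<le> 1 / (\<delta>\<^sup>2 * real n)"
  proof -
    define N where "N = real NK * real NJ"
    have N0: "0 < N" using NJ NK by (simp add: N_def)
    have N: "exp (real n * Rc) * exp (real n * R) \<le> 4 * N"
    proof -
      have "(exp (real n * Rc) / 2) * (exp (real n * R) / 2) \<le> N" unfolding N_def using NJ NK by (intro mult_mono) auto
      then show ?thesis by simp
    qed
    have "exp (real n * (\<delta> - ln (1 - b\<^sup>2) / 2)) = exp (- (2 * real n * \<delta>)) * (exp (real n * Rc) * exp (real n * R))"
      unfolding b2 by (simp add: exp_add[symmetric] algebra_simps diff_divide_distrib add_divide_distrib)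
    also have "\<dots> \<le> exp (- (2 * real n * \<delta>)) * (4 * N)" using N by (intro mult_left_mono) auto
    also have "\<dots> \<le> 1 / (2 * real n * \<delta>) * (4 * N)" using dec N0 by (intro mult_right_mono) auto
    finally have "exp (real n * (\<delta> - ln (1 - b\<^sup>2) / 2)) / (2 * \<delta> * N) \<le> 1 / (2 * real n * \<delta>) * (4 * N) / (2 * \<delta> * N)"
      using \<delta> N0 by (intro divide_right_mono) auto
    also have "\<dots> = 1 / (\<delta>\<^sup>2 * real n)" using \<delta> N0 n0 by (simp add: power2_eq_square)
    finally show ?thesis by (simp add: N_def)
  qed
  have tot: "2 * (4 / (real n * \<delta>\<^sup>2) + \<delta> / 2) + exp (real n * (\<delta> - ln (1 - a\<^sup>2) / 2)) / (2 * \<delta> * real NJ)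
       + exp (real n * (\<delta> - ln (1 - b\<^sup>2) / 2)) / (2 * \<delta> * (real NK * real NJ)) + (\<delta> / 2 + 1 / (real n * \<delta>)) < 2 * \<delta>"
  proof -
    define p q where "p = 1 / (real n * \<delta>\<^sup>2)" and "q = 1 / (real n * \<delta>)"
    have pq: "4 / (real n * \<delta>\<^sup>2) = 4 * p" "1 / (real n * \<delta>) = q" "1 / (2 * \<delta>\<^sup>2 * real n) = p / 2" "1 / (\<delta>\<^sup>2 * real n) = p"
      by (simp_all add: p_def q_def mult_ac)
    have "K / real n = 8 * p + q + 3 * p / 2"
      unfolding K_def p_def q_def using n0 \<delta> by (simp add: field_simps)
    then have "2 * (4 * p + \<delta> / 2) + A + B + (\<delta> / 2 + q) < 2 * \<delta>" if "A \<le> p / 2" "B \<le> p" for A B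
      using Kn that by argo
    then show ?thesis using La Lb unfolding pq by blast
  qed
  define U where "U = {..<NK} \<times> {..<NJ}"
  obtain v where v: "\<forall>u\<in>U. v u \<in> space (Rn n)"
    and vC: "(\<Sum>k<NK. uncovered a n \<delta> ({k} \<times> {..<NJ}) v) / real NK + uncovered b n \<delta> U v
      + (\<Sum>u\<in>U. \<bar>sqn n (v u) - real n\<bar>) / (real n * (real NK * real NJ)) < 2 * \<delta>"
    using good_codebook[OF a1 b1 \<delta>(1) n1 NJ(1) NK(1) tot] unfolding U_def by blast
  define V where "V = (\<Sum>u\<in>U. \<bar>sqn n (v u) - real n\<bar>) / (real NK * real NJ)"
  have unc0: "0 \<le> uncovered a n \<delta> I v" for a and I :: "(nat \<times> nat) set"
    unfolding uncovered_def by (intro integral_nonneg_AE) auto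
  have V0: "0 \<le> V" unfolding V_def by (intro divide_nonneg_nonneg sum_nonneg) auto
  have vV: "(\<Sum>u\<in>U. \<bar>sqn n (v u) - real n\<bar>) / (real n * (real NK * real NJ)) = V / real n" by (simp add: V_def mult.commute)
  \<comment> \<open>The three errors are nonnegative, so each of them obeys the bound for their
    sum.\<close>
  have ua: "(\<Sum>k<NK. uncovered a n \<delta> ({k} \<times> {..<NJ}) v) / real NK \<le> 2 * \<delta>" (is "?ua \<le> _")
    and ub: "uncovered b n \<delta> U v \<le> 2 * \<delta>" and V: "V \<le> real n * (2 * \<delta>)"
  proof -
    have "0 \<le> ?ua" using unc0 by (intro divide_nonneg_nonneg sum_nonneg) auto
    moreover have "0 \<le> V / real n" using V0 by simp
    ultimately have *: "?ua \<le> 2 * \<delta>" "uncovered b n \<delta> U v \<le> 2 * \<delta>" "V / real n \<le> 2 * \<delta>" using vC unc0[of b U] unfolding vV by linarith+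
    then show "?ua \<le> 2 * \<delta>" "uncovered b n \<delta> U v \<le> 2 * \<delta>" by auto
    show "V \<le> real n * (2 * \<delta>)" using * n0 by (simp add: field_simps)
  qed
  have dv: "(\<integral>x. \<bar>sqn n x - real n\<bar> \<partial>std n) \<le> real n * (2 * \<delta>)"
  proof -
    have "8 / (real n * \<delta>\<^sup>2) \<ge> 0" "1 / (2 * \<delta>\<^sup>2 * real n) \<ge> 0" "1 / (\<delta>\<^sup>2 * real n) \<ge> 0" using n0 \<delta> by auto
    moreover have "K / real n = 8 / (real n * \<delta>\<^sup>2) + 1 / (real n * \<delta>) + 1 / (2 * \<delta>\<^sup>2 * real n) + 1 / (\<delta>\<^sup>2 * real n)"
      unfolding K_def using n0 \<delta> by (simp add: field_simps)
    ultimately have "\<delta> / 2 + 1 / (real n * \<delta>) \<le> 2 * \<delta>" using Kn \<delta>(1) by linarith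
    then have "real n * (\<delta> / 2 + 1 / (real n * \<delta>)) \<le> real n * (2 * \<delta>)" by (intro mult_left_mono) auto
    moreover have "real n * (\<delta> / 2 + 1 / (real n * \<delta>)) = real n * (\<delta> / 2) + 1 / \<delta>" using n0 by (simp add: distrib_left)
    ultimately show ?thesis using std_norm_deviation(2)[OF \<delta>(1) n1] by linarith
  qed
  \<comment> \<open>Stated as a predicate so that one quantizer can be chosen for all seeds at
    once.\<close>
  define Pr where "Pr k \<omega> \<longleftrightarrow> (\<forall>i\<in>{k} \<times> {..<NJ}. \<omega> i \<in> borel_measurable (Rn n) \<and> (\<forall>x. 0 \<le> \<omega> i x) \<and> (\<integral>x. \<omega> i x \<partial>std n) = 1 / real (card ({k} \<times> {..<NJ})))
    \<and> (\<forall>x. (\<Sum>i\<in>{k} \<times> {..<NJ}. \<omega> i x) = 1)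
    \<and> (\<Sum>i\<in>{k} \<times> {..<NJ}. \<integral>x. \<omega> i x * sqd n x (\<lambda>t. a * v i t) \<partial>std n) \<le>
        real n * (1 - a\<^sup>2) * (1 + \<delta>) + 4 * real n * uncovered a n \<delta> ({k} \<times> {..<NJ}) v + 2 * (\<integral>x. \<bar>sqn n x - real n\<bar> \<partial>std n)
        + 2 * (\<Sum>i\<in>{k} \<times> {..<NJ}. \<bar>sqn n (v i) - real n\<bar>) / real (card ({k} \<times> {..<NJ}))" for k \<omega>
  have "\<exists>\<omega>. Pr k \<omega>" if "k < NK" for k
    unfolding Pr_def using NJ(1) v that by (intro codebook_quantizer[OF a1 \<delta>(1)]) (auto simp: U_def lessThan_empty_iff)
  then obtain \<omega> where "\<And>k. k < NK \<Longrightarrow> Pr k (\<omega> k)" by metis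
  note \<omega> = this[unfolded Pr_def]
  define w where "w k j = \<omega> k (k, j)" for k j
  obtain \<omega>' where \<omega>': "\<forall>i\<in>U. \<omega>' i \<in> borel_measurable (Rn n) \<and> (\<forall>x. 0 \<le> \<omega>' i x) \<and> (\<integral>x. \<omega>' i x \<partial>std n) = 1 / real (card U)"
    "\<forall>x. (\<Sum>i\<in>U. \<omega>' i x) = 1"
    "(\<Sum>i\<in>U. \<integral>x. \<omega>' i x * sqd n x (\<lambda>t. b * v i t) \<partial>std n) \<le>
        real n * (1 - b\<^sup>2) * (1 + \<delta>) + 4 * real n * uncovered b n \<delta> U v + 2 * (\<integral>x. \<bar>sqn n x - real n\<bar> \<partial>std n)
        + 2 * (\<Sum>i\<in>U. \<bar>sqn n (v i) - real n\<bar>) / real (card U)"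
    using codebook_quantizer[OF b1 \<delta>(1), of U v n] NJ(1) NK(1) v by (auto simp: U_def lessThan_empty_iff)
  define w' where "w' k j = \<omega>' (k, j)" for k j
  have cU: "real (card U) = real NK * real NJ" by (simp add: U_def)
  have q: "quantizers n NJ NK w w'"
    unfolding quantizers_def
  proof (intro conjI allI impI)
    fix k j x assume k: "k < NK"
    show "(\<Sum>j<NJ. w k j x) = 1" using \<omega>[OF k] by (simp add: w_def sum_Times)
    assume j: "j < NJ"
    show "w k j \<in> borel_measurable (Rn n)" "0 \<le> w k j x" "(\<integral>x. w k j x \<partial>std n) = 1 / real NJ"
      using \<omega>[OF k] j by (auto simp: w_def)
    show "w' k j \<in> borel_measurable (Rn n)" "0 \<le> w' k j x" "(\<integral>x. w' k j x \<partial>std n) = 1 / (real NK * real NJ)"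
      using \<omega>'(1) k j cU by (auto simp: w'_def U_def)
  next
    fix x show "(\<Sum>k<NK. \<Sum>j<NJ. w' k j x) = 1" using \<omega>'(2) by (simp add: w'_def U_def sum_Times)
  qed
  have split: "real n * (1 - c) * (1 + \<delta>) \<le> real n * (1 - c) + real n * \<delta>" if "0 \<le> c" for c
  proof -
    have "real n * (1 - c) * (1 + \<delta>) = real n * (1 - c) + real n * ((1 - c) * \<delta>)" by (simp add: algebra_simps)
    moreover have "real n * ((1 - c) * \<delta>) \<le> real n * (1 * \<delta>)" using that \<delta> by (intro mult_left_mono mult_right_mono) auto
    ultimately show ?thesis by simp
  qed
  have costX: "(\<Sum>k<NK. \<Sum>j<NJ. \<integral>x. w k j x * sqd n x (\<lambda>t. a * v (k, j) t) \<partial>std n) / real NK \<le> real n * ((1 - a\<^sup>2) + 17 * \<delta>)"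
  proof -
    define A0 where "A0 = real n * (1 - a\<^sup>2) * (1 + \<delta>) + 2 * (\<integral>x. \<bar>sqn n x - real n\<bar> \<partial>std n)"
    have "(\<Sum>k<NK. \<Sum>j<NJ. \<integral>x. w k j x * sqd n x (\<lambda>t. a * v (k, j) t) \<partial>std n) \<le>
      (\<Sum>k<NK. A0 + 4 * real n * uncovered a n \<delta> ({k} \<times> {..<NJ}) v + 2 * (\<Sum>j<NJ. \<bar>sqn n (v (k, j)) - real n\<bar>) / real NJ)"
    proof (intro sum_mono)
      fix k assume "k \<in> {..<NK}"
      then show "(\<Sum>j<NJ. \<integral>x. w k j x * sqd n x (\<lambda>t. a * v (k, j) t) \<partial>std n) \<le>
        A0 + 4 * real n * uncovered a n \<delta> ({k} \<times> {..<NJ}) v + 2 * (\<Sum>j<NJ. \<bar>sqn n (v (k, j)) - real n\<bar>) / real NJ"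
        using \<omega>[of k] by (simp add: w_def sum_Times A0_def add_ac)
    qed
    also have "\<dots> = real NK * A0 + 4 * real n * (\<Sum>k<NK. uncovered a n \<delta> ({k} \<times> {..<NJ}) v) + 2 * (\<Sum>u\<in>U. \<bar>sqn n (v u) - real n\<bar>) / real NJ"
      unfolding U_def sum_Times by (simp add: sum.distrib sum_distrib_left sum_divide_distrib)
    finally have "(\<Sum>k<NK. \<Sum>j<NJ. \<integral>x. w k j x * sqd n x (\<lambda>t. a * v (k, j) t) \<partial>std n) / real NK \<le>
      (real NK * A0 + 4 * real n * (\<Sum>k<NK. uncovered a n \<delta> ({k} \<times> {..<NJ}) v) + 2 * (\<Sum>u\<in>U. \<bar>sqn n (v u) - real n\<bar>) / real NJ) / real NK"
      by (intro divide_right_mono) auto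
    also have "\<dots> = A0 + 4 * real n * ?ua + 2 * V"
      using NK(1) by (simp add: add_divide_distrib V_def mult_ac)
    finally have le: "(\<Sum>k<NK. \<Sum>j<NJ. \<integral>x. w k j x * sqd n x (\<lambda>t. a * v (k, j) t) \<partial>std n) / real NK \<le> A0 + 4 * real n * ?ua + 2 * V" .
    have "4 * real n * ?ua \<le> 4 * real n * (2 * \<delta>)" using ua by (intro mult_left_mono) auto
    moreover have "real n * (1 - a\<^sup>2) * (1 + \<delta>) \<le> real n * (1 - a\<^sup>2) + real n * \<delta>" by (rule split) simp
    \<comment> \<open>17 = 1 + 4 + 8 + 4: slack of the typical distortion, norm of the source,
      uncovered mass, norms of the codewords.\<close>
    ultimately have "A0 + 4 * real n * ?ua + 2 * V \<le> real n * (1 - a\<^sup>2) + real n * \<delta> + 2 * (real n * (2 * \<delta>)) + 4 * real n * (2 * \<delta>) + 2 * (real n * (2 * \<delta>))"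
      using dv V unfolding A0_def by (intro add_mono) linarith+
    also have "\<dots> = real n * ((1 - a\<^sup>2) + 17 * \<delta>)" by (simp add: algebra_simps)
    finally show ?thesis using le by linarith
  qed
  have costZ: "(\<Sum>k<NK. \<Sum>j<NJ. \<integral>x. w' k j x * sqd n x (\<lambda>t. b * v (k, j) t) \<partial>std n) \<le> real n * ((1 - b\<^sup>2) + 17 * \<delta>)"
  proof -
    have "(\<Sum>k<NK. \<Sum>j<NJ. \<integral>x. w' k j x * sqd n x (\<lambda>t. b * v (k, j) t) \<partial>std n) \<le>
      real n * (1 - b\<^sup>2) * (1 + \<delta>) + 4 * real n * uncovered b n \<delta> U v + 2 * (\<integral>x. \<bar>sqn n x - real n\<bar> \<partial>std n) + 2 * V"
      using \<omega>'(3) unfolding cU V_def by (simp add: w'_def U_def sum_Times)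
    moreover have "4 * real n * uncovered b n \<delta> U v \<le> 4 * real n * (2 * \<delta>)" using ub by (intro mult_left_mono) auto
    moreover have "real n * (1 - b\<^sup>2) + real n * \<delta> + 4 * real n * (2 * \<delta>) + 2 * (real n * (2 * \<delta>)) + 2 * (real n * (2 * \<delta>)) = real n * ((1 - b\<^sup>2) + 17 * \<delta>)"
      by (simp add: algebra_simps)
    moreover have "real n * (1 - b\<^sup>2) * (1 + \<delta>) \<le> real n * (1 - b\<^sup>2) + real n * \<delta>" by (rule split) simp
    ultimately show ?thesis using dv V by linarith
  qed
  show ?thesis using q n1 NJ(1) NK(1) RJ RK costX costZ by blast
qed

lemma correlated_quantizers:
  assumes R: "0 \<le> R" and Rc: "0 \<le> Rc" and e: "0 < e"
  shows "\<exists>n NJ NK w w'. quantizers n NJ NK w w' \<and> 1 \<le> n \<and> 1 \<le> NJ \<and> 1 \<le> NK \<and> ln (real NJ) / real n \<le> R \<and> ln (real NK) / real n \<le> Rc \<and>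
    real n * (xi R Rc - e) \<le> (\<Sum>k<NK. \<Sum>j<NJ. \<Sum>t<n. real NJ * ((\<integral>x. w k j x * x t \<partial>std n) * (\<integral>x. w' k j x * x t \<partial>std n)))"
proof (cases "R = 0")
  case True
  \<comment> \<open>For \<open>R = 0\<close> the coefficient \<open>a\<close> of the limit is 0, and
    the correlation bound divides by it. But then \<open>xi R Rc = 0\<close>, and a trivial code
    with one message and one seed is good enough.\<close>
  have "quantizers 1 1 1 (\<lambda>_ _ _. 1) (\<lambda>_ _ _. 1)"
    using prob_space.prob_space[OF prob_space_std[of "Suc 0"]] by (simp add: quantizers_def)
  moreover have "(\<integral>x. x 0 \<partial>std 1) = 0" by (rule std_component_moments) simp
  ultimately show ?thesis
    using True Rc e by (intro exI[of _ 1] exI[of _ "\<lambda>_ _ _. 1"] conjI) (auto simp: xi_def)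
next
  case False
  then have R0: "0 < R" using R by simp
  define a where "a d = sqrt (1 - exp (-2 * (R - 3 * d)))" for d
  define b where "b d = sqrt (1 - exp (-2 * (R + Rc - 3 * d)))" for d
  \<comment> \<open>The bound of \<open>quantizer_correlation\<close> with excess
    \<open>17 * d\<close>. At \<open>d = 0\<close> the squares of \<open>a\<close> and
    \<open>b\<close> equal the energy bounds, so the root vanishes and \<open>xi R Rc\<close>
    remains; continuity then yields a suitable \<open>d\<close>.\<close>
  define h where "h d = a d * b d - 17 * d * a d / (2 * b d) - 17 * d * b d / (2 * a d)
    - sqrt ((1 - exp (-2 * R) - (a d)\<^sup>2 + 17 * d) * (1 - exp (-2 * (R + Rc)) - (b d)\<^sup>2 + 17 * d))" for d
  have a0: "0 < a 0" "(a 0)\<^sup>2 = 1 - exp (-2 * R)" and b0: "0 < b 0" "(b 0)\<^sup>2 = 1 - exp (-2 * (R + Rc))"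
    using R0 Rc by (auto simp: a_def b_def)
  have h0: "h 0 = xi R Rc"
    unfolding h_def using a0 b0 by (simp add: a_def b_def xi_def real_sqrt_mult)
  have "isCont a 0" "isCont b 0" unfolding a_def b_def by (intro continuous_intros isCont_real_sqrt)+
  then have "isCont h 0"
    unfolding h_def using a0 b0 by (intro continuous_intros isCont_o2[OF _ isCont_real_sqrt]) auto
  then have "(h \<longlongrightarrow> xi R Rc) (at_right 0)" using h0 by (simp add: isCont_def filterlim_at_split)
  then have "\<forall>\<^sub>F d in at_right 0. xi R Rc - e < h d" using e by (intro order_tendstoD) auto
  moreover have "\<forall>\<^sub>F d in at_right (0::real). d < min 1 (R / 3) \<and> 0 < d"
    using R0 by (intro eventually_conj eventually_at_right_less)
      (auto simp: eventually_at_right_field intro!: exI[of _ "min 1 (R / 3)"])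
  ultimately have "\<exists>d. xi R Rc - e < h d \<and> d < min 1 (R / 3) \<and> 0 < d"
    using eventually_happens[of _ "at_right (0::real)"] eventually_conj by fastforce
  then obtain d where d: "xi R Rc - e < h d" "0 < d" "d \<le> 1" "3 * d < R" by auto
  obtain n NJ NK w w' v where q: "quantizers n NJ NK w w'" "1 \<le> n" "1 \<le> NJ" "1 \<le> NK" "ln (real NJ) / real n \<le> R" "ln (real NK) / real n \<le> Rc"
    "(\<Sum>k<NK. \<Sum>j<NJ. \<integral>x. w k j x * sqd n x (\<lambda>t. a d * v (k, j) t) \<partial>std n) / real NK \<le> real n * ((1 - (a d)\<^sup>2) + 17 * d)"
    "(\<Sum>k<NK. \<Sum>j<NJ. \<integral>x. w' k j x * sqd n x (\<lambda>t. b d * v (k, j) t) \<partial>std n) \<le> real n * ((1 - (b d)\<^sup>2) + 17 * d)"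
    using quantizers_exist[OF R0 Rc d(2,3,4)] unfolding a_def b_def by blast
  have ab: "0 < a d" "0 < b d" using d Rc by (auto simp: a_def b_def)
  have "real n * h d \<le> (\<Sum>k<NK. \<Sum>j<NJ. \<Sum>t<n. real NJ * ((\<integral>x. w k j x * x t \<partial>std n) * (\<integral>x. w' k j x * x t \<partial>std n)))"
    unfolding h_def by (rule quantizer_correlation[OF q(1-6) ab q(7,8)])
  moreover have "real n * (xi R Rc - e) \<le> real n * h d" using d by (intro mult_left_mono) auto
  ultimately have "real n * (xi R Rc - e) \<le> (\<Sum>k<NK. \<Sum>j<NJ. \<Sum>t<n. real NJ * ((\<integral>x. w k j x * x t \<partial>std n) * (\<integral>x. w' k j x * x t \<partial>std n)))"
    by linarith
  with q(1-6) show ?thesis by blast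
qed

section \<open>The upper bound\<close>

text \<open>Both laws are driven by the same standard normal variable. The second one is written as
  an image and not as \<open>gauss\<close>, because for \<open>s = 0\<close> it is a point
  mass.\<close>

lemma W2sq_gauss_le:
  assumes \<sigma>: "0 < \<sigma>"
  shows "W2sq (gauss \<mu> \<sigma>) (distr (gauss 0 1) borel (\<lambda>y. \<mu> + s * y)) \<le> ennreal ((\<sigma> - s)\<^sup>2)"
proof -
  define \<pi> where "\<pi> = distr (gauss 0 1) (borel \<Otimes>\<^sub>M borel) (\<lambda>y. (\<mu> + \<sigma> * y, \<mu> + s * y))"
  have m: "(\<lambda>y. (\<mu> + \<sigma> * y, \<mu> + s * y)) \<in> gauss 0 1 \<rightarrow>\<^sub>M borel \<Otimes>\<^sub>M borel" by simp
  have "W2sq (gauss \<mu> \<sigma>) (distr (gauss 0 1) borel (\<lambda>y. \<mu> + s * y)) \<le> (\<integral>\<^sup>+ z. ennreal ((fst z - snd z)\<^sup>2) \<partial>\<pi>)"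
    unfolding W2sq_def
  proof (rule INF_lower, intro CollectI conjI)
    show "prob_space \<pi>" unfolding \<pi>_def by (rule prob_space.prob_space_distr[OF prob_space_gauss1 m])
    show "sets \<pi> = sets (borel \<Otimes>\<^sub>M borel)" by (simp add: \<pi>_def)
    show "distr \<pi> borel fst = gauss \<mu> \<sigma>"
      unfolding \<pi>_def using m by (subst distr_distr) (auto simp: comp_def gauss_affine[OF \<sigma>])
    show "distr \<pi> borel snd = distr (gauss 0 1) borel (\<lambda>y. \<mu> + s * y)"
      unfolding \<pi>_def using m by (subst distr_distr) (auto simp: comp_def)
  qed
  also have "\<dots> = (\<integral>\<^sup>+ y. ennreal ((\<sigma> - s)\<^sup>2 * y\<^sup>2) \<partial>gauss 0 1)"
    unfolding \<pi>_def using m by (subst nn_integral_distr) (auto simp: power_mult_distrib[symmetric] left_diff_distrib)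
  also have "\<dots> = ennreal (\<integral>y. (\<sigma> - s)\<^sup>2 * y\<^sup>2 \<partial>gauss 0 1)"
    using gauss_moments(3) by (intro nn_integral_eq_integral) auto
  also have "\<dots> = ennreal ((\<sigma> - s)\<^sup>2)" using gauss_moments by simp
  finally show ?thesis .
qed

text \<open>The gluing. The seed selects a partition of the source, the encoder draws the message by
  its weights, and the decoder draws a normal vector from the output cell with the same pair of
  indices and scales it by \<open>s\<close>. Source and output meet through the index only, so their
  correlation is a sum of products of cell means.\<close>

lemma achievable_scaled_output:
  assumes \<sigma>: "0 < \<sigma>" and R: "0 \<le> R" and Rc: "0 \<le> Rc" and s: "0 \<le> s" and P: "(\<sigma> - s)\<^sup>2 \<le> P" and e: "0 < e"
  shows "achievable (gauss \<mu> \<sigma>) R Rc P (\<sigma>\<^sup>2 + s\<^sup>2 - 2 * \<sigma> * s * (xi R Rc - e))"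
proof -
  obtain n NJ NK w w' where qz: "quantizers n NJ NK w w'" and n: "1 \<le> n" and NJ: "1 \<le> NJ" and NK: "1 \<le> NK"
    and RJ: "ln (real NJ) / real n \<le> R" and RK: "ln (real NK) / real n \<le> Rc"
    and corr: "real n * (xi R Rc - e) \<le> (\<Sum>k<NK. \<Sum>j<NJ. \<Sum>t<n. real NJ * ((\<integral>x. w k j x * x t \<partial>std n) * (\<integral>x. w' k j x * x t \<partial>std n)))"
    using correlated_quantizers[OF R Rc e] by blast
  interpret S: prob_space "std n" by simp
  define N where "N = real NK * real NJ"
  have N: "0 < N" using NJ NK by (simp add: N_def)
  have w: "w k j \<in> borel_measurable (Rn n)" "0 \<le> w k j x" "(\<integral>x. w k j x \<partial>std n) = 1 / real NJ" if "k < NK" "j < NJ" for k j x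
    using qz that by (auto simp: quantizers_def)
  have w1: "(\<Sum>j<NJ. w k j x) = 1" if "k < NK" for k x using qz that by (auto simp: quantizers_def)
  have w': "w' k j \<in> borel_measurable (Rn n)" "0 \<le> w' k j x" "(\<integral>x. w' k j x \<partial>std n) = 1 / N" if "k < NK" "j < NJ" for k j x
    using qz that by (auto simp: quantizers_def N_def)
  have w'1: "(\<Sum>k<NK. \<Sum>j<NJ. w' k j x) = 1" for x using qz by (auto simp: quantizers_def)
  have wle: "w k j x \<le> 1" if "k < NK" "j < NJ" for k j x
    using member_le_sum[of j "{..<NJ}" "\<lambda>j. w k j x"] w w1 that by auto
  have w'le: "w' k j x \<le> 1" if "k < NK" "j < NJ" for k j x
  proof -
    have "w' k j x \<le> (\<Sum>j<NJ. w' k j x)" using that w' by (intro member_le_sum) auto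
    also have "\<dots> \<le> (\<Sum>k<NK. \<Sum>j<NJ. w' k j x)"
      using that w' by (intro member_le_sum[of k "{..<NK}" "\<lambda>k. \<Sum>j<NJ. w' k j x"] sum_nonneg) auto
    finally show ?thesis using w'1 by simp
  qed
  have iw: "integrable (std n) (\<lambda>y. w k j y * f y)" "integrable (std n) (\<lambda>y. w' k j y * f y)"
    if "k < NK" "j < NJ" "integrable (std n) f" for k j and f :: "_ \<Rightarrow> real"
    using that w w' wle w'le by (auto intro!: integrable_weight_mult AE_I2)
  have iw1: "integrable (std n) (w k j)" "integrable (std n) (w' k j)" if "k < NK" "j < NJ" for k j
    using iw[OF that, of "\<lambda>_. 1"] by simp_all

  define nrm where "nrm x = (\<lambda>t\<in>{..<n}. - \<mu> / \<sigma> + 1 / \<sigma> * x t)" for x :: "nat \<Rightarrow> real"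
  define a where "a y = (\<lambda>t\<in>{..<n}. \<mu> + \<sigma> * y t)" for y :: "nat \<Rightarrow> real"
  define b where "b z = (\<lambda>t\<in>{..<n}. \<mu> + s * z t)" for z :: "nat \<Rightarrow> real"
  define enc where "enc x k = density (count_space {..<NJ}) (\<lambda>j. ennreal (w k j (nrm x)))" for x k
  \<comment> \<open>The law of a standard normal vector given its cell; the factor \<open>N\<close>
    normalizes the cell mass \<open>1 / N\<close>.\<close>
  define \<delta> where "\<delta> j k = density (std n) (\<lambda>z. ennreal (N * w' k j z))" for j k
  define dec where "dec j k = distr (\<delta> j k) (Rn n) b" for j k
  have nm: "nrm \<in> Rn n \<rightarrow>\<^sub>M Rn n" "b \<in> Rn n \<rightarrow>\<^sub>M Rn n" "a \<in> Rn n \<rightarrow>\<^sub>M Rn n"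
    unfolding nrm_def[abs_def] b_def[abs_def] a_def[abs_def] by (rule measurable_affine_Rn)+
  \<comment> \<open>On extensional functions \<open>nrm\<close> undoes \<open>a\<close>, so at the
    source vector \<open>a y\<close> the encoder uses the weights \<open>w k j y\<close>.\<close>
  have nrma: "nrm (a y) = y" if "y \<in> space (std n)" for y
    using that \<sigma> by (auto simp: nrm_def a_def space_PiM PiE_def extensional_def field_simps)
  have em: "emeasure (enc x k) A = (\<Sum>j\<in>A. ennreal (w k j (nrm x)))" if A: "A \<subseteq> {..<NJ}" for x k A
  proof -
    have fA: "finite A" using A finite_subset by blast
    have "emeasure (enc x k) A = (\<integral>\<^sup>+j. ennreal (w k j (nrm x)) * indicator A j \<partial>count_space {..<NJ})"
      unfolding enc_def using A by (intro emeasure_density) auto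
    also have "\<dots> = (\<Sum>j<NJ. ennreal (w k j (nrm x)) * indicator A j)"
      by (simp add: nn_integral_count_space_finite)
    also have "\<dots> = (\<Sum>j\<in>A. ennreal (w k j (nrm x)))"
      using A by (simp add: indicator_def if_distrib sum.If_cases Int_absorb1 cong: if_cong)
    finally show ?thesis .
  qed
  have enc: "(\<lambda>x. enc x k) \<in> Rn n \<rightarrow>\<^sub>M prob_algebra (count_space {..<NJ})" if k: "k < NK" for k
  proof -
    have p: "prob_space (enc x k)" for x
    proof
      have "emeasure (enc x k) (space (enc x k)) = ennreal (\<Sum>j<NJ. w k j (nrm x))"
        using em[of "{..<NJ}" x k] w(2)[OF k] sum_ennreal[of "{..<NJ}" "\<lambda>j. w k j (nrm x)"]
        by (simp add: enc_def del: sum_ennreal)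
      then show "emeasure (enc x k) (space (enc x k)) = 1" using w1[OF k] by simp
    qed
    show ?thesis
    proof (rule measurable_prob_algebraI[OF p], rule measurable_subprob_algebra)
      show "subprob_space (enc x k)" for x using p by (rule prob_space_imp_subprob_space)
      show "sets (enc x k) = sets (count_space {..<NJ})" for x by (simp add: enc_def)
      fix A assume "A \<in> sets (count_space {..<NJ})"
      then have A: "A \<subseteq> {..<NJ}" by simp
      show "(\<lambda>x. emeasure (enc x k) A) \<in> borel_measurable (Rn n)"
        unfolding em[OF A]
      proof (intro borel_measurable_sum measurable_compose[OF _ measurable_ennreal])
        fix j assume "j \<in> A"
        then show "(\<lambda>x. w k j (nrm x)) \<in> borel_measurable (Rn n)"
          using A k by (intro measurable_compose[OF nm(1) w(1)]) auto
      qed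
    qed
  qed
  have \<delta>p: "prob_space (\<delta> j k)" if kj: "k < NK" "j < NJ" for k j
  proof
    have "(\<lambda>z. ennreal (N * w' k j z)) \<in> borel_measurable (std n)" using w'(1)[OF kj] by simp
    then have "emeasure (\<delta> j k) (space (std n)) = (\<integral>\<^sup>+z. ennreal (N * w' k j z) * indicator (space (std n)) z \<partial>std n)"
      unfolding \<delta>_def by (rule emeasure_density) (rule sets.top)
    also have "\<dots> = (\<integral>\<^sup>+z. ennreal (N * w' k j z) \<partial>std n)" by (intro nn_integral_cong) simp
    finally have "emeasure (\<delta> j k) (space (\<delta> j k)) = (\<integral>\<^sup>+z. ennreal (N * w' k j z) \<partial>std n)"
      by (simp add: \<delta>_def)
    also have "\<dots> = ennreal (\<integral>z. N * w' k j z \<partial>std n)"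
      using iw1(2)[OF kj] w'(2)[OF kj] N by (intro nn_integral_eq_integral) auto
    also have "\<dots> = 1" using w'(3)[OF kj] N by simp
    finally show "emeasure (\<delta> j k) (space (\<delta> j k)) = 1" .
  qed
  have b\<delta>: "b \<in> \<delta> j k \<rightarrow>\<^sub>M Rn n" for j k
    using nm(2) by (simp add: \<delta>_def)
  have dec: "prob_space (dec j k)" "sets (dec j k) = sets (Rn n)" if "k < NK" "j < NJ" for j k
    unfolding dec_def using prob_space.prob_space_distr[OF \<delta>p[OF that] b\<delta>] by simp_all
  have V: "valid_code n NJ NK enc dec"
    unfolding valid_code_def
  proof (intro conjI allI impI n NJ NK)
    have "(\<lambda>z. enc (fst z) (snd z)) \<in> Rn n \<Otimes>\<^sub>M count_space {..<NK} \<rightarrow>\<^sub>M prob_algebra (count_space {..<NJ})"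
      by (rule measurable_compose_countable'[OF _ measurable_snd])
         (auto intro: measurable_compose[OF measurable_fst enc])
    then show "(\<lambda>(x, k). enc x k) \<in> Rn n \<Otimes>\<^sub>M count_space {..<NK} \<rightarrow>\<^sub>M prob_algebra (count_space {..<NJ})"
      by (simp add: split_beta')
    show "dec j k \<in> space (prob_algebra (Rn n))" if "j < NJ" "k < NK" for j k
      using dec that by (simp add: space_prob_algebra)
  qed
  note g = prob_space_gauss[OF \<sigma>, of \<mu>] sets_gauss[of \<mu> \<sigma>]
  define M where "M = code_joint n (gauss \<mu> \<sigma>) NK enc dec"
  have sM[measurable_cong]: "sets M = sets (Rn n \<Otimes>\<^sub>M Rn n)" unfolding M_def by (rule sets_code_joint[OF V g])
  have fsM[measurable]: "fst \<in> M \<rightarrow>\<^sub>M Rn n" "snd \<in> M \<rightarrow>\<^sub>M Rn n"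
    using measurable_cong_sets[OF sM refl] measurable_fst measurable_snd by blast+
  have ct[measurable]: "(\<lambda>x. x t) \<in> borel_measurable (Rn n)" if "t < n" for t
    using that by (intro measurable_component_singleton) simp
  have code: "(\<integral>\<^sup>+z. f z \<partial>M) = (\<Sum>k<NK. \<Sum>j<NJ. \<integral>\<^sup>+y. ennreal (w k j y / real NK) * (\<integral>\<^sup>+z. f (a y, b z) \<partial>\<delta> j k) \<partial>std n)"
    if f: "f \<in> borel_measurable (Rn n \<Otimes>\<^sub>M Rn n)" for f
    unfolding M_def nn_integral_code_joint_std[OF \<sigma> V f] a_def[symmetric]
  proof (intro sum.cong refl nn_integral_cong)
    fix k j y assume k: "k \<in> {..<NK}" and j: "j \<in> {..<NJ}" and y: "y \<in> space (std n)"
    have "measure (enc (a y) k) {j} = w k j y"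
      using em[of "{j}" "a y" k] j k w(2)[of k j y] nrma[OF y] by (simp add: measure_def)
    moreover have "(\<integral>\<^sup>+z. f (a y, z) \<partial>dec j k) = (\<integral>\<^sup>+z. f (a y, b z) \<partial>\<delta> j k)"
    proof -
      have "a y \<in> space (Rn n)" using measurable_space[OF nm(3)] y by (simp add: space_PiM)
      then show ?thesis unfolding dec_def using f by (intro nn_integral_distr b\<delta>) simp
    qed
    ultimately show "ennreal (measure (enc (a y) k) {j} / real NK) * (\<integral>\<^sup>+z. f (a y, z) \<partial>dec j k) =
      ennreal (w k j y / real NK) * (\<integral>\<^sup>+z. f (a y, b z) \<partial>\<delta> j k)" by simp
  qed
  define q where "q = distr (gauss 0 1) borel (\<lambda>y. \<mu> + s * y)"
  have q: "prob_space q" "sets q = sets borel"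
    unfolding q_def by (auto intro!: prob_space.prob_space_distr[OF prob_space_gauss1])
  have Qb: "PiM {..<n} (\<lambda>_. q) = distr (std n) (Rn n) b"
    unfolding q_def b_def[abs_def] by (rule distr_PiM_family[symmetric]) auto
  have mq: "distr M (Rn n) snd = PiM {..<n} (\<lambda>_. q)"
    unfolding Qb
  proof (rule measure_eqI)
    show "sets (distr M (Rn n) snd) = sets (distr (std n) (Rn n) b)" by simp
    fix B assume "B \<in> sets (distr M (Rn n) snd)"
    then have B[measurable]: "B \<in> sets (Rn n)" by simp
    have Bm: "(\<lambda>z. indicator B (b z) :: ennreal) \<in> borel_measurable (Rn n)"
      using nm(2) by (intro measurable_compose[OF nm(2)]) simp
    have "emeasure (distr M (Rn n) snd) B = (\<integral>\<^sup>+x. indicator B x \<partial>distr M (Rn n) snd)" by simp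
    also have "\<dots> = (\<integral>\<^sup>+z. indicator B (snd z) \<partial>M)" by (intro nn_integral_distr) auto
    also have "\<dots> = (\<Sum>k<NK. \<Sum>j<NJ. \<integral>\<^sup>+y. ennreal (w k j y / real NK) * (\<integral>\<^sup>+z. indicator B (b z) \<partial>\<delta> j k) \<partial>std n)"
      by (subst code) auto
    also have "\<dots> = (\<Sum>k<NK. \<Sum>j<NJ. \<integral>\<^sup>+z. ennreal (w' k j z) * indicator B (b z) \<partial>std n)"
    proof (intro sum.cong refl)
      fix k j assume "k \<in> {..<NK}" "j \<in> {..<NJ}"
      then have kj: "k < NK" "j < NJ" by auto
      have "(\<integral>\<^sup>+y. ennreal (w k j y / real NK) \<partial>std n) = ennreal (1 / N)"
        using iw1(1)[OF kj] w(2,3)[OF kj] by (subst nn_integral_eq_integral) (auto simp: N_def)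
      moreover have "(\<integral>\<^sup>+z. indicator B (b z) \<partial>\<delta> j k) = ennreal N * (\<integral>\<^sup>+z. ennreal (w' k j z) * indicator B (b z) \<partial>std n)"
      proof -
        have "(\<integral>\<^sup>+z. indicator B (b z) \<partial>\<delta> j k) = (\<integral>\<^sup>+z. ennreal (N * w' k j z) * indicator B (b z) \<partial>std n)"
          unfolding \<delta>_def using w'(1)[OF kj] Bm by (subst nn_integral_density) auto
        also have "\<dots> = (\<integral>\<^sup>+z. ennreal N * (ennreal (w' k j z) * indicator B (b z)) \<partial>std n)"
          using N w'(2)[OF kj] by (intro nn_integral_cong) (simp add: ennreal_mult mult.assoc)
        also have "\<dots> = ennreal N * (\<integral>\<^sup>+z. ennreal (w' k j z) * indicator B (b z) \<partial>std n)"
          using w'(1)[OF kj] Bm by (intro nn_integral_cmult) auto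
        finally show ?thesis .
      qed
      \<comment> \<open>The probability of the index pair cancels the normalization of the cell law.
        This is where balance makes the mixture reproduce the normal law exactly.\<close>
      moreover have "ennreal (1 / N) * ennreal N = 1" using N by (simp add: ennreal_mult[symmetric])
      ultimately show "(\<integral>\<^sup>+y. ennreal (w k j y / real NK) * (\<integral>\<^sup>+z. indicator B (b z) \<partial>\<delta> j k) \<partial>std n)
        = (\<integral>\<^sup>+z. ennreal (w' k j z) * indicator B (b z) \<partial>std n)"
        using w(1)[OF kj] by (subst nn_integral_multc) (auto simp: mult.assoc[symmetric])
    qed
    also have "\<dots> = (\<integral>\<^sup>+z. (\<Sum>k<NK. \<Sum>j<NJ. ennreal (w' k j z) * indicator B (b z)) \<partial>std n)"
    proof -
      have m: "(\<lambda>z. ennreal (w' k j z) * indicator B (b z)) \<in> borel_measurable (std n)" if "k < NK" "j < NJ" for k j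
        using w'(1)[OF that] Bm by simp
      have "(\<Sum>k<NK. \<Sum>j<NJ. \<integral>\<^sup>+z. ennreal (w' k j z) * indicator B (b z) \<partial>std n)
        = (\<Sum>k<NK. \<integral>\<^sup>+z. (\<Sum>j<NJ. ennreal (w' k j z) * indicator B (b z)) \<partial>std n)"
        using m by (intro sum.cong refl nn_integral_sum[symmetric]) blast
      also have "\<dots> = (\<integral>\<^sup>+z. (\<Sum>k<NK. \<Sum>j<NJ. ennreal (w' k j z) * indicator B (b z)) \<partial>std n)"
        using m by (intro nn_integral_sum[symmetric] borel_measurable_sum) blast
      finally show ?thesis .
    qed
    also have "\<dots> = (\<integral>\<^sup>+z. indicator B (b z) \<partial>std n)"
    proof (intro nn_integral_cong)
      fix z
      have "(\<Sum>k<NK. \<Sum>j<NJ. ennreal (w' k j z) * indicator B (b z)) = ennreal (\<Sum>k<NK. \<Sum>j<NJ. w' k j z) * indicator B (b z)"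
      proof -
        have "(\<Sum>k<NK. \<Sum>j<NJ. ennreal (w' k j z)) = (\<Sum>k<NK. ennreal (\<Sum>j<NJ. w' k j z))"
          using w'(2) by (intro sum.cong refl sum_ennreal) auto
        also have "\<dots> = ennreal (\<Sum>k<NK. \<Sum>j<NJ. w' k j z)"
          using w'(2) by (intro sum_ennreal sum_nonneg) auto
        finally show ?thesis by (simp only: sum_distrib_right[symmetric])
      qed
      then show "(\<Sum>k<NK. \<Sum>j<NJ. ennreal (w' k j z) * indicator B (b z)) = indicator B (b z)" using w'1 by simp
    qed
    also have "\<dots> = (\<integral>\<^sup>+x. indicator B x \<partial>distr (std n) (Rn n) b)"
      using nm(2) by (subst nn_integral_distr) auto
    also have "\<dots> = emeasure (distr (std n) (Rn n) b) B" by simp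
    finally show "emeasure (distr M (Rn n) snd) B = emeasure (distr (std n) (Rn n) b) B" .
  qed
  have inv: "ennreal (1 / real n) * ennreal (real n * c) = ennreal c" if "0 \<le> c" for c
    using n that by (simp add: ennreal_mult[symmetric])
  have perc: "ennreal (1 / real n) * (\<Sum>t<n. W2sq (distr M borel (\<lambda>z. fst z t)) (distr M borel (\<lambda>z. snd z t))) \<le> ennreal P"
    unfolding M_def average_perception[OF V g q mq[unfolded M_def]]
    using W2sq_gauss_le[OF \<sigma>, of \<mu> s] P unfolding q_def by (auto intro: order_trans ennreal_leI)
  define D where "D = \<sigma>\<^sup>2 + s\<^sup>2 - 2 * \<sigma> * s * (xi R Rc - e)"
  \<comment> \<open>\<open>achievable\<close> asks for a nonnegative level; since \<open>xi\<close>
    is at most 1, \<open>D\<close> stays above \<open>(\<sigma> - s)\<^sup>2\<close>.\<close>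
  have D0: "0 \<le> D"
  proof -
    have "xi R Rc \<le> 1" unfolding xi_def using R Rc by (intro real_le_lsqrt) (auto intro!: mult_le_one)
    then have "2 * \<sigma> * s * (xi R Rc - e) \<le> 2 * \<sigma> * s * 1" using e \<sigma> s by (intro mult_left_mono) auto
    moreover have "0 \<le> (\<sigma> - s)\<^sup>2" by simp
    ultimately show ?thesis unfolding D_def power2_diff by linarith
  qed
  define c where "c k j t = (\<integral>y. w k j y / real NK * (\<sigma> * y t)\<^sup>2 \<partial>std n) - 2 * (\<integral>y. w k j y / real NK * (\<sigma> * y t) \<partial>std n) * (\<integral>z. s * z t \<partial>\<delta> j k)
      + (\<integral>y. w k j y / real NK \<partial>std n) * (\<integral>z. (s * z t)\<^sup>2 \<partial>\<delta> j k)" for k j t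
  have cell: "(\<integral>\<^sup>+y. ennreal (w k j y / real NK) * (\<integral>\<^sup>+z. ennreal ((a y t - b z t)\<^sup>2) \<partial>\<delta> j k) \<partial>std n) = ennreal (c k j t)"
    "0 \<le> c k j t"
    "c k j t = \<sigma>\<^sup>2 / real NK * (\<integral>y. w k j y * (y t)\<^sup>2 \<partial>std n) + s\<^sup>2 * (\<integral>y. w' k j y * (y t)\<^sup>2 \<partial>std n)
      - 2 * \<sigma> * s * (real NJ * ((\<integral>x. w k j x * x t \<partial>std n) * (\<integral>x. w' k j x * x t \<partial>std n)))"
    if kj: "k < NK" "j < NJ" and t: "t < n" for k j t
  proof -
    note y = std_component_moments[OF t]
    have i: "integrable (std n) (\<lambda>y. w k j y / real NK)" "integrable (std n) (\<lambda>y. w k j y / real NK * (\<sigma> * y t))"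
      "integrable (std n) (\<lambda>y. w k j y / real NK * (\<sigma> * y t)\<^sup>2)"
      using iw1(1)[OF kj] iw(1)[OF kj, of "\<lambda>y. \<sigma> * y t / real NK"] iw(1)[OF kj, of "\<lambda>y. (\<sigma> * y t)\<^sup>2 / real NK"] y
      by (auto simp: power_mult_distrib)
    have Nw: "(\<lambda>z. N * w' k j z) \<in> borel_measurable (std n)" "AE z in std n. 0 \<le> N * w' k j z"
      using w'(1,2)[OF kj] N by auto
    have z: "integrable (\<delta> j k) f \<longleftrightarrow> integrable (std n) (\<lambda>x. N * w' k j x * f x)" "(\<integral>x. f x \<partial>\<delta> j k) = (\<integral>x. N * w' k j x * f x \<partial>std n)"
      if "f \<in> borel_measurable (Rn n)" for f
    proof -
      have f: "f \<in> borel_measurable (std n)" using that by simp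
      show "integrable (\<delta> j k) f \<longleftrightarrow> integrable (std n) (\<lambda>x. N * w' k j x * f x)"
        unfolding \<delta>_def by (rule integrable_real_density[OF Nw f])
      show "(\<integral>x. f x \<partial>\<delta> j k) = (\<integral>x. N * w' k j x * f x \<partial>std n)"
        unfolding \<delta>_def by (rule integral_real_density[OF Nw f])
    qed
    have mt: "(\<lambda>z. s * z t) \<in> borel_measurable (Rn n)" "(\<lambda>z. (s * z t)\<^sup>2) \<in> borel_measurable (Rn n)"
      using ct[OF t] by (auto intro!: borel_measurable_times borel_measurable_power)
    have v1: "(\<lambda>x. N * w' k j x * (s * x t)) = (\<lambda>x. N * s * (w' k j x * x t))" by (simp add: fun_eq_iff)
    have v2: "(\<lambda>x. N * w' k j x * (s * x t)\<^sup>2) = (\<lambda>x. N * s\<^sup>2 * (w' k j x * (x t)\<^sup>2))" by (simp add: fun_eq_iff power_mult_distrib)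
    have iz: "integrable (\<delta> j k) (\<lambda>z. s * z t)" "integrable (\<delta> j k) (\<lambda>z. (s * z t)\<^sup>2)"
      unfolding z(1)[OF mt(1)] z(1)[OF mt(2)] v1 v2 using iw(2)[OF kj y(1)] iw(2)[OF kj y(3)] by auto
    have w0: "0 \<le> w k j y / real NK" for y using w(2)[OF kj] by simp
    have diff: "a y t - b z t = \<sigma> * y t - s * z t" for y z using t by (simp add: a_def b_def)
    show "(\<integral>\<^sup>+y. ennreal (w k j y / real NK) * (\<integral>\<^sup>+z. ennreal ((a y t - b z t)\<^sup>2) \<partial>\<delta> j k) \<partial>std n) = ennreal (c k j t)"
      unfolding diff c_def by (rule nn_integral_pair_square(1)[OF i AE_I2[OF w0] \<delta>p[OF kj] iz])
    show "0 \<le> c k j t" unfolding c_def by (rule nn_integral_pair_square(2)[OF i AE_I2[OF w0] \<delta>p[OF kj] iz])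
    have x1: "(\<lambda>y. w k j y / real NK * (\<sigma> * y t)\<^sup>2) = (\<lambda>y. \<sigma>\<^sup>2 / real NK * (w k j y * (y t)\<^sup>2))"
      and x2: "(\<lambda>y. w k j y / real NK * (\<sigma> * y t)) = (\<lambda>y. \<sigma> / real NK * (w k j y * y t))"
      by (simp_all add: fun_eq_iff power_mult_distrib)
    \<comment> \<open>The factor \<open>NJ\<close> is \<open>N / NK\<close>: the normalization of
      the cell law times the probability of the seed.\<close>
    show "c k j t = \<sigma>\<^sup>2 / real NK * (\<integral>y. w k j y * (y t)\<^sup>2 \<partial>std n) + s\<^sup>2 * (\<integral>y. w' k j y * (y t)\<^sup>2 \<partial>std n)
      - 2 * \<sigma> * s * (real NJ * ((\<integral>x. w k j x * x t \<partial>std n) * (\<integral>x. w' k j x * x t \<partial>std n)))"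
      unfolding c_def z(2)[OF mt(1)] z(2)[OF mt(2)] v1 v2 x1 x2 using w(3)[OF kj] NK NJ N_def by simp
  qed
  have second: "(\<Sum>k<NK. \<Sum>j<NJ. \<Sum>t<n. \<integral>y. f (k, j) y * (y t)\<^sup>2 \<partial>std n) = real n"
    if f: "\<And>u. u \<in> {..<NK} \<times> {..<NJ} \<Longrightarrow> f u \<in> borel_measurable (Rn n)" "\<And>u y. u \<in> {..<NK} \<times> {..<NJ} \<Longrightarrow> 0 \<le> f u y"
      "\<And>y. (\<Sum>u\<in>{..<NK} \<times> {..<NJ}. f u y) = 1" for f :: "_ \<Rightarrow> _ \<Rightarrow> real"
    using sum_weighted_second_moments[of "{..<NK} \<times> {..<NJ}" f n] f by (auto simp: sum_Times)
  have sw: "(\<Sum>k<NK. \<Sum>j<NJ. \<Sum>t<n. \<integral>y. w k j y * (y t)\<^sup>2 \<partial>std n) / real NK = real n"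
  proof -
    have "(\<Sum>k<NK. \<Sum>j<NJ. \<Sum>t<n. \<integral>y. w k j y / real NK * (y t)\<^sup>2 \<partial>std n) = real n"
      using second[of "\<lambda>u y. w (fst u) (snd u) y / real NK"] w w1 NK
      by (auto simp: sum_Times sum_divide_distrib[symmetric])
    then show ?thesis by (simp add: sum_divide_distrib)
  qed
  have sw': "(\<Sum>k<NK. \<Sum>j<NJ. \<Sum>t<n. \<integral>y. w' k j y * (y t)\<^sup>2 \<partial>std n) = real n"
    using second[of "\<lambda>u. w' (fst u) (snd u)"] w' w'1 by (auto simp: sum_Times)
  have dist: "(\<Sum>t<n. \<integral>\<^sup>+ z. ennreal ((fst z t - snd z t)\<^sup>2) \<partial>M) \<le> ennreal (real n * D)"
  proof -
    have "(\<Sum>t<n. \<integral>\<^sup>+ z. ennreal ((fst z t - snd z t)\<^sup>2) \<partial>M) = (\<Sum>t<n. \<Sum>k<NK. \<Sum>j<NJ. ennreal (c k j t))"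
    proof (intro sum.cong refl)
      fix t assume t: "t \<in> {..<n}"
      have "(\<integral>\<^sup>+ z. ennreal ((fst z t - snd z t)\<^sup>2) \<partial>M) =
        (\<Sum>k<NK. \<Sum>j<NJ. \<integral>\<^sup>+y. ennreal (w k j y / real NK) * (\<integral>\<^sup>+z. ennreal ((a y t - b z t)\<^sup>2) \<partial>\<delta> j k) \<partial>std n)"
        using t by (subst code) (auto intro!: measurable_compose[OF _ measurable_ennreal])
      then show "(\<integral>\<^sup>+ z. ennreal ((fst z t - snd z t)\<^sup>2) \<partial>M) = (\<Sum>k<NK. \<Sum>j<NJ. ennreal (c k j t))"
        using cell(1) t by simp
    qed
    also have "\<dots> = ennreal (\<Sum>t<n. \<Sum>k<NK. \<Sum>j<NJ. c k j t)"
    proof -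
      have "(\<Sum>t<n. \<Sum>k<NK. \<Sum>j<NJ. ennreal (c k j t)) = (\<Sum>t<n. \<Sum>k<NK. ennreal (\<Sum>j<NJ. c k j t))"
        using cell(2) by (intro sum.cong refl sum_ennreal) auto
      also have "\<dots> = (\<Sum>t<n. ennreal (\<Sum>k<NK. \<Sum>j<NJ. c k j t))"
        using cell(2) by (intro sum.cong refl sum_ennreal sum_nonneg) auto
      also have "\<dots> = ennreal (\<Sum>t<n. \<Sum>k<NK. \<Sum>j<NJ. c k j t)"
        using cell(2) by (intro sum_ennreal sum_nonneg) auto
      finally show ?thesis .
    qed
    also have "(\<Sum>t<n. \<Sum>k<NK. \<Sum>j<NJ. c k j t) = (\<Sum>k<NK. \<Sum>t<n. \<Sum>j<NJ. c k j t)" by (rule sum.swap)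
    also have "\<dots> = (\<Sum>k<NK. \<Sum>j<NJ. \<Sum>t<n. c k j t)" by (intro sum.cong refl sum.swap)
    also have "\<dots> = (\<Sum>k<NK. \<Sum>j<NJ. \<Sum>t<n. \<sigma>\<^sup>2 / real NK * (\<integral>y. w k j y * (y t)\<^sup>2 \<partial>std n) + s\<^sup>2 * (\<integral>y. w' k j y * (y t)\<^sup>2 \<partial>std n)
      - 2 * \<sigma> * s * (real NJ * ((\<integral>x. w k j x * x t \<partial>std n) * (\<integral>x. w' k j x * x t \<partial>std n))))"
      using cell(3) by (intro sum.cong refl) auto
    also have "\<dots> = \<sigma>\<^sup>2 * real n + s\<^sup>2 * real n - 2 * \<sigma> * s * (\<Sum>k<NK. \<Sum>j<NJ. \<Sum>t<n. real NJ * ((\<integral>x. w k j x * x t \<partial>std n) * (\<integral>x. w' k j x * x t \<partial>std n)))"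
      unfolding sum.distrib sum_subtractf sum_distrib_left[symmetric] sw' sw[symmetric] by simp
    also have "\<dots> \<le> real n * D"
    proof -
      have "2 * \<sigma> * s * (real n * (xi R Rc - e)) \<le> 2 * \<sigma> * s * (\<Sum>k<NK. \<Sum>j<NJ. \<Sum>t<n. real NJ * ((\<integral>x. w k j x * x t \<partial>std n) * (\<integral>x. w' k j x * x t \<partial>std n)))"
        using corr \<sigma> s by (intro mult_left_mono) auto
      moreover have "real n * D = \<sigma>\<^sup>2 * real n + s\<^sup>2 * real n - 2 * \<sigma> * s * (real n * (xi R Rc - e))"
        by (simp add: D_def algebra_simps)
      ultimately show ?thesis by linarith
    qed
    finally show ?thesis by (simp add: ennreal_leI)
  qed
  have "ennreal (1 / real n) * (\<Sum>t<n. \<integral>\<^sup>+ z. ennreal ((fst z t - snd z t)\<^sup>2) \<partial>M) \<le> ennreal D"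
    using mult_left_mono[OF dist, of "ennreal (1 / real n)"] inv[OF D0] by simp
  then show ?thesis
    unfolding achievable_def Let_def D_def[symmetric]
    using D0 V RJ RK perc q mq unfolding M_def by blast
qed

text \<open>The scale minimizes
  \<open>\<sigma>\<^sup>2 + s\<^sup>2 - 2 * \<sigma> * s * xi R Rc\<close> subject to
  \<open>(\<sigma> - s)\<^sup>2 \<le> P\<close>: it is the vertex \<open>\<sigma> * xi R Rc\<close>
  if that is admissible, and otherwise the nearest admissible scale
  \<open>\<sigma> - sqrt P\<close>. Nonemptiness is recorded for the lower bound, where
  \<open>cInf_greatest\<close> asks for it.\<close>

lemma RDP_le_D_upper:
  fixes \<mu> \<sigma> R Rc P :: real
  assumes \<sigma>: "0 < \<sigma>" and R: "0 \<le> R" and Rc: "0 \<le> Rc" and P: "0 \<le> P"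
  shows "RDP (gauss \<mu> \<sigma>) R Rc P \<le> D_upper \<sigma> R Rc P" "{D. achievable (gauss \<mu> \<sigma>) R Rc P D} \<noteq> {}"
proof -
  have xi: "0 \<le> xi R Rc" "xi R Rc \<le> 1"
    unfolding xi_def using R Rc by (auto intro!: real_le_lsqrt mult_le_one)
  obtain s where s: "0 \<le> s" "(\<sigma> - s)\<^sup>2 \<le> P" and DU: "D_upper \<sigma> R Rc P = \<sigma>\<^sup>2 + s\<^sup>2 - 2 * \<sigma> * s * xi R Rc"
  proof (cases "\<sigma> - sqrt P \<le> \<sigma> * xi R Rc")
    case True
    have "\<sigma> * xi R Rc \<le> \<sigma>" using xi \<sigma> by (simp add: mult_left_le)
    then have "(\<sigma> - \<sigma> * xi R Rc)\<^sup>2 \<le> (sqrt P)\<^sup>2" using True by (intro power_mono) auto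
    then show thesis
      using True xi \<sigma> P by (intro that[of "\<sigma> * xi R Rc"]) (auto simp: D_upper_def power_mult_distrib power2_eq_square)
  next
    case False
    moreover have "0 \<le> \<sigma> * xi R Rc" using xi \<sigma> by simp
    ultimately show thesis
      using P by (intro that[of "\<sigma> - sqrt P"]) (auto simp: D_upper_def)
  qed
  have ach: "achievable (gauss \<mu> \<sigma>) R Rc P (\<sigma>\<^sup>2 + s\<^sup>2 - 2 * \<sigma> * s * (xi R Rc - e))" if "0 < e" for e
    by (rule achievable_scaled_output[OF \<sigma> R Rc s that])
  from ach[of 1] show "{D. achievable (gauss \<mu> \<sigma>) R Rc P D} \<noteq> {}" by auto
  have bdd: "bdd_below {D. achievable (gauss \<mu> \<sigma>) R Rc P D}"
    by (intro bdd_belowI[of _ 0]) (simp add: achievable_def)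
  have "RDP (gauss \<mu> \<sigma>) R Rc P \<le> D_upper \<sigma> R Rc P + e" if e: "0 < e" for e
  proof -
    \<comment> \<open>\<open>s + 1\<close> in place of \<open>s\<close> avoids a division by 0,
      since the optimal scale is 0 when \<open>xi R Rc\<close> is 0 and the vertex is
      admissible.\<close>
    define e' where "e' = e / (2 * \<sigma> * (s + 1))"
    have e': "0 < e'" using e \<sigma> s by (simp add: e'_def)
    have "RDP (gauss \<mu> \<sigma>) R Rc P \<le> \<sigma>\<^sup>2 + s\<^sup>2 - 2 * \<sigma> * s * (xi R Rc - e')"
      unfolding RDP_def using ach[OF e'] by (intro cInf_lower bdd) auto
    also have "\<dots> = D_upper \<sigma> R Rc P + 2 * \<sigma> * s * e'" unfolding DU by (simp add: algebra_simps)
    also have "2 * \<sigma> * s * e' \<le> 2 * \<sigma> * (s + 1) * e'" using \<sigma> e' by (intro mult_right_mono) auto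
    also have "2 * \<sigma> * (s + 1) * e' = e" using \<sigma> s by (simp add: e'_def)
    finally show ?thesis by simp
  qed
  then show "RDP (gauss \<mu> \<sigma>) R Rc P \<le> D_upper \<sigma> R Rc P" by (rule field_le_epsilon)
qed

theorem theorem4:
  fixes \<mu> \<sigma> R Rc P :: real
  assumes "0 < \<sigma>" and "0 \<le> R" and "0 \<le> Rc" and "0 \<le> P"
  shows "D_lower \<sigma> R Rc P \<le> RDP (gauss \<mu> \<sigma>) R Rc P \<and> RDP (gauss \<mu> \<sigma>) R Rc P \<le> D_upper \<sigma> R Rc P"
proof
  show "D_lower \<sigma> R Rc P \<le> RDP (gauss \<mu> \<sigma>) R Rc P"
    unfolding RDP_def using RDP_le_D_upper(2)[OF assms] achievable_ge_D_lower[OF assms]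
    by (intro cInf_greatest) auto
  show "RDP (gauss \<mu> \<sigma>) R Rc P \<le> D_upper \<sigma> R Rc P" by (rule RDP_le_D_upper(1)[OF assms])
qed

end
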